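(* Let $\mathcal{P}$ be a toral poset constructed from the (contact) toral-pairs $\{(\mathcal{S}_i,\varphi_{\mathcal{S}_i})\}_{i=1}^n$ with construction sequence $\mathcal{S}_1=\mathcal{Q}_1\subset\mathcal{Q}_2\subset\cdots\subset\mathcal{Q}_n=\mathcal{P}$. Then $\mathcal{P}$ is contact (i.e. the Lie algebra $\mathfrak{g}_A(\mathcal{P})$ is contact) if and only if both of the following hold: 1. $(\mathcal{S}_i,\varphi_{\mathcal{S}_i})$ is a contact toral-pair for exactly one value of $i\in\{1,\dots,n\}$ (the remaining pairs being toral-pairs), and 2. $\mathcal{Q}_i$ is formed from $\mathcal{Q}_{i-1}$ and $\mathcal{S}_i$ by applying a rule from the set $\{A_1,A_2,C,D_1,D_2,F\}$, for each $i=2,\dots,n$.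
   Context: **Posets and Lie algebras.** All posets are finite; a poset is taken on $\mathcal{P}=\{1,\dots,n\}$, labelled so that $x\preceq y$ implies $x\le y$ as integers. $Rel(\mathcal{P})$ is the set of strict relations (pairs $(p,q)$ with $p\prec q$); $Ext(\mathcal{P})$ is the set of minimal and maximal elements. $\mathcal{P}$ is connected if its Hasse diagram is connected. An order ideal is a subset $I$ with $y\prec x\in I\Rightarrow y\in I$; a filter is a subset $F$ with $F\ni x\prec y\Rightarrow y\in F$. $\mathfrak{g}(\mathcal{P})$ is the complex Lie algebra with basis $E_{p,q}$ ($p\preceq q$), with commutator bracket of the product $E_{p,q}E_{r,s}=\delta_{q,r}E_{p,s}$; $\mathfrak{g}_A(\mathcal{P})$ is its subalgebra of trace-zero elements ($\sum c_{p,q}E_{p,q}$ has trace $\sum c_{p,p}$). For a one-form $\varphi\in\mathfrak{g}^*$, $d\varphi(x,y)=-\varphi([x,y])$, and the kernel of $d\varphi$ is $\{x: \varphi([x,y])=0\ \forall y\in\mathfrak{g}\}$. $\mathrm{ind}(\mathfrak{g})=\min_{\varphi\in\mathfrak g^*}\dim\ker(d\varphi)$. $\mathfrak{g}$ is Frobenius if $\mathrm{ind}(\mathfrak{g})=0$; a $\varphi$ with $\ker(d\varphi)=0$ is then a Frobenius one-form. A $(2k+1)$-dimensional $\mathfrak{g}$ is contact if some $\varphi\in\mathfrak{g}^*$ (a contact form) satisfies $\varphi\wedge(d\varphi)^k\neq0$. $\mathcal{P}$ is called Frobenius (contact) if $\mathfrak{g}_A(\mathcal{P})$ is. **One-forms.**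 $E^*_{p,q}$ ($p\preceq q$) is the functional taking an element to its coefficient of $E_{p,q}$. For a set $S$ of pairs $(p,q)$ with $p\preceq q$, $\varphi_S=\sum_{(p,q)\in S}E^*_{p,q}$; such a form may be regarded on $\mathfrak{g}(\mathcal{P})$ or on $\mathfrak{g}_A(\mathcal{P})$. $\ker(d\varphi)$ denotes the kernel for $\varphi$ on $\mathfrak{g}(\mathcal{P})$ and $\ker_A(d\varphi)$ the kernel for $\varphi$ on $\mathfrak{g}_A(\mathcal{P})$. For $S\subseteq Rel(\mathcal{P})$, $\Gamma_{\varphi_S}$ is the directed graph on $\mathcal{P}$ with edge $p\to q$ for $(p,q)\in S$; $\varphi_S$ is small if $\Gamma_{\varphi_S}$ is a spanning tree of the comparability graph of $\mathcal{P}$ (the graph on $\mathcal P$ joining comparable distinct elements). $U_{\varphi_S}(\mathcal{P})$, $D_{\varphi_S}(\mathcal{P})$, $O_{\varphi_S}(\mathcal{P})$ are the sets of sinks, of sources, and of the remaining vertices of $\Gamma_{\varphi_S}$. **Binary spectrum.** For a Frobenius Lie algebra with Frobenius one-form $\varphi$, let $\widehat\varphi$ be the unique element with $\varphi([\widehat\varphi,-])=\varphi$; the multiset of eigenvalues of $\mathrm{ad}(\widehat\varphi)$ is independent of $\varphi$ and is the spectrum. The spectrum is binary if it consists of an equal number of 0's and 1's. **Toral-pair.** $(\mathcal{P},\varphi)$ with $\mathcal{P}$ a Frobenius poset and $\varphi=\varphi_S$, $S\subseteq Rel(\mathcal{P})$, a Frobenius one-form on $\mathfrak{g}_A(\mathcal{P})$,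 such that: (P1) $|Ext(\mathcal{P})|\in\{2,3\}$; (P2) $\mathfrak{g}_A(\mathcal{P})$ has a binary spectrum; (F1) $\varphi$ is small; (F2) $U_\varphi(\mathcal{P})$ is a filter, $D_\varphi(\mathcal{P})$ is an order ideal, $O_\varphi(\mathcal{P})=\emptyset$; (F3) $\Gamma_\varphi$ contains all edges between comparable elements of $Ext(\mathcal{P})$; (F4) every $B\in\ker(d\varphi)$ satisfies $E^*_{p,p}(B)=E^*_{q,q}(B)$ for all $p,q\in\mathcal{P}$ and $E^*_{p,q}(B)=0$ for all $p\prec q$. **Contact toral-pair.** $(\mathcal{P},\varphi)$ with $\mathcal{P}$ a contact poset and $\varphi=\varphi_S$, $S\subseteq Rel(\mathcal{P})\cup\{(p,p):p\in\mathcal{P}\}$, a contact form on $\mathfrak{g}_A(\mathcal{P})$, such that: (CP1) $\mathcal{P}$ is connected; (CP2) $|Ext(\mathcal{P})|\in\{2,3\}$; (CF1) $E^*_{p,p}$ is a summand of $\varphi$ iff $p=1$; (CF2) $\varphi-E^*_{1,1}$ is small; (CF3) $U_{\varphi-E^*_{1,1}}(\mathcal{P})$ is a filter, $D_{\varphi-E^*_{1,1}}(\mathcal{P})$ is an order ideal, $O_{\varphi-E^*_{1,1}}(\mathcal{P})=\emptyset$; (CF4) $\Gamma_{\varphi-E^*_{1,1}}$ contains all edges between comparable elements of $Ext(\mathcal{P})$. "(Contact) toral-pair" means a toral-pair or a contact toral-pair. **Gluing rules.** Let $\mathcal{Q}$ be a poset and $\mathcal{S}$ (a disjoint copy of) the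 poset of a (contact) toral-pair. If $|Ext(\mathcal{S})|=2$ write $Ext(\mathcal{S})=\{a_1,c\}$ with $c\prec a_1$; if $|Ext(\mathcal{S})|=3$ write $Ext(\mathcal{S})=\{a_1,a_2,c\}$ with either $c\prec a_1,a_2$ or $a_1,a_2\prec c$. Combine $\mathcal{S}$ and $\mathcal{Q}$ by identifying some of $c,a_1,a_2$ with distinct elements $x,y,z\in Ext(\mathcal{Q})$ respectively, minimal elements with minimal elements and maximal with maximal, the relations being those inherited from $\mathcal{S}$ and $\mathcal{Q}$. Write $\sim$ / $\nsim$ for comparable / incomparable in $\mathcal{Q}$; "$=$" means identified, and elements not mentioned are not identified with anything (rules identifying $a_2$ apply only if $|Ext(\mathcal{S})|=3$). Rules: $A_1$: $a_1=y$ only. $A_2$: $a_2=z$ only. $B$: $a_1=y,\ a_2=z$ only. $C$: $c=x$ only. $D_1$: $c=x,\ a_1=y$, $y\sim x$. $D_2$: $c=x,\ a_2=z$, $z\sim x$. $E_1$: $c=x,\ a_1=y$, $y\nsim x$. $E_2$: $c=x,\ a_2=z$, $z\nsim x$. $F$: $c=x,a_1=y,a_2=z$, $y\sim x$, $z\sim x$. $G_1$: all three identified, $y\sim x$, $z\nsim x$. $G_2$: all three, $y\nsim x$, $z\sim x$. $H$: all three, $y\nsim x$, $z\nsim x$. **Toral poset.** $\mathcal{P}$ is toral if there are (contact) toral-pairs $\{(\mathcal{S}_i,\varphi_{\mathcal{S}_i})\}_{i=1}^n$ and posets $\mathcal{S}_1=\mathcal{Q}_1\subset\mathcal{Q}_2\subset\dots\subset\mathcal{Q}_n=\mathcal{P}$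 such that $\mathcal{Q}_i$ is formed from $\mathcal{Q}_{i-1}$ and $\mathcal{S}_i$ by one of the twelve rules, for $i=2,\dots,n$. Such a sequence is a construction sequence for $\mathcal{P}$. *)

theory Defs
  imports Complex_Main "HOL-Library.Function_Algebras" "HOL-Combinatorics.Permutations"
begin

section \<open>Finite posets\<close>

text \<open>
  A poset is its reflexive order relation \<open>r\<close>, with \<open>p \<preceq> q\<close> iff \<open>(p, q) \<in> r\<close>; by reflexivity
  its underlying set is \<open>Field r\<close>.
\<close>

definition labelled_poset :: "nat rel \<Rightarrow> bool" where
  "labelled_poset r \<longleftrightarrow>
     (\<exists>n. partial_order_on {1..n} r) \<and> (\<forall>(x, y)\<in>r. x \<le> y)"

definition Rel :: "'a rel \<Rightarrow> 'a rel" where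
  "Rel r = r - Id"

definition minimal_elements :: "'a rel \<Rightarrow> 'a set" where
  "minimal_elements r = {x \<in> Field r. \<forall>y. (y, x) \<notin> Rel r}"

definition maximal_elements :: "'a rel \<Rightarrow> 'a set" where
  "maximal_elements r = {x \<in> Field r. \<forall>y. (x, y) \<notin> Rel r}"

definition Ext :: "'a rel \<Rightarrow> 'a set" where
  "Ext r = minimal_elements r \<union> maximal_elements r"

definition comparable :: "'a rel \<Rightarrow> 'a \<Rightarrow> 'a \<Rightarrow> bool" where
  "comparable r x y \<longleftrightarrow> (x, y) \<in> r \<or> (y, x) \<in> r"

definition order_ideal :: "'a rel \<Rightarrow> 'a set \<Rightarrow> bool" where
  "order_ideal r I \<longleftrightarrow> I \<subseteq> Field r \<and> (\<forall>x\<in>I. \<forall>y. (y, x) \<in> Rel r \<longrightarrow> y \<in> I)"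

definition order_filter :: "'a rel \<Rightarrow> 'a set \<Rightarrow> bool" where
  "order_filter r F \<longleftrightarrow> F \<subseteq> Field r \<and> (\<forall>x\<in>F. \<forall>y. (x, y) \<in> Rel r \<longrightarrow> y \<in> F)"

definition hasse_edges :: "'a rel \<Rightarrow> 'a rel" where
  "hasse_edges r = {(p, q) \<in> Rel r. \<not> (\<exists>m. (p, m) \<in> Rel r \<and> (m, q) \<in> Rel r)}"


section \<open>Directed graphs given by edge sets\<close>

text \<open>
  Connectedness and cycles refer to the underlying undirected graph. (The trees of the
  \<open>Graph_Theory\<close> library only forbid directed cycles, hence do not fit here.)
\<close>

definition graph_connected :: "'a set \<Rightarrow> 'a rel \<Rightarrow> bool" where
  "graph_connected V E \<longleftrightarrow> (\<forall>p\<in>V. \<forall>q\<in>V. (p, q) \<in> (E \<union> E\<inverse>)\<^sup>*)"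

definition graph_cycle :: "'a rel \<Rightarrow> 'a list \<Rightarrow> bool" where
  "graph_cycle E vs \<longleftrightarrow> 3 \<le> length vs \<and> distinct vs \<and>
     (\<forall>i<length vs. (vs ! i, vs ! (Suc i mod length vs)) \<in> E \<union> E\<inverse>)"

definition sinks :: "'a set \<Rightarrow> 'a rel \<Rightarrow> 'a set" where
  "sinks V E = {p \<in> V. \<forall>q. (p, q) \<notin> E}"

definition sources :: "'a set \<Rightarrow> 'a rel \<Rightarrow> 'a set" where
  "sources V E = {p \<in> V. \<forall>q. (q, p) \<notin> E}"

definition other_vertices :: "'a set \<Rightarrow> 'a rel \<Rightarrow> 'a set" where
  "other_vertices V E = V - (sinks V E \<union> sources V E)"

definition connected_poset :: "'a rel \<Rightarrow> bool" where
  "connected_poset r \<longleftrightarrow> graph_connected (Field r) (hasse_edges r)"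

text \<open>
  The edge set \<open>E\<close> is a spanning tree of the comparability graph. As \<open>E \<subseteq> Rel r\<close> has no loops and
  no antiparallel edges, cycles of length at least 3 are the only ones to exclude.
\<close>

definition small :: "'a rel \<Rightarrow> 'a rel \<Rightarrow> bool" where
  "small r E \<longleftrightarrow> E \<subseteq> Rel r \<and> graph_connected (Field r) E \<and> \<not> (\<exists>vs. graph_cycle E vs)"


section \<open>The complex vector space of matrices indexed by pairs of elements\<close>

type_synonym pmat = "nat \<times> nat \<Rightarrow> complex"

definition pmat_scale :: "complex \<Rightarrow> pmat \<Rightarrow> pmat" where
  "pmat_scale c X = (\<lambda>pq. c * X pq)"

global_interpretation pmat: vector_space pmat_scale
  by unfold_locales (auto simp: pmat_scale_def fun_eq_iff algebra_simps)


section \<open>Lie algebras inside this space\<close>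

text \<open>
  A Lie algebra is given by its underlying subspace \<open>G\<close> and its bracket \<open>br\<close>. A one-form on \<open>G\<close> is
  a function on the whole matrix type of which only the restriction to \<open>G\<close> matters.
\<close>

definition one_form :: "pmat set \<Rightarrow> (pmat \<Rightarrow> complex) \<Rightarrow> bool" where
  "one_form G \<phi> \<longleftrightarrow>
     (\<forall>x\<in>G. \<forall>y\<in>G. \<phi> (x + y) = \<phi> x + \<phi> y) \<and> (\<forall>c. \<forall>x\<in>G. \<phi> (pmat_scale c x) = c * \<phi> x)"

definition form_kernel ::
  "pmat set \<Rightarrow> (pmat \<Rightarrow> pmat \<Rightarrow> pmat) \<Rightarrow> (pmat \<Rightarrow> complex) \<Rightarrow> pmat set" where
  "form_kernel G br \<phi> = {x \<in> G. \<forall>y\<in>G. \<phi> (br x y) = 0}"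

definition lie_index :: "pmat set \<Rightarrow> (pmat \<Rightarrow> pmat \<Rightarrow> pmat) \<Rightarrow> nat" where
  "lie_index G br = (LEAST d. \<exists>\<phi>. one_form G \<phi> \<and> d = pmat.dim (form_kernel G br \<phi>))"

definition frobenius :: "pmat set \<Rightarrow> (pmat \<Rightarrow> pmat \<Rightarrow> pmat) \<Rightarrow> bool" where
  "frobenius G br \<longleftrightarrow> lie_index G br = 0"

definition frobenius_form ::
  "pmat set \<Rightarrow> (pmat \<Rightarrow> pmat \<Rightarrow> pmat) \<Rightarrow> (pmat \<Rightarrow> complex) \<Rightarrow> bool" where
  "frobenius_form G br \<phi> \<longleftrightarrow> one_form G \<phi> \<and> form_kernel G br \<phi> = {0}"

definition principal_element ::
  "pmat set \<Rightarrow> (pmat \<Rightarrow> pmat \<Rightarrow> pmat) \<Rightarrow> (pmat \<Rightarrow> complex) \<Rightarrow> pmat" where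
  "principal_element G br \<phi> = (THE h. h \<in> G \<and> (\<forall>y\<in>G. \<phi> (br h y) = \<phi> y))"

text \<open>Algebraic multiplicity, as the dimension of the generalized eigenspace.\<close>

definition eigenvalue_mult :: "pmat set \<Rightarrow> (pmat \<Rightarrow> pmat) \<Rightarrow> complex \<Rightarrow> nat" where
  "eigenvalue_mult G T c =
     pmat.dim {x \<in> G. \<exists>k. ((\<lambda>y. T y - pmat_scale c y) ^^ k) x = 0}"

text \<open>
  The multiset of eigenvalues of \<open>ad\<close> of the principal element, as a multiplicity function. It does
  not depend on the choice of the Frobenius form, whence the quantifier in \<open>binary_spectrum\<close>.
\<close>

definition spectrum ::
  "pmat set \<Rightarrow> (pmat \<Rightarrow> pmat \<Rightarrow> pmat) \<Rightarrow> (pmat \<Rightarrow> complex) \<Rightarrow> complex \<Rightarrow> nat" where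
  "spectrum G br \<phi> = eigenvalue_mult G (br (principal_element G br \<phi>))"

definition binary_spectrum :: "pmat set \<Rightarrow> (pmat \<Rightarrow> pmat \<Rightarrow> pmat) \<Rightarrow> bool" where
  "binary_spectrum G br \<longleftrightarrow>
     (\<forall>\<phi>. frobenius_form G br \<phi> \<longrightarrow>
        (\<forall>c. c \<noteq> 0 \<and> c \<noteq> 1 \<longrightarrow> spectrum G br \<phi> c = 0) \<and>
        spectrum G br \<phi> 0 = spectrum G br \<phi> 1)"


section \<open>Exterior forms and contact forms\<close>

text \<open>
  A \<open>k\<close>-form is a function of the arguments \<open>x 0, \<dots>, x (k - 1)\<close>; the degrees are passed to the
  wedge product explicitly. The normalization is that of the usual product of alternating maps.
\<close>

type_synonym 'v form = "(nat \<Rightarrow> 'v) \<Rightarrow> complex"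

definition wedge :: "nat \<Rightarrow> nat \<Rightarrow> 'v form \<Rightarrow> 'v form \<Rightarrow> 'v form" where
  "wedge k l \<alpha> \<beta> = (\<lambda>x.
     (\<Sum>\<sigma> | \<sigma> permutes {..<k + l}.
        of_int (sign \<sigma>) * \<alpha> (\<lambda>i. x (\<sigma> i)) * \<beta> (\<lambda>i. x (\<sigma> (k + i)))) / (fact k * fact l))"

definition form_of_functional :: "('v \<Rightarrow> complex) \<Rightarrow> 'v form" where
  "form_of_functional \<phi> = (\<lambda>x. \<phi> (x 0))"

definition exterior_derivative :: "('v \<Rightarrow> 'v \<Rightarrow> 'v) \<Rightarrow> ('v \<Rightarrow> complex) \<Rightarrow> 'v form" where
  "exterior_derivative br \<phi> = (\<lambda>x. - \<phi> (br (x 0) (x 1)))"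

primrec wedge_power :: "'v form \<Rightarrow> nat \<Rightarrow> 'v form" where
  "wedge_power \<omega> 0 = (\<lambda>_. 1)"
| "wedge_power \<omega> (Suc k) = wedge 2 (2 * k) \<omega> (wedge_power \<omega> k)"

definition contact_form ::
  "pmat set \<Rightarrow> (pmat \<Rightarrow> pmat \<Rightarrow> pmat) \<Rightarrow> (pmat \<Rightarrow> complex) \<Rightarrow> bool" where
  "contact_form G br \<phi> \<longleftrightarrow> one_form G \<phi> \<and>
     (\<exists>k. pmat.dim G = 2 * k + 1 \<and>
       (\<exists>x. (\<forall>i. x i \<in> G) \<and>
          wedge 1 (2 * k) (form_of_functional \<phi>) (wedge_power (exterior_derivative br \<phi>) k) x \<noteq> 0))"

definition contact :: "pmat set \<Rightarrow> (pmat \<Rightarrow> pmat \<Rightarrow> pmat) \<Rightarrow> bool" where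
  "contact G br \<longleftrightarrow> (\<exists>\<phi>. contact_form G br \<phi>)"


section \<open>Lie poset algebras\<close>

definition lie_poset :: "nat rel \<Rightarrow> pmat set" where
  "lie_poset r = {X. \<forall>pq. pq \<notin> r \<longrightarrow> X pq = 0}"

definition lie_poset_A :: "nat rel \<Rightarrow> pmat set" where
  "lie_poset_A r = {X \<in> lie_poset r. (\<Sum>p\<in>Field r. X (p, p)) = 0}"

definition poset_mult :: "nat rel \<Rightarrow> pmat \<Rightarrow> pmat \<Rightarrow> pmat" where
  "poset_mult r X Y = (\<lambda>(p, s). \<Sum>q\<in>Field r. X (p, q) * Y (q, s))"

definition poset_bracket :: "nat rel \<Rightarrow> pmat \<Rightarrow> pmat \<Rightarrow> pmat" where
  "poset_bracket r X Y = poset_mult r X Y - poset_mult r Y X"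

definition frobenius_poset :: "nat rel \<Rightarrow> bool" where
  "frobenius_poset r \<longleftrightarrow> frobenius (lie_poset_A r) (poset_bracket r)"

definition contact_poset :: "nat rel \<Rightarrow> bool" where
  "contact_poset r \<longleftrightarrow> contact (lie_poset_A r) (poset_bracket r)"

text \<open>The one-form \<open>\<Sum>(p, q)\<in>E. E\<^sup>*\<^bsub>p,q\<^esub>\<close>; the edge set \<open>E\<close> is also that of its directed graph.\<close>

definition coord_form :: "nat rel \<Rightarrow> pmat \<Rightarrow> complex" where
  "coord_form E = (\<lambda>X. \<Sum>pq\<in>E. X pq)"


section \<open>Toral-pairs and contact toral-pairs\<close>

definition toral_pair :: "nat rel \<Rightarrow> (pmat \<Rightarrow> complex) \<Rightarrow> bool" where
  "toral_pair r \<phi> \<longleftrightarrow>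
     labelled_poset r \<and> frobenius_poset r \<and>
     card (Ext r) \<in> {2, 3} \<and>
     binary_spectrum (lie_poset_A r) (poset_bracket r) \<and>
     (\<exists>E \<subseteq> Rel r. \<phi> = coord_form E \<and>
        frobenius_form (lie_poset_A r) (poset_bracket r) \<phi> \<and>
        small r E \<and>
        order_filter r (sinks (Field r) E) \<and>
        order_ideal r (sources (Field r) E) \<and>
        other_vertices (Field r) E = {} \<and>
        (\<forall>p\<in>Ext r. \<forall>q\<in>Ext r. (p, q) \<in> Rel r \<longrightarrow> (p, q) \<in> E) \<and>
        (\<forall>B\<in>form_kernel (lie_poset r) (poset_bracket r) \<phi>.
           (\<forall>p\<in>Field r. \<forall>q\<in>Field r. B (p, p) = B (q, q)) \<and>
           (\<forall>(p, q)\<in>Rel r. B (p, q) = 0)))"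

text \<open>
  Below, \<open>E' = E - {(1, 1)}\<close> is the edge set of \<open>\<phi> - E\<^sup>*\<^bsub>1,1\<^esub>\<close>, as \<open>(1, 1) \<in> E\<close>.
\<close>

definition contact_toral_pair :: "nat rel \<Rightarrow> (pmat \<Rightarrow> complex) \<Rightarrow> bool" where
  "contact_toral_pair r \<phi> \<longleftrightarrow>
     labelled_poset r \<and> contact_poset r \<and>
     connected_poset r \<and>
     card (Ext r) \<in> {2, 3} \<and>
     (\<exists>E \<subseteq> Rel r \<union> Id_on (Field r). \<phi> = coord_form E \<and>
        contact_form (lie_poset_A r) (poset_bracket r) \<phi> \<and>
        (\<forall>p\<in>Field r. (p, p) \<in> E \<longleftrightarrow> p = 1) \<and>
        (let E' = E - {(1, 1)} in
          small r E' \<and>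
          order_filter r (sinks (Field r) E') \<and>
          order_ideal r (sources (Field r) E') \<and>
          other_vertices (Field r) E' = {} \<and>
          (\<forall>p\<in>Ext r. \<forall>q\<in>Ext r. (p, q) \<in> Rel r \<longrightarrow> (p, q) \<in> E')))"


section \<open>Gluing rules\<close>

datatype glue_rule =
  Rule_A1 | Rule_A2 | Rule_B | Rule_C | Rule_D1 | Rule_D2
| Rule_E1 | Rule_E2 | Rule_F | Rule_G1 | Rule_G2 | Rule_H

fun identified :: "glue_rule \<Rightarrow> 'a \<Rightarrow> 'a \<Rightarrow> 'a \<Rightarrow> 'a set" where
  "identified Rule_A1 c a\<^sub>1 a\<^sub>2 = {a\<^sub>1}"
| "identified Rule_A2 c a\<^sub>1 a\<^sub>2 = {a\<^sub>2}"
| "identified Rule_B  c a\<^sub>1 a\<^sub>2 = {a\<^sub>1, a\<^sub>2}"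
| "identified Rule_C  c a\<^sub>1 a\<^sub>2 = {c}"
| "identified Rule_D1 c a\<^sub>1 a\<^sub>2 = {c, a\<^sub>1}"
| "identified Rule_D2 c a\<^sub>1 a\<^sub>2 = {c, a\<^sub>2}"
| "identified Rule_E1 c a\<^sub>1 a\<^sub>2 = {c, a\<^sub>1}"
| "identified Rule_E2 c a\<^sub>1 a\<^sub>2 = {c, a\<^sub>2}"
| "identified Rule_F  c a\<^sub>1 a\<^sub>2 = {c, a\<^sub>1, a\<^sub>2}"
| "identified Rule_G1 c a\<^sub>1 a\<^sub>2 = {c, a\<^sub>1, a\<^sub>2}"
| "identified Rule_G2 c a\<^sub>1 a\<^sub>2 = {c, a\<^sub>1, a\<^sub>2}"
| "identified Rule_H  c a\<^sub>1 a\<^sub>2 = {c, a\<^sub>1, a\<^sub>2}"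

definition uses_a2 :: "glue_rule \<Rightarrow> bool" where
  "uses_a2 \<rho> \<longleftrightarrow> \<rho> \<in> {Rule_A2, Rule_B, Rule_D2, Rule_E2, Rule_F, Rule_G1, Rule_G2, Rule_H}"

fun side_condition :: "glue_rule \<Rightarrow> 'a rel \<Rightarrow> 'a \<Rightarrow> 'a \<Rightarrow> 'a \<Rightarrow> bool" where
  "side_condition Rule_D1 Q x y z \<longleftrightarrow> comparable Q y x"
| "side_condition Rule_D2 Q x y z \<longleftrightarrow> comparable Q z x"
| "side_condition Rule_E1 Q x y z \<longleftrightarrow> \<not> comparable Q y x"
| "side_condition Rule_E2 Q x y z \<longleftrightarrow> \<not> comparable Q z x"
| "side_condition Rule_F  Q x y z \<longleftrightarrow> comparable Q y x \<and> comparable Q z x"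
| "side_condition Rule_G1 Q x y z \<longleftrightarrow> comparable Q y x \<and> \<not> comparable Q z x"
| "side_condition Rule_G2 Q x y z \<longleftrightarrow> \<not> comparable Q y x \<and> comparable Q z x"
| "side_condition Rule_H  Q x y z \<longleftrightarrow> \<not> comparable Q y x \<and> \<not> comparable Q z x"
| "side_condition _ Q x y z \<longleftrightarrow> True"

text \<open>If there are only two extremal elements, \<open>a\<^sub>2\<close> is a dummy.\<close>

definition ext_labels :: "'a rel \<Rightarrow> 'a \<Rightarrow> 'a \<Rightarrow> 'a \<Rightarrow> bool" where
  "ext_labels S c a\<^sub>1 a\<^sub>2 \<longleftrightarrow>
     card (Ext S) = 2 \<and> Ext S = {a\<^sub>1, c} \<and> (c, a\<^sub>1) \<in> Rel S \<or>
     card (Ext S) = 3 \<and> Ext S = {a\<^sub>1, a\<^sub>2, c} \<and>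
       ((c, a\<^sub>1) \<in> Rel S \<and> (c, a\<^sub>2) \<in> Rel S \<or> (a\<^sub>1, c) \<in> Rel S \<and> (a\<^sub>2, c) \<in> Rel S)"

text \<open>
  \<open>R\<close> arises from \<open>Q\<close> and \<open>S\<close> by rule \<open>\<rho>\<close>, where \<open>R\<close> contains \<open>Q\<close> literally and \<open>S\<close> through the
  injection \<open>e\<close>: a vertex of \<open>S\<close> is identified with a vertex of \<open>Q\<close> iff \<open>e\<close> maps it into \<open>Q\<close>.
  As minimal elements are glued to minimal ones and maximal to maximal, the union of the two orders
  is already transitive and antisymmetric.
\<close>

definition glued ::
  "glue_rule \<Rightarrow> 'b rel \<Rightarrow> 'a rel \<Rightarrow> ('a \<Rightarrow> 'b) \<Rightarrow> 'b rel \<Rightarrow> bool" where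
  "glued \<rho> Q S e R \<longleftrightarrow>
     inj_on e (Field S) \<and> R = Q \<union> map_prod e e ` S \<and>
     (\<exists>c a\<^sub>1 a\<^sub>2. ext_labels S c a\<^sub>1 a\<^sub>2 \<and>
        (uses_a2 \<rho> \<longrightarrow> card (Ext S) = 3) \<and>
        e ` Field S \<inter> Field Q = e ` identified \<rho> c a\<^sub>1 a\<^sub>2 \<and>
        (\<forall>v\<in>identified \<rho> c a\<^sub>1 a\<^sub>2.
           v \<in> minimal_elements S \<and> e v \<in> minimal_elements Q \<or>
           v \<in> maximal_elements S \<and> e v \<in> maximal_elements Q) \<and>
        side_condition \<rho> Q (e c) (e a\<^sub>1) (e a\<^sub>2))"


section \<open>Construction sequences of toral posets\<close>

text \<open>
  Every \<open>Q i\<close> is a poset on a subset of the underlying set of \<open>P\<close>, and \<open>e i\<close> places a copy of the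
  separately labelled poset \<open>S i\<close> in it. All sequences are indexed by \<open>1, \<dots>, n\<close>.
\<close>

definition construction_sequence ::
  "nat rel \<Rightarrow> nat \<Rightarrow> (nat \<Rightarrow> nat rel) \<Rightarrow> (nat \<Rightarrow> pmat \<Rightarrow> complex) \<Rightarrow> (nat \<Rightarrow> nat rel) \<Rightarrow>
   (nat \<Rightarrow> nat \<Rightarrow> nat) \<Rightarrow> (nat \<Rightarrow> glue_rule) \<Rightarrow> bool" where
  "construction_sequence P n S \<phi> Q e \<rho> \<longleftrightarrow>
     labelled_poset P \<and> 1 \<le> n \<and>
     (\<forall>i\<in>{1..n}. toral_pair (S i) (\<phi> i) \<or> contact_toral_pair (S i) (\<phi> i)) \<and>
     inj_on (e 1) (Field (S 1)) \<and> Q 1 = map_prod (e 1) (e 1) ` S 1 \<and>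
     (\<forall>i\<in>{2..n}. glued (\<rho> i) (Q (i - 1)) (S i) (e i) (Q i)) \<and>
     Q n = P"

definition toral_poset :: "nat rel \<Rightarrow> bool" where
  "toral_poset P \<longleftrightarrow> (\<exists>n S \<phi> Q e \<rho>. construction_sequence P n S \<phi> Q e \<rho>)"

end

theory Submission
  imports Defs
begin

text \<open>
  Let \<open>D\<close> be the set of all sources of the trees of the pieces. It is an order ideal of \<open>P\<close>, and it cuts
  the relations of \<open>P\<close> (including the pairs \<open>(p, p)\<close>) into the \<^emph>\<open>crossing\<close> ones, which start in \<open>D\<close> and end
  outside, and the \<^emph>\<open>internal\<close> ones. Accordingly the full Lie algebra is the direct sum of an
  internal subalgebra \<open>g\<^sub>0\<close> and an abelian ideal \<open>g\<^sub>1\<close>, and the diagonal matrix \<open>h\<close> with ones exactly on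
  \<open>D\<close> acts on \<open>g\<^sub>0\<close> as \<open>0\<close> and on \<open>g\<^sub>1\<close> as the identity. Modulo the scalars let \<open>d\<^sub>0\<close> and \<open>d\<^sub>1\<close> be the
  dimensions of the two parts. Everything follows from comparing them.

  A toral-pair has \<open>d\<^sub>0 = d\<^sub>1\<close> and a contact toral-pair has \<open>d\<^sub>0 = d\<^sub>1 + 1\<close>, because \<open>d\<phi>\<close> vanishes on each of
  the two parts (\<open>card_internal_frobenius\<close>, \<open>card_internal_contact\<close>). Counting identified elements and
  relations, every gluing step adds the values of \<open>d\<^sub>0 - d\<^sub>1\<close> and subtracts an excess that is zero
  exactly for the rules \<open>A\<^sub>1, A\<^sub>2, C, D\<^sub>1, D\<^sub>2, F\<close> (\<open>card_glued\<close>). So \<open>d\<^sub>0 - d\<^sub>1 = c - b\<close> for \<open>P\<close>, where \<open>c\<close>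
  is the number of contact toral-pairs and \<open>b\<close> the total excess; the claim is that \<open>P\<close> is contact iff
  \<open>c = 1\<close> and \<open>b = 0\<close>.

  Let \<open>\<phi>\<close> be any contact form on \<open>P\<close>. It is nondegenerate in the sense that no nonzero \<open>w\<close> satisfies
  \<open>\<phi> w = 0\<close> and \<open>d\<phi> (w, -) = 0\<close> (\<open>contact_form_nondegenerate\<close>), so subspaces that are isotropic for
  \<open>d\<phi>\<close> have at most half of the dimension, rounded up. By \<open>d\<^sub>0 > d\<^sub>1\<close>, each contact piece contains a nonzero
  internal matrix that is zero at the extremal diagonal entries and acts trivially on \<open>g\<^sub>1\<close> under \<open>\<phi>\<close>
  (\<open>local_solution\<close>). Matrices from different pieces have zero product, so these \<open>c\<close> matrices and \<open>g\<^sub>1\<close>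
  span an isotropic subspace of dimension \<open>d\<^sub>1 + c\<close>; the bound becomes \<open>c + b \<le> 1\<close>
  (\<open>isotropic_bound\<close>). The case \<open>c = b = 0\<close> is excluded by the odd dimension, and in the case \<open>c = 0\<close>,
  \<open>b = 1\<close> some nonzero \<open>Y\<close> in \<open>g\<^sub>1\<close> is in the kernel of \<open>d\<phi>\<close>, whence \<open>\<phi> Y = \<phi> [h, Y] = 0\<close>
  (\<open>crossing_kernel\<close>). This leaves \<open>c = 1\<close>, \<open>b = 0\<close>.

  Conversely, if \<open>c = 1\<close> and \<open>b = 0\<close>, take the sum of \<open>E\<^sup>*\<^bsub>p,q\<^esub>\<close> over the edges of all trees, plus
  \<open>E\<^sup>*\<^bsub>v,v\<^esub>\<close> for the image \<open>v\<close> of \<open>1\<close> in the contact piece. An internal matrix annihilated by \<open>d\<phi>\<close>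
  is scalar on every toral piece with one common value, and the nondegeneracy of the contact piece
  determines it from its trace and its entry at \<open>(v, v)\<close> (\<open>internal_kernel_trivial\<close>). As \<open>d\<^sub>0 = d\<^sub>1 + 1\<close>,
  the corresponding linear system is square, and its solutions together with the matrix units of
  \<open>g\<^sub>1\<close> are a Darboux family, on which \<open>\<phi> \<and> (d\<phi>)\<^sup>k\<close> does not vanish (\<open>contact_form_if_darboux\<close>).
\<close>

section \<open>Systems of linear equations\<close>

lemma homogeneous_system_nontrivial:
  fixes a :: "'j \<Rightarrow> 'i \<Rightarrow> 'k::field"
  assumes "finite J" "finite I" "card J < card I"
  shows "\<exists>c. (\<exists>i\<in>I. c i \<noteq> 0) \<and> (\<forall>j\<in>J. (\<Sum>i\<in>I. a j i * c i) = 0)"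
  using assms
proof (induction J arbitrary: I a rule: finite_induct)
  case empty
  then have "I \<noteq> {}" by auto
  then show ?case by (intro exI[of _ "\<lambda>_. 1"]) auto
next
  case (insert j0 J)
  note fin = \<open>finite I\<close>
  show ?case
  proof (cases "\<exists>i0\<in>I. a j0 i0 \<noteq> 0")
    case False
    have "card J < card I" using insert by simp
    from insert.IH[OF fin this, of a] obtain c where
      "\<exists>i\<in>I. c i \<noteq> 0" "\<forall>j\<in>J. (\<Sum>i\<in>I. a j i * c i) = 0" by blast
    then show ?thesis using False by (intro exI[of _ c]) auto
  next
    case True
    then obtain i0 where i0: "i0 \<in> I" "a j0 i0 \<noteq> 0" by blast
    \<comment> \<open>equation \<open>j0\<close> is used to eliminate the unknown \<open>i0\<close>\<close>
    define I' where "I' = I - {i0}"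
    have fin': "finite I'" and card': "card J < card I'"
      using insert.prems insert.hyps i0 fin by (auto simp: I'_def)
    define b where "b j i = a j i - a j i0 * a j0 i / a j0 i0" for j i
    from insert.IH[OF fin' card', of b] obtain c where
      c: "\<exists>i\<in>I'. c i \<noteq> 0" "\<forall>j\<in>J. (\<Sum>i\<in>I'. b j i * c i) = 0" by blast
    define s where "s = (\<Sum>i\<in>I'. a j0 i * c i)"
    define d where "d = c(i0 := - s / a j0 i0)"
    have sum_I: "(\<Sum>i\<in>I. a j i * d i) = a j i0 * d i0 + (\<Sum>i\<in>I'. a j i * c i)" for j
    proof -
      have "(\<Sum>i\<in>I. a j i * d i) = a j i0 * d i0 + (\<Sum>i\<in>I'. a j i * d i)"
        using fin i0 by (simp add: I'_def sum.remove)
      also have "(\<Sum>i\<in>I'. a j i * d i) = (\<Sum>i\<in>I'. a j i * c i)"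
        by (rule sum.cong) (auto simp: I'_def d_def)
      finally show ?thesis .
    qed
    have "(\<Sum>i\<in>I. a j i * d i) = 0" if "j \<in> J" for j
    proof -
      have "0 = (\<Sum>i\<in>I'. b j i * c i)" using c that by simp
      also have "\<dots> = (\<Sum>i\<in>I'. a j i * c i) - a j i0 / a j0 i0 * s"
        unfolding s_def sum_distrib_left sum_subtractf[symmetric]
        by (rule sum.cong) (auto simp: b_def field_simps)
      also have "\<dots> = a j i0 * d i0 + (\<Sum>i\<in>I'. a j i * c i)"
        by (simp add: d_def)
      finally show ?thesis using sum_I by simp
    qed
    moreover have "(\<Sum>i\<in>I. a j0 i * d i) = 0"
      unfolding sum_I using i0 by (simp add: d_def s_def)
    moreover have "\<exists>i\<in>I. d i \<noteq> 0" using c by (auto simp: I'_def d_def)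
    ultimately show ?thesis by blast
  qed
qed

lemma injective_system_solvable:
  fixes a :: "'j \<Rightarrow> 'i \<Rightarrow> 'k::field"
  assumes fin: "finite J" "finite I" and card: "card J \<le> card I"
    and inj: "\<And>c. (\<And>j. j \<in> J \<Longrightarrow> (\<Sum>i\<in>I. a j i * c i) = 0) \<Longrightarrow> (\<And>i. i \<in> I \<Longrightarrow> c i = 0)"
  shows "\<exists>c. \<forall>j\<in>J. (\<Sum>i\<in>I. a j i * c i) = b j"
proof -
  \<comment> \<open>the right-hand side becomes the coefficient of one additional unknown\<close>
  define a' where "a' j u = (case u of None \<Rightarrow> - b j | Some i \<Rightarrow> a j i)" for j u
  have sum_opt: "(\<Sum>u\<in>insert None (Some ` I). a' j u * c u)
      = (\<Sum>i\<in>I. a j i * c (Some i)) - b j * c None" for j c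
  proof -
    have "(\<Sum>u\<in>insert None (Some ` I). a' j u * c u)
        = a' j None * c None + (\<Sum>u\<in>Some ` I. a' j u * c u)"
      using fin by (intro sum.insert) auto
    also have "(\<Sum>u\<in>Some ` I. a' j u * c u) = (\<Sum>i\<in>I. a' j (Some i) * c (Some i))"
      by (subst sum.reindex) (auto simp: o_def)
    finally show ?thesis by (simp add: a'_def)
  qed
  have fin': "finite (insert None (Some ` I))" using fin by simp
  have "card (insert None (Some ` I)) = Suc (card I)"
    using fin by (subst card_insert_disjoint) (auto simp: card_image)
  then have "card J < card (insert None (Some ` I))" using card by linarith
  from homogeneous_system_nontrivial[OF fin(1) fin' this, of a'] obtain c where
    c1: "\<exists>u\<in>insert None (Some ` I). c u \<noteq> 0"
    and c2: "\<forall>j\<in>J. (\<Sum>u\<in>insert None (Some ` I). a' j u * c u) = 0"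
    by blast
  have c: "(\<Sum>i\<in>I. a j i * c (Some i)) = b j * c None" if "j \<in> J" for j
  proof -
    have "(\<Sum>i\<in>I. a j i * c (Some i)) - b j * c None = 0"
      using bspec[OF c2 that] unfolding sum_opt .
    then show ?thesis by (rule eq_iff_diff_eq_0[THEN iffD2])
  qed
  have "c None \<noteq> 0"
  proof
    assume 0: "c None = 0"
    have "c (Some i) = 0" if i: "i \<in> I" for i
    proof (rule inj[of "\<lambda>i. c (Some i)", OF _ i])
      show "(\<Sum>i\<in>I. a j i * c (Some i)) = 0" if "j \<in> J" for j
        using c[OF that] 0 by simp
    qed
    with c1 0 show False by blast
  qed
  then have "(\<Sum>i\<in>I. a j i * (c (Some i) / c None)) = b j" if "j \<in> J" for j
  proof -
    have "(\<Sum>i\<in>I. a j i * (c (Some i) / c None)) = (\<Sum>i\<in>I. a j i * c (Some i)) / c None"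
      by (subst sum_divide_distrib) (rule sum.cong, simp_all)
    also have "\<dots> = b j"
      unfolding c[OF that] using \<open>c None \<noteq> 0\<close> by (rule nonzero_mult_div_cancel_right)
    finally show ?thesis .
  qed
  then show ?thesis by (intro exI[of _ "\<lambda>i. c (Some i) / c None"]) blast
qed

lemma family_dependent:
  assumes "finite I" "pmat.dim G < card I" "0 < pmat.dim G" "\<And>i. i \<in> I \<Longrightarrow> u i \<in> G"
  shows "\<exists>t. (\<exists>i\<in>I. t i \<noteq> 0) \<and> (\<Sum>i\<in>I. pmat_scale (t i) (u i)) = 0"
proof -
  obtain B where B: "B \<subseteq> G" "pmat.independent B" "G \<subseteq> pmat.span B" "card B = pmat.dim G"
    using pmat.basis_exists[of G] .
  have "finite B" using B(4) assms(3) card_gt_0_iff by metis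
  define R where "R = pmat.representation B"
  obtain t where t: "\<exists>i\<in>I. t i \<noteq> 0" "\<And>b. b \<in> B \<Longrightarrow> (\<Sum>i\<in>I. R (u i) b * t i) = 0"
    using homogeneous_system_nontrivial[OF \<open>finite B\<close> assms(1), of "\<lambda>b i. R (u i) b"] B(4) assms(2)
    by auto
  have u: "u i = (\<Sum>b\<in>B. pmat_scale (R (u i) b) b)" if "i \<in> I" for i
    unfolding R_def using B \<open>finite B\<close> assms(4)[OF that]
    by (intro pmat.sum_representation_eq[symmetric]) auto
  have "(\<Sum>i\<in>I. pmat_scale (t i) (u i)) = (\<Sum>i\<in>I. \<Sum>b\<in>B. pmat_scale (R (u i) b * t i) b)"
    by (rule sum.cong, simp, subst u, assumption) (simp add: pmat.scale_sum_right mult.commute)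
  also have "\<dots> = (\<Sum>b\<in>B. pmat_scale (\<Sum>i\<in>I. R (u i) b * t i) b)"
    by (subst sum.swap) (simp add: pmat.scale_sum_left)
  also have "\<dots> = 0" by (rule sum.neutral) (simp add: t)
  finally show ?thesis using t by blast
qed

section \<open>Contact forms are nondegenerate\<close>

definition multilinear_on :: "pmat set \<Rightarrow> nat \<Rightarrow> pmat form \<Rightarrow> bool" where
  "multilinear_on G k \<alpha> \<longleftrightarrow>
     (\<forall>x j v. k \<le> j \<longrightarrow> \<alpha> (x(j := v)) = \<alpha> x) \<and>
     (\<forall>x j u v. (\<forall>i. x i \<in> G) \<and> u \<in> G \<and> v \<in> G \<and> j < k \<longrightarrow>
        \<alpha> (x(j := u + v)) = \<alpha> (x(j := u)) + \<alpha> (x(j := v))) \<and>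
     (\<forall>x j u c. (\<forall>i. x i \<in> G) \<and> u \<in> G \<and> j < k \<longrightarrow>
        \<alpha> (x(j := pmat_scale c u)) = c * \<alpha> (x(j := u)))"

definition null_at :: "pmat set \<Rightarrow> nat \<Rightarrow> pmat form \<Rightarrow> pmat \<Rightarrow> bool" where
  "null_at G k \<alpha> w \<longleftrightarrow> (\<forall>x. (\<forall>i. x i \<in> G) \<and> (\<exists>j<k. x j = w) \<longrightarrow> \<alpha> x = 0)"

lemma fun_upd_permuted:
  assumes "\<sigma> permutes A"
  shows "(\<lambda>i. (x(j := v)) (\<sigma> i)) = (\<lambda>i. x (\<sigma> i))(inv \<sigma> j := v)"
  using permutes_inverses[OF assms] by (auto simp: fun_eq_iff)

text \<open>
  Slot \<open>j\<close> of the product lands in slot \<open>inv \<sigma> j\<close>, which belongs to exactly one of the two factors;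
  multilinearity of a wedge product thus reduces to that of its factors.
\<close>

lemma wedge_summand_upd:
  fixes k l :: nat
  assumes \<sigma>: "\<sigma> permutes {..<k + l}"
    and \<alpha>: "\<forall>x j v. k \<le> j \<longrightarrow> \<alpha> (x(j := v)) = \<alpha> x"
  obtains (left) j' where "j' < k" "j < k + l"
      "\<And>v. (\<lambda>i. (x(j := v)) (\<sigma> i)) = (\<lambda>i. x (\<sigma> i))(j' := v)"
      "\<And>v. (\<lambda>i. (x(j := v)) (\<sigma> (k + i))) = (\<lambda>i. x (\<sigma> (k + i)))"
    | (right) j' where "j' < l" "j < k + l"
      "\<And>v. \<alpha> (\<lambda>i. (x(j := v)) (\<sigma> i)) = \<alpha> (\<lambda>i. x (\<sigma> i))"
      "\<And>v. (\<lambda>i. (x(j := v)) (\<sigma> (k + i))) = (\<lambda>i. x (\<sigma> (k + i)))(j' := v)"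
    | (outside) j' where "k + l \<le> j" "l \<le> j'"
      "\<And>v. \<alpha> (\<lambda>i. (x(j := v)) (\<sigma> i)) = \<alpha> (\<lambda>i. x (\<sigma> i))"
      "\<And>v. (\<lambda>i. (x(j := v)) (\<sigma> (k + i))) = (\<lambda>i. x (\<sigma> (k + i)))(j' := v)"
proof -
  let ?m = "inv \<sigma> j"
  have upd: "(\<lambda>i. (x(j := v)) (\<sigma> i)) = (\<lambda>i. x (\<sigma> i))(?m := v)" for v
    by (rule fun_upd_permuted[OF \<sigma>])
  have upd': "(x(j := v)) (\<sigma> i) = ((\<lambda>i. x (\<sigma> i))(?m := v)) i" for v i
    using fun_cong[OF upd[of v]] .
  show thesis
  proof (cases "?m < k")
    case True
    then have "?m \<in> {..<k + l}" by (simp add: trans_less_add1)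
    then have "j < k + l"
      using permutes_in_image[OF permutes_inv[OF \<sigma>], of j] by simp
    moreover have "(\<lambda>i. (x(j := v)) (\<sigma> (k + i))) = (\<lambda>i. x (\<sigma> (k + i)))" for v
      unfolding upd' using True by auto
    ultimately show thesis using left[OF True] upd by blast
  next
    case False
    then obtain j' where j': "?m = k + j'" using le_Suc_ex not_less by blast
    have l: "\<alpha> (\<lambda>i. (x(j := v)) (\<sigma> i)) = \<alpha> (\<lambda>i. x (\<sigma> i))" for v
      unfolding upd using False \<alpha> by simp
    have r: "(\<lambda>i. (x(j := v)) (\<sigma> (k + i))) = (\<lambda>i. x (\<sigma> (k + i)))(j' := v)" for v
      unfolding upd' j' by auto
    show thesis
    proof (cases "j < k + l")
      case True
      then have "j' < l"
        using permutes_in_image[OF permutes_inv[OF \<sigma>], of j] j' by (auto simp: lessThan_iff)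
      then show thesis using right[OF _ True l r] by blast
    next
      case False
      then have "l \<le> j'"
        using permutes_in_image[OF permutes_inv[OF \<sigma>], of j] j' by (auto simp: lessThan_iff)
      then show thesis using outside[OF _ _ l r] False by simp
    qed
  qed
qed

lemma multilinear_on_wedge:
  assumes \<alpha>: "multilinear_on G k \<alpha>" and \<beta>: "multilinear_on G l \<beta>"
  shows "multilinear_on G (k + l) (wedge k l \<alpha> \<beta>)"
proof -
  define t where "t x \<sigma> = of_int (sign \<sigma>) * \<alpha> (\<lambda>i. x (\<sigma> i)) * \<beta> (\<lambda>i. x (\<sigma> (k + i)))"
    for x \<sigma>
  have wedge_eq: "wedge k l \<alpha> \<beta> x = (\<Sum>\<sigma> | \<sigma> permutes {..<k + l}. t x \<sigma>) / (fact k * fact l)"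
    for x by (simp add: wedge_def t_def)
  note \<alpha>0 = \<alpha>[unfolded multilinear_on_def, THEN conjunct1]
  note \<alpha>1 = \<alpha>[unfolded multilinear_on_def, THEN conjunct2, THEN conjunct1, rule_format]
  note \<alpha>2 = \<alpha>[unfolded multilinear_on_def, THEN conjunct2, THEN conjunct2, rule_format]
  note \<beta>0 = \<beta>[unfolded multilinear_on_def, THEN conjunct1, rule_format]
  note \<beta>1 = \<beta>[unfolded multilinear_on_def, THEN conjunct2, THEN conjunct1, rule_format]
  note \<beta>2 = \<beta>[unfolded multilinear_on_def, THEN conjunct2, THEN conjunct2, rule_format]
  have t0: "t (x(j := v)) \<sigma> = t x \<sigma>" if "\<sigma> permutes {..<k + l}" "k + l \<le> j" for x j v \<sigma>
    by (rule wedge_summand_upd[OF that(1) \<alpha>0, of j x])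
      (use that in \<open>auto simp: t_def \<beta>0 simp del: fun_upd_apply\<close>)
  have t1: "t (x(j := u + v)) \<sigma> = t (x(j := u)) \<sigma> + t (x(j := v)) \<sigma>"
    if "\<sigma> permutes {..<k + l}" "j < k + l" "\<forall>i. x i \<in> G" "u \<in> G" "v \<in> G" for x j u v \<sigma>
    by (rule wedge_summand_upd[OF that(1) \<alpha>0, of j x])
      (use that in \<open>auto simp: t_def \<alpha>1 \<beta>1 algebra_simps simp del: fun_upd_apply\<close>)
  have t2: "t (x(j := pmat_scale c u)) \<sigma> = c * t (x(j := u)) \<sigma>"
    if "\<sigma> permutes {..<k + l}" "j < k + l" "\<forall>i. x i \<in> G" "u \<in> G" for x j u c \<sigma>
    by (rule wedge_summand_upd[OF that(1) \<alpha>0, of j x])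
      (use that in \<open>auto simp: t_def \<alpha>2 \<beta>2 simp del: fun_upd_apply\<close>)
  show ?thesis
    unfolding multilinear_on_def wedge_eq
    by (auto simp: t0 t1 t2 sum.distrib add_divide_distrib sum_distrib_left[symmetric]
        simp del: fun_upd_apply)
qed

lemma null_at_wedge:
  assumes \<alpha>: "null_at G k \<alpha> w" and \<beta>: "null_at G l \<beta> w"
  shows "null_at G (k + l) (wedge k l \<alpha> \<beta>) w"
  unfolding null_at_def
proof (intro allI impI)
  fix x assume x: "(\<forall>i. x i \<in> G) \<and> (\<exists>j<k + l. x j = w)"
  then obtain j where j: "j < k + l" "x j = w" by blast
  have "of_int (sign \<sigma>) * \<alpha> (\<lambda>i. x (\<sigma> i)) * \<beta> (\<lambda>i. x (\<sigma> (k + i))) = 0"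
    if \<sigma>: "\<sigma> permutes {..<k + l}" for \<sigma>
  proof (cases "inv \<sigma> j < k")
    case True
    then have "\<alpha> (\<lambda>i. x (\<sigma> i)) = 0"
      using \<alpha>[unfolded null_at_def, rule_format, of "\<lambda>i. x (\<sigma> i)"] x j permutes_inverses(1)[OF \<sigma>]
      by metis
    then show ?thesis by simp
  next
    case False
    then obtain j' where j': "inv \<sigma> j = k + j'" using le_Suc_ex not_less by blast
    then have "j' < l"
      using permutes_in_image[OF permutes_inv[OF \<sigma>], of j] j by (auto simp: lessThan_iff)
    then have "\<beta> (\<lambda>i. x (\<sigma> (k + i))) = 0"
      using \<beta>[unfolded null_at_def, rule_format, of "\<lambda>i. x (\<sigma> (k + i))"] x j
        permutes_inverses(1)[OF \<sigma>] j' by metis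
    then show ?thesis by simp
  qed
  then show "wedge k l \<alpha> \<beta> x = 0"
    unfolding wedge_def by (subst sum.neutral) auto
qed

lemma wedge_permute:
  assumes \<tau>: "\<tau> permutes {..<k + l}"
  shows "wedge k l \<alpha> \<beta> (\<lambda>i. x (\<tau> i)) = of_int (sign \<tau>) * wedge k l \<alpha> \<beta> x"
proof -
  define t where "t \<sigma> = \<alpha> (\<lambda>i. x (\<sigma> i)) * \<beta> (\<lambda>i. x (\<sigma> (k + i)))" for \<sigma>
  have s: "sign \<sigma> = sign \<tau> * sign (\<tau> \<circ> \<sigma>)" if "\<sigma> permutes {..<k + l}" for \<sigma>
    using that \<tau> permutation_permutes finite_lessThan
    by (subst sign_compose) (auto simp: mult.assoc[symmetric])
  have "(\<Sum>\<sigma> | \<sigma> permutes {..<k + l}. of_int (sign \<sigma>) * t (\<tau> \<circ> \<sigma>))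
      = (\<Sum>\<sigma> | \<sigma> permutes {..<k + l}. of_int (sign \<tau>) * (of_int (sign (\<tau> \<circ> \<sigma>)) * t (\<tau> \<circ> \<sigma>)))"
    by (rule sum.cong) (auto simp: s mult.assoc)
  also have "\<dots> = of_int (sign \<tau>) * (\<Sum>\<sigma> | \<sigma> permutes {..<k + l}. of_int (sign \<sigma>) * t \<sigma>)"
    unfolding sum_distrib_left[symmetric]
    by (subst setum_permutations_compose_left[OF \<tau>, of "\<lambda>\<sigma>. of_int (sign \<sigma>) * t \<sigma>"]) simp
  finally show ?thesis by (simp add: wedge_def t_def mult.assoc)
qed

lemma wedge_repeated_argument:
  assumes "i < k + l" "j < k + l" "i \<noteq> j" "x i = x j"
  shows "wedge k l \<alpha> \<beta> x = 0"
proof -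
  have "(\<lambda>m. x (transpose i j m)) = x"
    using assms(4) by (auto simp: fun_eq_iff transpose_def)
  then have "wedge k l \<alpha> \<beta> x = - wedge k l \<alpha> \<beta> x"
    using wedge_permute[of "transpose i j" k l \<alpha> \<beta> x] assms
    by (simp add: permutes_swap_id sign_swap_id)
  then show ?thesis by simp
qed

lemma multilinear_on_sum:
  assumes \<alpha>: "multilinear_on G k \<alpha>" and G: "pmat.subspace G"
    and "finite A" "j < k" "\<forall>i. x i \<in> G" "\<And>a. a \<in> A \<Longrightarrow> u a \<in> G"
  shows "\<alpha> (x(j := (\<Sum>a\<in>A. pmat_scale (t a) (u a)))) = (\<Sum>a\<in>A. t a * \<alpha> (x(j := u a)))"
  using assms(3,6)
proof (induction A rule: finite_induct)
  case empty
  have "\<alpha> (x(j := pmat_scale 0 0)) = 0 * \<alpha> (x(j := 0))"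
    using \<alpha> assms(4,5) pmat.subspace_0[OF G] unfolding multilinear_on_def by blast
  then show ?case by (simp only: pmat.scale_zero_left sum.empty mult_zero_left)
next
  case (insert a A)
  have "(\<Sum>a\<in>A. pmat_scale (t a) (u a)) \<in> G"
    using insert G by (auto intro!: pmat.subspace_sum pmat.subspace_scale)
  moreover have "pmat_scale (t a) (u a) \<in> G"
    using insert G by (auto intro!: pmat.subspace_scale)
  ultimately have "\<alpha> (x(j := pmat_scale (t a) (u a) + (\<Sum>a\<in>A. pmat_scale (t a) (u a))))
     = \<alpha> (x(j := pmat_scale (t a) (u a))) + \<alpha> (x(j := (\<Sum>a\<in>A. pmat_scale (t a) (u a))))"
    using \<alpha> assms(4,5) unfolding multilinear_on_def by blast
  moreover have "\<alpha> (x(j := pmat_scale (t a) (u a))) = t a * \<alpha> (x(j := u a))"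
    using \<alpha> assms(4,5) insert.prems[of a] unfolding multilinear_on_def by blast
  moreover have "\<alpha> (x(j := (\<Sum>a\<in>A. pmat_scale (t a) (u a)))) = (\<Sum>a\<in>A. t a * \<alpha> (x(j := u a)))"
    using insert by blast
  ultimately show ?case by (simp only: sum.insert[OF insert.hyps])
qed

definition bracket_on :: "pmat set \<Rightarrow> (pmat \<Rightarrow> pmat \<Rightarrow> pmat) \<Rightarrow> bool" where
  "bracket_on G br \<longleftrightarrow> pmat.subspace G \<and> (\<forall>x\<in>G. \<forall>y\<in>G. br x y \<in> G \<and> br x y + br y x = 0) \<and>
     (\<forall>x y z. br (x + y) z = br x z + br y z) \<and>
     (\<forall>c x z. br (pmat_scale c x) z = pmat_scale c (br x z)) \<and>
     (\<forall>x y z. br z (x + y) = br z x + br z y) \<and>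
     (\<forall>c x z. br z (pmat_scale c x) = pmat_scale c (br z x))"

lemma multilinear_wedge_power:
  assumes br: "bracket_on G br" and \<phi>: "one_form G \<phi>"
  shows "multilinear_on G (2 * k) (wedge_power (exterior_derivative br \<phi>) k)"
proof (induction k)
  case 0
  show ?case by (simp add: multilinear_on_def)
next
  case (Suc k)
  have "multilinear_on G 2 (exterior_derivative br \<phi>)"
  proof -
    have br': "br (x + y) z = br x z + br y z" "br (pmat_scale c x) z = pmat_scale c (br x z)"
      "br z (x + y) = br z x + br z y" "br z (pmat_scale c x) = pmat_scale c (br z x)" for c x y z
      using br by (simp_all add: bracket_on_def)
    have closed: "br x y \<in> G" if "x \<in> G" "y \<in> G" for x y
      using br that by (simp add: bracket_on_def)
    have \<phi>1: "\<phi> (x + y) = \<phi> x + \<phi> y" if "x \<in> G" "y \<in> G" for x y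
      using \<phi> that by (simp add: one_form_def)
    have \<phi>2: "\<phi> (pmat_scale c x) = c * \<phi> x" if "x \<in> G" for c x
      using \<phi> that by (simp add: one_form_def)
    show ?thesis
      unfolding multilinear_on_def exterior_derivative_def
      by (auto simp: less_2_cases_iff br' closed \<phi>1 \<phi>2)
  qed
  from multilinear_on_wedge[OF this Suc.IH] show ?case by simp
qed

lemma null_at_wedge_power:
  assumes "\<And>y. y \<in> G \<Longrightarrow> \<phi> (br w y) = 0" "\<And>y. y \<in> G \<Longrightarrow> \<phi> (br y w) = 0"
  shows "null_at G (2 * k) (wedge_power (exterior_derivative br \<phi>) k) w"
proof (induction k)
  case 0
  show ?case by (simp add: null_at_def)
next
  case (Suc k)
  have "null_at G 2 (exterior_derivative br \<phi>) w"
    using assms by (auto simp: null_at_def exterior_derivative_def less_2_cases_iff)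
  from null_at_wedge[OF this Suc.IH] show ?case by simp
qed

lemma one_form_uminus:
  assumes "one_form G \<phi>" "x \<in> G"
  shows "\<phi> (- x) = - \<phi> x"
proof -
  have "\<phi> (pmat_scale (- 1) x) = - 1 * \<phi> x" using assms unfolding one_form_def by blast
  then show ?thesis by simp
qed

text \<open>
  If \<open>w\<close> lies in the kernels of both \<open>\<phi>\<close> and \<open>d\<phi>\<close>, then \<open>\<phi> \<and> (d\<phi>)\<^sup>k\<close> vanishes as soon as one
  argument is \<open>w\<close>. Any \<open>2k + 1\<close> arguments are linearly dependent together with \<open>w\<close>, so one of them
  may be replaced by a multiple of \<open>w\<close> without changing the value up to a nonzero factor.
\<close>

lemma contact_form_nondegenerate:
  assumes br: "bracket_on G br" and contact: "contact_form G br \<phi>"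
    and w: "w \<in> G" "\<phi> w = 0" "\<And>y. y \<in> G \<Longrightarrow> \<phi> (br w y) = 0"
  shows "w = 0"
proof (rule ccontr)
  assume "w \<noteq> 0"
  have G: "pmat.subspace G" using br by (simp add: bracket_on_def)
  from contact obtain k x where \<phi>: "one_form G \<phi>" and dim: "pmat.dim G = 2 * k + 1"
    and x: "\<forall>i. x i \<in> G"
    and nz: "wedge 1 (2 * k) (form_of_functional \<phi>) (wedge_power (exterior_derivative br \<phi>) k) x \<noteq> 0"
    unfolding contact_form_def by blast
  define F where
    "F = wedge 1 (2 * k) (form_of_functional \<phi>) (wedge_power (exterior_derivative br \<phi>) k)"
  have w0: "pmat_scale s w \<in> G" "\<phi> (pmat_scale s w) = 0" for s
    using w \<phi> G by (auto simp: one_form_def intro: pmat.subspace_scale)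
  have w1: "\<phi> (br (pmat_scale s w) y) = 0" "\<phi> (br y (pmat_scale s w)) = 0" if "y \<in> G" for s y
  proof -
    have "br (pmat_scale s w) y = pmat_scale s (br w y)" "br w y \<in> G"
      using br w that unfolding bracket_on_def by blast+
    then show "\<phi> (br (pmat_scale s w) y) = 0" using \<phi> w(3)[OF that] by (simp add: one_form_def)
    moreover have "br (pmat_scale s w) y + br y (pmat_scale s w) = 0" "br (pmat_scale s w) y \<in> G"
      using br w0 that unfolding bracket_on_def by blast+
    ultimately show "\<phi> (br y (pmat_scale s w)) = 0"
      using one_form_uminus[OF \<phi>] by (metis add.inverse_unique neg_equal_0_iff_equal)
  qed
  have F_lin: "multilinear_on G (1 + 2 * k) F"
    unfolding F_def
    by (rule multilinear_on_wedge[OF _ multilinear_wedge_power[OF br \<phi>]])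
      (use \<phi> in \<open>auto simp: multilinear_on_def form_of_functional_def one_form_def\<close>)
  have F_null: "null_at G (1 + 2 * k) F (pmat_scale s w)" for s
    unfolding F_def
    by (rule null_at_wedge[OF _ null_at_wedge_power[where w = "pmat_scale s w" and G = G and br = br and \<phi> = \<phi>, OF w1]])
      (auto simp: null_at_def form_of_functional_def w0)
  define u where "u i = (case i of None \<Rightarrow> w | Some j \<Rightarrow> x j)" for i
  define I where "I = insert None (Some ` {..<1 + 2 * k})"
  have "card I = 2 * k + 2" "finite I"
    unfolding I_def by (subst card_insert_disjoint) (auto simp: card_image)
  moreover have "u i \<in> G" for i using x w by (simp add: u_def split: option.split)
  ultimately obtain t where t: "\<exists>i\<in>I. t i \<noteq> 0" "(\<Sum>i\<in>I. pmat_scale (t i) (u i)) = 0"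
    using family_dependent[of I G u] dim by auto
  have sum_eq: "(\<Sum>j<1 + 2 * k. pmat_scale (t (Some j)) (x j)) = pmat_scale (- t None) w"
  proof -
    have "pmat_scale (t None) w + (\<Sum>j<1 + 2 * k. pmat_scale (t (Some j)) (x j)) = 0"
      using t(2) unfolding I_def by (subst (asm) sum.insert) (auto simp: sum.reindex u_def)
    then show ?thesis
      by (metis add.inverse_unique pmat.scale_minus_left)
  qed
  obtain m where m: "m < 1 + 2 * k" "t (Some m) \<noteq> 0"
  proof (rule ccontr)
    assume "\<not> thesis"
    with that have all0: "t (Some j) = 0" if "j < 1 + 2 * k" for j using that by blast
    then have "pmat_scale (- t None) w = 0" using sum_eq by simp
    with \<open>w \<noteq> 0\<close> have "t None = 0" using pmat.scale_eq_0_iff by fastforce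
    with all0 t(1) show False by (auto simp: I_def)
  qed
  have "F (x(m := pmat_scale (- t None) w)) = 0"
    using F_null[of "- t None"] m(1) x w0(1)[of "- t None"] unfolding null_at_def
    by (metis fun_upd_apply)
  moreover have "F (x(m := pmat_scale (- t None) w)) = (\<Sum>j<1 + 2 * k. t (Some j) * F (x(m := x j)))"
    unfolding sum_eq[symmetric] using m x
    by (intro multilinear_on_sum[OF F_lin G]) auto
  moreover have "\<dots> = (\<Sum>j<1 + 2 * k. if j = m then t (Some m) * F x else 0)"
  proof (rule sum.cong)
    fix j assume j: "j \<in> {..<1 + 2 * k}"
    show "t (Some j) * F (x(m := x j)) = (if j = m then t (Some m) * F x else 0)"
    proof (cases "j = m")
      case False
      then have "F (x(m := x j)) = 0"
        unfolding F_def using j m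
        by (intro wedge_repeated_argument[of m 1 "2 * k" j]) auto
      then show ?thesis using False by simp
    qed simp
  qed simp
  moreover have "(\<Sum>j<1 + 2 * k. if j = m then t (Some m) * F x else 0) = t (Some m) * F x"
    using m(1) by (subst sum.delta) (simp_all only: finite_lessThan lessThan_iff if_True)
  ultimately have "t (Some m) * F x = 0" by simp
  with m(2) have "F x = 0" by simp
  then show False using nz by (simp add: F_def)
qed

section \<open>Contact forms from Darboux families\<close>

definition alternating_sum :: "nat \<Rightarrow> 'v form \<Rightarrow> 'v form" where
  "alternating_sum m f = (\<lambda>x. \<Sum>\<sigma> | \<sigma> permutes {..<m}. of_int (sign \<sigma>) * f (\<lambda>i. x (\<sigma> i)))"

text \<open>
  A permutation of the last \<open>l\<close> of \<open>k + l\<close> slots does not affect the first factor, so all \<open>l!\<close> of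
  them contribute the same sum.
\<close>

lemma wedge_alternating_sum:
  assumes \<alpha>: "\<And>x y. (\<And>i. i < k \<Longrightarrow> x i = y i) \<Longrightarrow> \<alpha> x = \<alpha> y"
  shows "wedge k l \<alpha> (\<lambda>x. C * alternating_sum l b x)
    = (\<lambda>x. C / fact k * alternating_sum (k + l) (\<lambda>y. \<alpha> y * b (\<lambda>i. y (k + i))) x)"
proof
  fix x
  define h where "h \<sigma> = of_int (sign \<sigma>) * (\<alpha> (\<lambda>i. x (\<sigma> i)) * b (\<lambda>i. x (\<sigma> (k + i))))"
    for \<sigma> :: "nat \<Rightarrow> nat"
  define up where "up \<tau> = map_permutation {..<l} ((+) k) \<tau>" for \<tau>
  have up_low: "up \<tau> i = i" if "i < k" for \<tau> i
    using that by (auto simp: up_def map_permutation_def restrict_id_def)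
  have up_high: "up \<tau> (k + i) = k + \<tau> i" if "\<tau> permutes {..<l}" for \<tau> i
  proof (cases "i < l")
    case True
    then show ?thesis unfolding up_def by (intro map_permutation_apply) auto
  next
    case False
    then show ?thesis using permutes_not_in[OF that, of i]
      by (auto simp: up_def map_permutation_def restrict_id_def)
  qed
  have up_permutes: "up \<tau> permutes {..<k + l}" if "\<tau> permutes {..<l}" for \<tau>
  proof (rule permutes_subset)
    show "up \<tau> permutes ((+) k ` {..<l})"
      unfolding up_def by (rule map_permutation_permutes[OF _ that]) (auto simp: bij_betw_def)
  qed auto
  have up_sign: "sign (up \<tau>) = sign \<tau>" if "\<tau> permutes {..<l}" for \<tau>
    unfolding up_def by (rule sign_map_permutation[OF _ that]) auto
  have summand: "of_int (sign \<sigma>) * \<alpha> (\<lambda>i. x (\<sigma> i)) * (of_int (sign \<tau>) * b (\<lambda>i. x (\<sigma> (k + \<tau> i))))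
      = h (\<sigma> \<circ> up \<tau>)" if \<sigma>: "\<sigma> permutes {..<k + l}" and \<tau>: "\<tau> permutes {..<l}" for \<sigma> \<tau>
  proof -
    have "permutation \<sigma>" "permutation (up \<tau>)"
      using \<sigma> up_permutes[OF \<tau>] permutation_permutes finite_lessThan by blast+
    then have "sign (\<sigma> \<circ> up \<tau>) = sign \<sigma> * sign \<tau>"
      by (simp add: sign_compose up_sign[OF \<tau>])
    moreover have "\<alpha> (\<lambda>i. x ((\<sigma> \<circ> up \<tau>) i)) = \<alpha> (\<lambda>i. x (\<sigma> i))"
      by (rule \<alpha>) (simp add: up_low)
    ultimately show ?thesis by (simp add: h_def up_high[OF \<tau>])
  qed
  have "(\<Sum>\<sigma> | \<sigma> permutes {..<k + l}. of_int (sign \<sigma>) * \<alpha> (\<lambda>i. x (\<sigma> i)) *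
          (C * alternating_sum l b (\<lambda>i. x (\<sigma> (k + i)))))
      = C * (\<Sum>\<sigma> | \<sigma> permutes {..<k + l}. \<Sum>\<tau> | \<tau> permutes {..<l}. h (\<sigma> \<circ> up \<tau>))"
    unfolding sum_distrib_left
    by (rule sum.cong, simp)
      (auto simp: alternating_sum_def summand[symmetric] sum_distrib_left mult_ac intro!: sum.cong)
  also have "\<dots> = C * (\<Sum>\<tau> | \<tau> permutes {..<l}. \<Sum>\<sigma> | \<sigma> permutes {..<k + l}. h (\<sigma> \<circ> up \<tau>))"
    by (subst sum.swap) simp
  also have "\<dots> = C * (\<Sum>\<tau> | \<tau> permutes {..<l}. \<Sum>\<sigma> | \<sigma> permutes {..<k + l}. h \<sigma>)"
    by (intro arg_cong2[where f = "(*)"] refl sum.cong sum_permutations_compose_right[symmetric])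
      (simp add: up_permutes)
  also have "\<dots> = C * (fact l * (\<Sum>\<sigma> | \<sigma> permutes {..<k + l}. h \<sigma>))"
    by (simp add: card_permutations[OF refl])
  finally show "wedge k l \<alpha> (\<lambda>x. C * alternating_sum l b x) x
    = C / fact k * alternating_sum (k + l) (\<lambda>y. \<alpha> y * b (\<lambda>i. y (k + i))) x"
    by (simp add: wedge_def alternating_sum_def h_def)
qed

lemma wedge_power_alternating_sum:
  assumes \<omega>: "\<And>x y. x 0 = y 0 \<Longrightarrow> x 1 = y 1 \<Longrightarrow> \<omega> x = \<omega> y"
  shows "wedge_power \<omega> k
    = (\<lambda>x. (1 / 2 ^ k) * alternating_sum (2 * k) (\<lambda>y. \<Prod>i<k. \<omega> (\<lambda>j. y (2 * i + j))) x)"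
proof (induction k)
  case 0
  have "{\<sigma>. \<sigma> permutes ({} :: nat set)} = {id}" by (auto simp: permutes_empty)
  then show ?case by (simp add: alternating_sum_def)
next
  case (Suc k)
  have "wedge_power \<omega> (Suc k) = wedge 2 (2 * k) \<omega>
      (\<lambda>x. (1 / 2 ^ k) * alternating_sum (2 * k) (\<lambda>y. \<Prod>i<k. \<omega> (\<lambda>j. y (2 * i + j))) x)"
    using Suc.IH by simp
  also have "\<dots> = (\<lambda>x. (1 / 2 ^ k) / fact 2 * alternating_sum (2 + 2 * k)
      (\<lambda>y. \<omega> y * (\<Prod>i<k. \<omega> (\<lambda>j. y (2 + (2 * i + j))))) x)"
    by (rule wedge_alternating_sum) (auto intro!: \<omega>)
  also have "(\<lambda>y. \<omega> y * (\<Prod>i<k. \<omega> (\<lambda>j. y (2 + (2 * i + j)))))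
      = (\<lambda>y. \<Prod>i<Suc k. \<omega> (\<lambda>j. y (2 * i + j)))"
    by (subst prod.lessThan_Suc_shift) (simp add: o_def add.assoc)
  finally show ?case by (simp add: mult.commute fact_2)
qed

text \<open>
  The slots \<open>1, \<dots>, 2k\<close> are grouped into the pairs \<open>{2i + 1, 2i + 2}\<close>.
\<close>

definition partner :: "nat \<Rightarrow> nat" where
  "partner m = (if odd m then m + 1 else m - 1)"

definition pair_sign :: "nat \<Rightarrow> int" where
  "pair_sign m = (if odd m then 1 else - 1)"

lemma partner_simps:
  "partner (Suc (2 * c)) = Suc (Suc (2 * c))" "partner (Suc (Suc (2 * c))) = Suc (2 * c)"
  by (simp_all add: partner_def)

lemma in_pair:
  assumes "0 < m"
  obtains c where "m = Suc (2 * c)" | c where "m = Suc (Suc (2 * c))"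
proof (cases "odd m")
  case True
  then show thesis using that(1) by (auto elim!: oddE)
next
  case False
  with assms show thesis using that(2)[of "m div 2 - 1"] by (auto elim!: evenE)
qed

text \<open>
  A permutation that maps pairs to pairs is a product of block transpositions, which are even, and of
  transpositions inside a pair, each of which reverses one pair.
\<close>

lemma sign_pair_preserving:
  assumes "\<sigma> permutes {1..<2 * k + 1}" "\<And>i. i < k \<Longrightarrow> \<sigma> (2 * i + 2) = partner (\<sigma> (2 * i + 1))"
  shows "sign \<sigma> * (\<Prod>i<k. pair_sign (\<sigma> (2 * i + 1))) = 1"
  using assms
proof (induction k arbitrary: \<sigma>)
  case 0
  then show ?case by simp
next
  case (Suc k)
  let ?A = "{1..<2 * Suc k + 1}"
  have odd_case: "sign \<sigma> * (\<Prod>i<Suc k. pair_sign (\<sigma> (2 * i + 1))) = 1"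
    if \<sigma>: "\<sigma> permutes ?A" and pairs: "\<And>i. i < Suc k \<Longrightarrow> \<sigma> (2 * i + 2) = partner (\<sigma> (2 * i + 1))"
      and odd: "odd (\<sigma> (2 * k + 1))" for \<sigma>
  proof -
    define a where "a = \<sigma> (2 * k + 1)"
    have a: "odd a" "a + 1 = \<sigma> (2 * k + 2)" "a \<in> ?A" "a + 1 \<in> ?A"
      using odd pairs[of k] permutes_in_image[OF \<sigma>, of "2 * k + 1"]
        permutes_in_image[OF \<sigma>, of "2 * k + 2"] by (auto simp: a_def partner_def)
    define \<tau> where "\<tau> = transpose a (2 * k + 1) \<circ> transpose (a + 1) (2 * k + 2)"
    have \<tau>: "\<tau> permutes ?A"
      unfolding \<tau>_def using a by (intro permutes_compose permutes_swap_id) auto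
    have \<tau>_sign: "sign \<tau> = 1"
      unfolding \<tau>_def by (subst sign_compose) (auto simp: sign_swap_id permutation_swap_id)
    have \<tau>_pair_sign: "pair_sign (\<tau> m) = pair_sign m" for m
      using a(1) by (auto simp: pair_sign_def \<tau>_def transpose_def)
    have \<tau>_partner: "\<tau> (partner m) = partner (\<tau> m)" if "0 < m" for m
    proof -
      obtain b where b: "a = Suc (2 * b)" using a(1) by (auto elim!: oddE)
      show ?thesis using that
        by (cases m rule: in_pair)
          (auto simp: b partner_simps \<tau>_def transpose_def Suc_double_not_eq_double double_not_eq_Suc_double)
    qed
    define \<rho> where "\<rho> = \<tau> \<circ> \<sigma>"
    have \<rho>: "\<rho> permutes ?A" unfolding \<rho>_def by (rule permutes_compose[OF \<sigma> \<tau>])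
    have fixed: "\<rho> (2 * k + 1) = 2 * k + 1" "\<rho> (2 * k + 2) = 2 * k + 2"
    proof -
      have "\<rho> (2 * k + 1) = \<tau> a" "\<rho> (2 * k + 2) = \<tau> (a + 1)"
        unfolding \<rho>_def a(2) by (simp_all add: a_def)
      moreover have "a \<noteq> 2 * k + 2" "a + 1 \<noteq> 2 * k + 1" using a(1) by auto
      ultimately show "\<rho> (2 * k + 1) = 2 * k + 1" "\<rho> (2 * k + 2) = 2 * k + 2"
        by (auto simp: \<tau>_def transpose_def)
    qed
    have "\<rho> permutes {1..<2 * k + 1}"
    proof (rule permutes_superset[OF \<rho>])
      fix m assume "m \<in> ?A - {1..<2 * k + 1}"
      then have "m = 2 * k + 1 \<or> m = 2 * k + 2" by auto
      then show "\<rho> m = m" using fixed by auto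
    qed
    moreover have "\<rho> (2 * i + 2) = partner (\<rho> (2 * i + 1))" if "i < k" for i
    proof -
      have "0 < \<sigma> (2 * i + 1)"
        using permutes_in_image[OF \<sigma>, of "2 * i + 1"] that by auto
      then show ?thesis using pairs[of i] that \<tau>_partner by (simp add: \<rho>_def)
    qed
    ultimately have "sign \<rho> * (\<Prod>i<k. pair_sign (\<rho> (2 * i + 1))) = 1"
      by (rule Suc.IH)
    moreover have "permutation \<sigma>" "permutation \<tau>"
      using \<sigma> \<tau> permutation_permutes finite_atLeastLessThan by blast+
    then have "sign \<rho> = sign \<sigma>"
      unfolding \<rho>_def by (simp add: sign_compose \<tau>_sign)
    moreover have "pair_sign (\<sigma> (2 * k + 1)) = 1" using odd by (simp add: pair_sign_def)
    ultimately show ?thesis by (simp add: \<rho>_def \<tau>_pair_sign)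
  qed
  show ?case
  proof (cases "odd (\<sigma> (2 * k + 1))")
    case True
    with Suc.prems show ?thesis by (intro odd_case)
  next
    case False
    define m where "m = \<sigma> (2 * k + 1)"
    have "even m" using False by (simp add: m_def)
    moreover have m_mem: "m \<in> ?A"
      using permutes_in_image[OF Suc.prems(1), of "2 * k + 1"] by (simp add: m_def)
    ultimately obtain a where a: "m = a + 1" "odd a" by (cases m) auto
    have \<sigma>2: "\<sigma> (2 * k + 2) = a"
      using Suc.prems(2)[of k] False a by (simp add: partner_def m_def)
    then have a_mem: "a \<in> ?A"
      using permutes_in_image[OF Suc.prems(1), of "2 * k + 2"] by simp
    define \<tau> where "\<tau> = transpose a (a + 1)"
    have \<tau>: "\<tau> permutes ?A"
      unfolding \<tau>_def using a_mem m_mem a by (intro permutes_swap_id) auto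
    have \<tau>_sign: "sign \<tau> = - 1" by (simp add: \<tau>_def sign_swap_id)
    have \<tau>_partner: "\<tau> (partner n) = partner (\<tau> n)" if "0 < n" for n
    proof -
      obtain b where b: "a = Suc (2 * b)" using a(2) by (auto elim!: oddE)
      show ?thesis using that
        by (cases n rule: in_pair)
          (auto simp: b partner_simps \<tau>_def transpose_def Suc_double_not_eq_double double_not_eq_Suc_double)
    qed
    define \<rho> where "\<rho> = \<tau> \<circ> \<sigma>"
    have \<rho>: "\<rho> permutes ?A" unfolding \<rho>_def by (rule permutes_compose[OF Suc.prems(1) \<tau>])
    have \<rho>k: "\<rho> (2 * k + 1) = a" 
    proof -
      have "\<rho> (2 * k + 1) = \<tau> m" by (simp add: \<rho>_def m_def)
      then show ?thesis using a by (simp add: \<tau>_def)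
    qed
    have "sign \<rho> * (\<Prod>i<Suc k. pair_sign (\<rho> (2 * i + 1))) = 1"
    proof (rule odd_case[OF \<rho>])
      fix i assume i: "i < Suc k"
      then have "0 < \<sigma> (2 * i + 1)"
        using permutes_in_image[OF Suc.prems(1), of "2 * i + 1"] by auto
      then show "\<rho> (2 * i + 2) = partner (\<rho> (2 * i + 1))"
        using Suc.prems(2)[OF i] \<tau>_partner by (simp add: \<rho>_def)
    next
      show "odd (\<rho> (2 * k + 1))" using a \<rho>k by simp
    qed
    moreover have "pair_sign (\<rho> (2 * i + 1)) = pair_sign (\<sigma> (2 * i + 1))" if "i < k" for i
    proof -
      have "\<sigma> (2 * i + 1) \<noteq> \<sigma> (2 * k + 1)" "\<sigma> (2 * i + 1) \<noteq> \<sigma> (2 * k + 2)"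
        using that permutes_inj[OF Suc.prems(1), THEN injD] by fastforce+
      then have "\<rho> (2 * i + 1) = \<sigma> (2 * i + 1)"
        using a \<sigma>2 by (auto simp: \<rho>_def \<tau>_def m_def transpose_def)
      then show ?thesis by simp
    qed
    moreover have "pair_sign (\<rho> (2 * k + 1)) = - pair_sign (\<sigma> (2 * k + 1))"
      using a(2) \<rho>k False by (simp add: pair_sign_def)
    moreover have "permutation \<sigma>" "permutation \<tau>"
      using Suc.prems(1) \<tau> permutation_permutes finite_atLeastLessThan by blast+
    then have "sign \<rho> = - sign \<sigma>"
      unfolding \<rho>_def by (simp add: sign_compose \<tau>_sign)
    ultimately show ?thesis by simp
  qed
qed

text \<open>
  On the arguments \<open>R, a 0, b 0, a 1, b 1, \<dots>\<close> only the permutations that fix the first slot and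
  preserve the pairs give nonzero summands, and all of these summands equal \<open>\<phi> R\<close>.
\<close>

lemma contact_form_if_darboux:
  assumes br: "bracket_on G br" and \<phi>: "one_form G \<phi>" and dim: "pmat.dim G = 2 * k + 1"
    and R: "R \<in> G" "\<phi> R \<noteq> 0" "\<And>y. y \<in> G \<Longrightarrow> \<phi> (br R y) = 0"
    and ab: "\<And>i. i < k \<Longrightarrow> a i \<in> G" "\<And>i. i < k \<Longrightarrow> b i \<in> G"
    and aa: "\<And>i j. i < k \<Longrightarrow> j < k \<Longrightarrow> \<phi> (br (a i) (a j)) = 0"
    and bb: "\<And>i j. i < k \<Longrightarrow> j < k \<Longrightarrow> \<phi> (br (b i) (b j)) = 0"
    and ba: "\<And>i j. i < k \<Longrightarrow> j < k \<Longrightarrow> \<phi> (br (b i) (a j)) = (if i = j then 1 else 0)"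
  shows "contact_form G br \<phi>"
proof -
  let ?\<omega> = "exterior_derivative br \<phi>" and ?n = "2 * k + 1"
  have skew: "\<phi> (br x y) = - \<phi> (br y x)" if "x \<in> G" "y \<in> G" for x y
  proof -
    have "br x y + br y x = 0" "br y x \<in> G" using br that unfolding bracket_on_def by blast+
    then show ?thesis using one_form_uminus[OF \<phi>] by (metis add_eq_0_iff2)
  qed
  define x where "x m = (if m = 0 \<or> 2 * k < m then R else if odd m then a (m div 2) else b (m div 2 - 1))"
    for m
  have x_odd: "x (Suc (2 * i)) = a i" and x_even: "x (Suc (Suc (2 * i))) = b i" if "i < k" for i
    using that by (simp_all add: x_def)
  have x_mem: "x m \<in> G" for m
  proof (cases "m = 0 \<or> 2 * k < m")
    case True
    then show ?thesis using R by (auto simp: x_def)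
  next
    case False
    then have "0 < m" "m \<le> 2 * k" by auto
    then show ?thesis by (cases m rule: in_pair) (use x_odd x_even ab in auto)
  qed
  define W where "W p q = - \<phi> (br (x p) (x q))" for p q
  have W: "W p q = (if 0 < p \<and> q = partner p then of_int (pair_sign p) else 0)"
    if "p < ?n" "0 < q" "q < ?n" for p q
  proof (cases "p = 0")
    case True
    then show ?thesis using R x_mem by (simp add: W_def x_def)
  next
    case False
    then have "0 < p" by simp
    then show ?thesis
    proof (cases p rule: in_pair)
      case p: (1 i)
      with that have i: "i < k" by simp
      from that(2) show ?thesis
      proof (cases q rule: in_pair)
        case q: (1 j)
        with that have j: "j < k" by simp
        show ?thesis using aa[OF i j] by (simp add: p q W_def x_odd i j partner_simps double_not_eq_Suc_double)
      next
        case q: (2 j)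
        with that have j: "j < k" by simp
        show ?thesis using ba[OF j i] skew[OF ab(1)[OF i] ab(2)[OF j]]
          by (simp add: p q W_def x_odd x_even i j partner_simps pair_sign_def)
      qed
    next
      case p: (2 i)
      with that have i: "i < k" by simp
      from that(2) show ?thesis
      proof (cases q rule: in_pair)
        case q: (1 j)
        with that have j: "j < k" by simp
        show ?thesis using ba[OF i j]
          by (simp add: p q W_def x_odd x_even i j partner_simps pair_sign_def)
      next
        case q: (2 j)
        with that have j: "j < k" by simp
        show ?thesis using bb[OF i j] by (simp add: p q W_def x_even i j partner_simps double_not_eq_Suc_double
            Suc_double_not_eq_double)
      qed
    qed
  qed
  have W0: "W p 0 = 0" "W 0 p = 0" for p
    using R(3)[OF x_mem[of p]] skew[OF x_mem[of p] R(1)] by (simp_all add: W_def x_def)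
  define good where
    "good \<sigma> \<longleftrightarrow> \<sigma> 0 = 0 \<and> (\<forall>i<k. \<sigma> (2 * i + 2) = partner (\<sigma> (2 * i + 1)))" for \<sigma> :: "nat \<Rightarrow> nat"
  have summand: "of_int (sign \<sigma>) * (\<phi> (x (\<sigma> 0)) * (\<Prod>i<k. W (\<sigma> (2 * i + 1)) (\<sigma> (2 * i + 2))))
      = (if good \<sigma> then \<phi> R else 0)" if \<sigma>: "\<sigma> permutes {..<?n}" for \<sigma>
  proof -
    have range: "\<sigma> m < ?n" if "m < ?n" for m
      using permutes_in_image[OF \<sigma>, of m] that by simp
    show ?thesis
    proof (cases "good \<sigma>")
      case True
      then have "\<sigma> 0 = 0" by (simp add: good_def)
      then have pos: "0 < \<sigma> m" if "0 < m" for m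
        using that permutes_inj[OF \<sigma>, THEN injD, of m 0] by (cases "\<sigma> m") auto
      have "\<sigma> permutes {1..<?n}"
      proof (rule permutes_superset[OF \<sigma>])
        fix m assume "m \<in> {..<?n} - {1..<?n}"
        then have "m = 0" by auto
        then show "\<sigma> m = m" using \<open>\<sigma> 0 = 0\<close> by simp
      qed
      then have s: "sign \<sigma> * (\<Prod>i<k. pair_sign (\<sigma> (2 * i + 1))) = 1"
        using True by (intro sign_pair_preserving) (auto simp: good_def)
      have "(\<Prod>i<k. W (\<sigma> (2 * i + 1)) (\<sigma> (2 * i + 2)))
          = (\<Prod>i<k. of_int (pair_sign (\<sigma> (2 * i + 1))))"
      proof (rule prod.cong)
        fix i assume "i \<in> {..<k}"
        then show "W (\<sigma> (2 * i + 1)) (\<sigma> (2 * i + 2)) = of_int (pair_sign (\<sigma> (2 * i + 1)))"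
          using True W[OF range[of "2 * i + 1"] pos range[of "2 * i + 2"]] pos[of "2 * i + 1"]
          by (simp add: good_def)
      qed simp
      also have "of_int (sign \<sigma>) * (\<phi> (x (\<sigma> 0)) * \<dots>)
          = \<phi> R * of_int (sign \<sigma> * (\<Prod>i<k. pair_sign (\<sigma> (2 * i + 1))))"
        using \<open>\<sigma> 0 = 0\<close> by (simp add: x_def)
      finally show ?thesis unfolding s using True by simp
    next
      case False
      have "\<exists>i<k. W (\<sigma> (2 * i + 1)) (\<sigma> (2 * i + 2)) = 0"
      proof (cases "\<sigma> 0 = 0")
        case True
        with False obtain i where i: "i < k" "\<sigma> (2 * i + 2) \<noteq> partner (\<sigma> (2 * i + 1))"
          by (auto simp: good_def)
        have "0 < \<sigma> (2 * i + 2)"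
          using True permutes_inj[OF \<sigma>, THEN injD, of "2 * i + 2" 0] by (cases "\<sigma> (2 * i + 2)") auto
        then have "W (\<sigma> (2 * i + 1)) (\<sigma> (2 * i + 2)) = 0"
          using i W[OF range[of "2 * i + 1"] _ range[of "2 * i + 2"]] by simp
        then show ?thesis using i by blast
      next
        case False
        define m where "m = inv \<sigma> 0"
        have m: "\<sigma> m = 0" using permutes_inverses[OF \<sigma>] by (simp add: m_def)
        have "m < ?n"
          using permutes_in_image[OF permutes_inv[OF \<sigma>], of 0] by (simp add: m_def)
        moreover have "m \<noteq> 0" using m False by metis
        ultimately have "0 < m" "m \<le> 2 * k" by simp_all
        from this(1) show ?thesis
        proof (cases m rule: in_pair)
          case (1 i)
          then show ?thesis using m W0(2) \<open>m \<le> 2 * k\<close> by (intro exI[of _ i]) auto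
        next
          case (2 i)
          then show ?thesis using m W0(1) \<open>m \<le> 2 * k\<close> by (intro exI[of _ i]) auto
        qed
      qed
      then have "(\<Prod>i<k. W (\<sigma> (2 * i + 1)) (\<sigma> (2 * i + 2))) = 0" by (auto intro: prod_zero)
      then show ?thesis using False by simp
    qed
  qed
  let ?S = "{\<sigma>. \<sigma> permutes {..<?n}}"
  have "wedge 1 (2 * k) (form_of_functional \<phi>) (wedge_power ?\<omega> k) x
      = 1 / 2 ^ k * (\<Sum>\<sigma>\<in>?S. of_int (sign \<sigma>) *
          (\<phi> (x (\<sigma> 0)) * (\<Prod>i<k. W (\<sigma> (2 * i + 1)) (\<sigma> (2 * i + 2)))))"
    by (subst wedge_power_alternating_sum, simp add: exterior_derivative_def,
        subst wedge_alternating_sum, simp add: form_of_functional_def)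
      (simp add: alternating_sum_def form_of_functional_def exterior_derivative_def W_def)
  also have "(\<Sum>\<sigma>\<in>?S. of_int (sign \<sigma>) *
          (\<phi> (x (\<sigma> 0)) * (\<Prod>i<k. W (\<sigma> (2 * i + 1)) (\<sigma> (2 * i + 2)))))
      = (\<Sum>\<sigma>\<in>?S. if good \<sigma> then \<phi> R else 0)"
    by (rule sum.cong) (use summand in auto)
  also have "\<dots> = of_nat (card {\<sigma> \<in> ?S. good \<sigma>}) * \<phi> R"
    by (simp add: sum.If_cases finite_permutations Int_def)
  finally have value_eq: "wedge 1 (2 * k) (form_of_functional \<phi>) (wedge_power ?\<omega> k) x
      = 1 / 2 ^ k * (of_nat (card {\<sigma> \<in> ?S. good \<sigma>}) * \<phi> R)" .
  have "id \<in> {\<sigma> \<in> ?S. good \<sigma>}" by (simp add: good_def permutes_id partner_def)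
  moreover have "finite {\<sigma> \<in> ?S. good \<sigma>}" by (simp add: finite_permutations)
  ultimately have "card {\<sigma> \<in> ?S. good \<sigma>} \<noteq> 0"
    by (metis (no_types, lifting) card_eq_0_iff empty_iff)
  then have "wedge 1 (2 * k) (form_of_functional \<phi>) (wedge_power ?\<omega> k) x \<noteq> 0"
    using R(2) unfolding value_eq by simp
  then show ?thesis using \<phi> dim x_mem unfolding contact_form_def by blast
qed

section \<open>Lie poset algebras in coordinates\<close>

lemma labelled_posetD:
  assumes "labelled_poset r"
  shows "finite r" "finite (Field r)" "trans r" "antisym r" "\<And>p. p \<in> Field r \<Longrightarrow> (p, p) \<in> r"
    "\<And>p q. (p, q) \<in> r \<Longrightarrow> p \<le> q"
proof -
  obtain n where po: "partial_order_on {1..n} r" and le: "\<forall>(x, y)\<in>r. x \<le> y"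
    using assms by (auto simp: labelled_poset_def)
  have sub: "r \<subseteq> {1..n} \<times> {1..n}" and refl: "refl_on {1..n} r"
    using po by (auto simp: partial_order_on_def preorder_on_def)
  show "finite r" using sub by (rule finite_subset) auto
  then show "finite (Field r)" by (rule finite_Field)
  show "trans r" "antisym r" using po by (auto simp: partial_order_on_def preorder_on_def)
  show "(p, p) \<in> r" if "p \<in> Field r" for p
    using that sub refl by (auto simp: Field_def refl_on_def)
  show "p \<le> q" if "(p, q) \<in> r" for p q using le that by auto
qed

lemma labelled_poset_Field:
  assumes "labelled_poset r"
  shows "\<exists>n. Field r = {1..n}"
proof -
  obtain n where po: "partial_order_on {1..n} r" using assms by (auto simp: labelled_poset_def)
  have "r \<subseteq> {1..n} \<times> {1..n}" "refl_on {1..n} r"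
    using po by (auto simp: partial_order_on_def preorder_on_def)
  then have "Field r = {1..n}" by (fastforce simp: Field_def refl_on_def)
  then show ?thesis ..
qed

lemma FieldI_pair: "(p, q) \<in> r \<Longrightarrow> p \<in> Field r" "(p, q) \<in> r \<Longrightarrow> q \<in> Field r"
  by (auto simp: Field_def)

lemma pmat_sum_apply: "(\<Sum>a\<in>A. g a) x = (\<Sum>a\<in>A. g a x :: complex)"
  by (induction A rule: infinite_finite_induct) auto

lemma one_form_sum:
  assumes \<psi>: "one_form G \<psi>" and G: "pmat.subspace G" and "finite A" "\<And>a. a \<in> A \<Longrightarrow> u a \<in> G"
  shows "\<psi> (\<Sum>a\<in>A. pmat_scale (t a) (u a)) = (\<Sum>a\<in>A. t a * \<psi> (u a))"
  using assms(3,4)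
proof (induction A rule: finite_induct)
  case empty
  have "\<psi> (pmat_scale 0 0) = 0 * \<psi> 0"
    using \<psi> pmat.subspace_0[OF G] unfolding one_form_def by blast
  then show ?case by (simp only: pmat.scale_zero_left sum.empty mult_zero_left)
next
  case (insert a A)
  have "(\<Sum>a\<in>A. pmat_scale (t a) (u a)) \<in> G" "pmat_scale (t a) (u a) \<in> G" "u a \<in> G"
    using insert G by (auto intro!: pmat.subspace_sum pmat.subspace_scale)
  then have "\<psi> (pmat_scale (t a) (u a) + (\<Sum>a\<in>A. pmat_scale (t a) (u a)))
      = t a * \<psi> (u a) + \<psi> (\<Sum>a\<in>A. pmat_scale (t a) (u a))"
    using \<psi> by (simp add: one_form_def)
  then show ?case using insert by (simp only: sum.insert[OF insert.hyps]) simp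
qed

definition matrix_unit :: "nat \<times> nat \<Rightarrow> pmat" where
  "matrix_unit pq = (\<lambda>x. if x = pq then 1 else 0)"

definition scalar_matrix :: "nat set \<Rightarrow> complex \<Rightarrow> pmat" where
  "scalar_matrix V c = (\<lambda>(p, q). if p = q \<and> p \<in> V then c else 0)"

definition matrix_trace :: "nat set \<Rightarrow> pmat \<Rightarrow> complex" where
  "matrix_trace V X = (\<Sum>p\<in>V. X (p, p))"

text \<open>
  For a one-form with coefficients \<open>f\<close>, the entry of \<open>coad V f X\<close> at \<open>(p, q)\<close> is the value of the form
  on the bracket of \<open>X\<close> with the matrix unit at \<open>(p, q)\<close>; so \<open>X\<close> is in the kernel of \<open>d\<phi>\<close> iff \<open>coad V f X\<close>
  vanishes on all relations.
\<close>

definition coad :: "nat set \<Rightarrow> pmat \<Rightarrow> pmat \<Rightarrow> pmat" where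
  "coad V f X = (\<lambda>(p, q). (\<Sum>s\<in>V. f (s, q) * X (s, p)) - (\<Sum>t\<in>V. f (p, t) * X (q, t)))"

lemma lie_poset_outside: "X \<in> lie_poset r \<Longrightarrow> pq \<notin> r \<Longrightarrow> X pq = 0"
  by (cases pq) (simp add: lie_poset_def)

lemma subspace_lie_poset: "pmat.subspace (lie_poset r)"
  by (auto simp: pmat.subspace_def lie_poset_def pmat_scale_def)

lemma subspace_lie_poset_A: "pmat.subspace (lie_poset_A r)"
  by (auto simp: pmat.subspace_def lie_poset_A_def lie_poset_def pmat_scale_def sum.distrib
      sum_distrib_left[symmetric])

lemma lie_poset_A_iff: "X \<in> lie_poset_A r \<longleftrightarrow> X \<in> lie_poset r \<and> matrix_trace (Field r) X = 0"
  by (simp add: lie_poset_A_def matrix_trace_def)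

lemma matrix_unit_in_lie_poset: "pq \<in> r \<Longrightarrow> matrix_unit pq \<in> lie_poset r"
  by (auto simp: lie_poset_def matrix_unit_def)

lemma scalar_matrix_in_lie_poset: "labelled_poset r \<Longrightarrow> scalar_matrix (Field r) c \<in> lie_poset r"
  using labelled_posetD(5) by (auto simp: lie_poset_def scalar_matrix_def)

lemma bracket_apply:
  "poset_bracket r X Y (p, s)
    = (\<Sum>q\<in>Field r. X (p, q) * Y (q, s)) - (\<Sum>q\<in>Field r. Y (p, q) * X (q, s))"
  by (simp add: poset_bracket_def poset_mult_def)

lemma bracket_in_lie_poset_A:
  assumes "labelled_poset r" "X \<in> lie_poset r" "Y \<in> lie_poset r"
  shows "poset_bracket r X Y \<in> lie_poset_A r"
proof -
  note tr = labelled_posetD(3)[OF assms(1)]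
  have 0: "X (p, q) * Y (q, s) = 0" if "(p, s) \<notin> r" "X \<in> lie_poset r" "Y \<in> lie_poset r" for p q s X Y
    using that transD[OF tr, of p q s] lie_poset_outside[of X r "(p, q)"]
      lie_poset_outside[of Y r "(q, s)"] by auto
  have "poset_bracket r X Y (p, s) = 0" if "(p, s) \<notin> r" for p s
    unfolding bracket_apply using 0[OF that assms(2,3)] 0[OF that assms(3,2)]
    by (simp only: sum.neutral_const diff_self)
  then have "poset_bracket r X Y \<in> lie_poset r" by (auto simp: lie_poset_def)
  moreover have "matrix_trace (Field r) (poset_bracket r X Y) = 0"
  proof -
    have "(\<Sum>p\<in>Field r. \<Sum>q\<in>Field r. X (p, q) * Y (q, p)) = (\<Sum>p\<in>Field r. \<Sum>q\<in>Field r. Y (p, q) * X (q, p))"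
      by (subst sum.swap) (simp add: mult.commute)
    then show ?thesis by (simp add: matrix_trace_def bracket_apply sum_subtractf)
  qed
  ultimately show ?thesis by (simp add: lie_poset_A_iff)
qed

lemma bracket_on_lie_poset_A:
  assumes "labelled_poset r"
  shows "bracket_on (lie_poset_A r) (poset_bracket r)"
  unfolding bracket_on_def
proof (intro conjI ballI allI)
  show "pmat.subspace (lie_poset_A r)" by (rule subspace_lie_poset_A)
  show "poset_bracket r X Y \<in> lie_poset_A r" if "X \<in> lie_poset_A r" "Y \<in> lie_poset_A r" for X Y
    using that bracket_in_lie_poset_A[OF assms] by (simp add: lie_poset_A_iff)
qed (auto simp: fun_eq_iff bracket_apply pmat_scale_def algebra_simps sum.distrib sum_distrib_left
      sum_subtractf)

lemma matrix_unit_expansion: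
  assumes "finite r" "X \<in> lie_poset r"
  shows "X = (\<Sum>pq\<in>r. pmat_scale (X pq) (matrix_unit pq))"
proof
  fix x
  have "(\<Sum>pq\<in>r. pmat_scale (X pq) (matrix_unit pq)) x = (\<Sum>pq\<in>r. if pq = x then X x else 0)"
    unfolding pmat_sum_apply by (rule sum.cong) (auto simp: pmat_scale_def matrix_unit_def)
  also have "\<dots> = X x" using assms by (simp add: lie_poset_outside)
  finally show "X x = (\<Sum>pq\<in>r. pmat_scale (X pq) (matrix_unit pq)) x" ..
qed

lemma one_form_coefficients:
  assumes "labelled_poset r" "one_form (lie_poset r) \<psi>" "X \<in> lie_poset r"
  shows "\<psi> X = (\<Sum>pq\<in>r. \<psi> (matrix_unit pq) * X pq)"
proof -
  note fin = labelled_posetD(1)[OF assms(1)]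
  have "\<psi> X = \<psi> (\<Sum>pq\<in>r. pmat_scale (X pq) (matrix_unit pq))"
    using matrix_unit_expansion[OF fin assms(3)] by simp
  also have "\<dots> = (\<Sum>pq\<in>r. X pq * \<psi> (matrix_unit pq))"
    by (rule one_form_sum[OF assms(2) subspace_lie_poset fin]) (rule matrix_unit_in_lie_poset)
  finally show ?thesis by (simp add: mult.commute)
qed

lemma sum_over_relation:
  assumes "labelled_poset r" "\<And>p q. (p, q) \<notin> r \<Longrightarrow> g (p, q) = 0"
  shows "(\<Sum>pq\<in>r. g pq) = (\<Sum>p\<in>Field r. \<Sum>q\<in>Field r. g (p, q) :: complex)"
proof -
  have "(\<Sum>pq\<in>r. g pq) = (\<Sum>pq\<in>Field r \<times> Field r. g pq)"
    using labelled_posetD[OF assms(1)] assms(2) FieldI_pair[of _ _ r]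
    by (intro sum.mono_neutral_left) auto
  then show ?thesis by (simp add: sum.cartesian_product)
qed

lemma bracket_pairing:
  assumes r: "labelled_poset r" and X: "X \<in> lie_poset r" and Y: "Y \<in> lie_poset r"
  shows "(\<Sum>pq\<in>r. f pq * poset_bracket r X Y pq) = (\<Sum>pq\<in>r. Y pq * coad (Field r) f X pq)"
proof -
  let ?V = "Field r"
  have br: "poset_bracket r X Y \<in> lie_poset r"
    using bracket_in_lie_poset_A[OF assms] by (simp add: lie_poset_A_iff)
  have "(\<Sum>pq\<in>r. f pq * poset_bracket r X Y pq)
      = (\<Sum>a\<in>?V. \<Sum>b\<in>?V. f (a, b) * poset_bracket r X Y (a, b))"
    by (rule sum_over_relation[OF r]) (simp add: lie_poset_outside[OF br])
  also have "\<dots> = (\<Sum>a\<in>?V. \<Sum>b\<in>?V. \<Sum>q\<in>?V. f (a, b) * X (a, q) * Y (q, b))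
      - (\<Sum>a\<in>?V. \<Sum>b\<in>?V. \<Sum>q\<in>?V. f (a, b) * Y (a, q) * X (q, b))"
    by (simp add: bracket_apply algebra_simps sum_distrib_left sum_subtractf)
  also have "(\<Sum>a\<in>?V. \<Sum>b\<in>?V. \<Sum>q\<in>?V. f (a, b) * X (a, q) * Y (q, b))
      = (\<Sum>b\<in>?V. \<Sum>q\<in>?V. \<Sum>a\<in>?V. f (a, b) * X (a, q) * Y (q, b))"
    by (subst sum.swap) (rule sum.cong[OF refl], rule sum.swap)
  also have "\<dots> = (\<Sum>q\<in>?V. \<Sum>b\<in>?V. \<Sum>a\<in>?V. f (a, b) * X (a, q) * Y (q, b))"
    by (rule sum.swap)
  also have "(\<Sum>a\<in>?V. \<Sum>b\<in>?V. \<Sum>q\<in>?V. f (a, b) * Y (a, q) * X (q, b))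
      = (\<Sum>a\<in>?V. \<Sum>q\<in>?V. \<Sum>b\<in>?V. f (a, b) * Y (a, q) * X (q, b))"
    by (rule sum.cong[OF refl], rule sum.swap)
  finally have "(\<Sum>pq\<in>r. f pq * poset_bracket r X Y pq)
      = (\<Sum>p\<in>?V. \<Sum>q\<in>?V. Y (p, q) * coad ?V f X (p, q))"
    by (simp add: coad_def algebra_simps sum_distrib_left sum_subtractf)
  also have "\<dots> = (\<Sum>pq\<in>r. Y pq * coad ?V f X pq)"
    by (rule sum_over_relation[OF r, symmetric]) (simp add: lie_poset_outside[OF Y])
  finally show ?thesis .
qed

lemma coad_skew:
  assumes r: "labelled_poset r" and X: "X \<in> lie_poset r" and Y: "Y \<in> lie_poset r"
  shows "(\<Sum>pq\<in>r. Y pq * coad (Field r) f X pq) = - (\<Sum>pq\<in>r. X pq * coad (Field r) f Y pq)"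
proof -
  have "poset_bracket r X Y = - poset_bracket r Y X" by (simp add: poset_bracket_def)
  then show ?thesis
    by (simp add: bracket_pairing[OF r X Y, symmetric] bracket_pairing[OF r Y X, symmetric]
        sum_negf)
qed

text \<open>
  The next two facts express that the identity matrix is central: its bracket with any \<open>X\<close> pairs to
  zero, and subtracting scalars does not change a bracket.
\<close>

lemma coad_trace:
  assumes "labelled_poset r"
  shows "(\<Sum>p\<in>Field r. coad (Field r) f X (p, p)) = 0"
  unfolding coad_def by (simp add: sum_subtractf) (rule sum.swap)

lemma coad_subtract_scalar:
  assumes "finite V" "p \<in> V" "q \<in> V"
  shows "coad V f (X - scalar_matrix V c) (p, q) = coad V f X (p, q)"
proof -
  have 1: "(\<Sum>s\<in>V. f (s, q) * scalar_matrix V c (s, p)) = f (p, q) * c"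
  proof -
    have "(\<Sum>s\<in>V. f (s, q) * scalar_matrix V c (s, p)) = (\<Sum>s\<in>V. if s = p then f (p, q) * c else 0)"
      by (rule sum.cong) (auto simp: scalar_matrix_def)
    then show ?thesis using assms by simp
  qed
  have 2: "(\<Sum>t\<in>V. f (p, t) * scalar_matrix V c (q, t)) = f (p, q) * c"
  proof -
    have "(\<Sum>t\<in>V. f (p, t) * scalar_matrix V c (q, t)) = (\<Sum>t\<in>V. if t = q then f (p, q) * c else 0)"
      by (rule sum.cong) (auto simp: scalar_matrix_def)
    then show ?thesis using assms by simp
  qed
  show ?thesis by (simp add: coad_def algebra_simps sum_subtractf 1 2)
qed

definition traceless_part :: "nat set \<Rightarrow> pmat \<Rightarrow> pmat" where
  "traceless_part V X = X - scalar_matrix V (matrix_trace V X / of_nat (card V))"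

lemma traceless_part_in_lie_poset_A:
  assumes "labelled_poset r" "Field r \<noteq> {}" "X \<in> lie_poset r"
  shows "traceless_part (Field r) X \<in> lie_poset_A r"
proof -
  have "traceless_part (Field r) X \<in> lie_poset r"
    unfolding traceless_part_def
    by (intro pmat.subspace_diff subspace_lie_poset assms scalar_matrix_in_lie_poset)
  moreover have "card (Field r) \<noteq> 0" using assms labelled_posetD(2) by auto
  ultimately show ?thesis
    by (simp add: lie_poset_A_iff traceless_part_def matrix_trace_def sum_subtractf scalar_matrix_def)
qed

lemma traceless_part_id: "X \<in> lie_poset_A r \<Longrightarrow> traceless_part (Field r) X = X"
  by (auto simp: lie_poset_A_iff traceless_part_def scalar_matrix_def fun_eq_iff)

lemma traceless_part_add: "traceless_part V (X + Y) = traceless_part V X + traceless_part V Y"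
  by (auto simp: traceless_part_def matrix_trace_def scalar_matrix_def fun_eq_iff sum.distrib
      add_divide_distrib)

lemma traceless_part_scale:
  "traceless_part V (pmat_scale c X) = pmat_scale c (traceless_part V X)"
  by (auto simp: traceless_part_def matrix_trace_def scalar_matrix_def fun_eq_iff pmat_scale_def
      sum_distrib_left[symmetric] algebra_simps)

text \<open>
  A contact form on the traceless algebra is extended to the full algebra by its value on traceless
  parts; the normalization \<open>X (v, v) = 0\<close> then removes the scalars.
\<close>

lemma contact_form_coefficients:
  assumes r: "labelled_poset r" and contact: "contact_form (lie_poset_A r) (poset_bracket r) \<phi>"
    and v: "v \<in> Field r"
  shows "\<exists>f. \<forall>X\<in>lie_poset r. X (v, v) = 0 \<longrightarrow> (\<Sum>pq\<in>r. f pq * X pq) = 0 \<longrightarrow>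
    (\<forall>pq\<in>r. coad (Field r) f X pq = 0) \<longrightarrow> X = 0"
proof -
  let ?V = "Field r" and ?A = "lie_poset_A r"
  have \<phi>: "one_form ?A \<phi>" using contact by (simp add: contact_form_def)
  have V: "?V \<noteq> {}" using v by auto
  note tl = traceless_part_in_lie_poset_A[OF r V]
  define \<psi> where "\<psi> X = \<phi> (traceless_part ?V X)" for X
  have \<psi>: "one_form (lie_poset r) \<psi>"
    using \<phi> tl by (simp add: one_form_def \<psi>_def traceless_part_add traceless_part_scale)
  define f where "f pq = \<psi> (matrix_unit pq)" for pq
  have \<psi>_f: "\<psi> X = (\<Sum>pq\<in>r. f pq * X pq)" if "X \<in> lie_poset r" for X
    unfolding f_def by (rule one_form_coefficients[OF r \<psi> that])
  have "X = 0" if X: "X \<in> lie_poset r" "X (v, v) = 0" "(\<Sum>pq\<in>r. f pq * X pq) = 0"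
      "\<forall>pq\<in>r. coad ?V f X pq = 0" for X
  proof -
    have "traceless_part ?V X = 0"
    proof (rule contact_form_nondegenerate[OF bracket_on_lie_poset_A[OF r] contact])
      show tl_mem: "traceless_part ?V X \<in> ?A" by (rule tl[OF X(1)])
      show "\<phi> (traceless_part ?V X) = 0" using \<psi>_f[OF X(1)] X(3) by (simp add: \<psi>_def)
      fix Y assume Y: "Y \<in> ?A"
      have mem: "Y \<in> lie_poset r" "traceless_part ?V X \<in> lie_poset r"
        using Y tl_mem by (simp_all add: lie_poset_A_iff)
      have br: "poset_bracket r (traceless_part ?V X) Y \<in> ?A"
        by (rule bracket_in_lie_poset_A[OF r mem(2,1)])
      then have "\<phi> (poset_bracket r (traceless_part ?V X) Y)
          = \<psi> (poset_bracket r (traceless_part ?V X) Y)"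
        by (simp add: \<psi>_def traceless_part_id)
      also have "\<dots> = (\<Sum>pq\<in>r. Y pq * coad ?V f (traceless_part ?V X) pq)"
        using br by (simp add: \<psi>_f lie_poset_A_iff bracket_pairing[OF r mem(2,1)])
      also have "\<dots> = (\<Sum>pq\<in>r. Y pq * coad ?V f X pq)"
      proof (rule sum.cong[OF refl])
        fix pq assume "pq \<in> r"
        then have "fst pq \<in> ?V" "snd pq \<in> ?V" by (cases pq; auto simp: Field_def)+
        from coad_subtract_scalar[OF labelled_posetD(2)[OF r] this]
        show "Y pq * coad ?V f (traceless_part ?V X) pq = Y pq * coad ?V f X pq"
          by (simp add: traceless_part_def)
      qed
      also have "\<dots> = 0" using X(4) by simp
      finally show "\<phi> (poset_bracket r (traceless_part ?V X) Y) = 0" .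
    qed
    then have scalar: "X = scalar_matrix ?V (matrix_trace ?V X / of_nat (card ?V))"
      by (simp add: traceless_part_def)
    have "matrix_trace ?V X / of_nat (card ?V) = 0"
      using X(2) v by (subst (asm) scalar) (simp add: scalar_matrix_def)
    then show ?thesis using scalar by (auto simp: scalar_matrix_def fun_eq_iff)
  qed
  then show ?thesis by (intro exI[of _ f]) simp
qed

text \<open>
  A basis: the matrix units other than the one at \<open>(v, v)\<close>, the diagonal ones made traceless by a
  correction at \<open>(v, v)\<close>.
\<close>

lemma dim_lie_poset_A:
  assumes r: "labelled_poset r" and V: "Field r \<noteq> {}"
  shows "pmat.dim (lie_poset_A r) = card r - 1"
proof -
  from V obtain v where v: "v \<in> Field r" by blast
  then have vv: "(v, v) \<in> r" by (rule labelled_posetD(5)[OF r])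
  note fin = labelled_posetD(1)[OF r]
  define r' where "r' = r - {(v, v)}"
  have fin': "finite r'" using fin by (simp add: r'_def)
  define b where "b pq = (\<lambda>x. (if x = pq then 1 else 0)
      - (if fst pq = snd pq \<and> x = (v, v) then 1 else 0) :: complex)" for pq :: "nat \<times> nat"
  have b_delta: "b pq x = (if x = pq then 1 else 0)" if "x \<noteq> (v, v)" for pq x
    using that by (simp add: b_def)
  have inj: "inj_on b r'"
    by (rule inj_onI) (metis b_delta DiffD2 insertI1 r'_def one_neq_zero)
  have expand: "(\<Sum>pq\<in>r'. pmat_scale (c pq) (b pq)) x = (if x \<in> r' then c x else 0)"
    if "x \<noteq> (v, v)" for c x
  proof -
    have "(\<Sum>pq\<in>r'. pmat_scale (c pq) (b pq)) x = (\<Sum>pq\<in>r'. if pq = x then c x else 0)"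
      unfolding pmat_sum_apply using that by (intro sum.cong) (auto simp: pmat_scale_def b_delta)
    then show ?thesis using fin' by simp
  qed
  have trace_r': "(\<Sum>pq\<in>r'. if fst pq = snd pq then c pq else 0) = (\<Sum>p\<in>Field r - {v}. c (p, p) :: complex)"
    for c
  proof -
    have "(\<Sum>pq\<in>r'. if fst pq = snd pq then c pq else 0) = (\<Sum>pq | pq \<in> r' \<and> fst pq = snd pq. c pq)"
      using fin' by (simp add: sum.inter_filter)
    also have "{pq. pq \<in> r' \<and> fst pq = snd pq} = (\<lambda>p. (p, p)) ` (Field r - {v})"
      using labelled_posetD(5)[OF r] by (auto simp: r'_def Field_def)
    also have "(\<Sum>pq\<in>(\<lambda>p. (p, p)) ` (Field r - {v}). c pq) = (\<Sum>p\<in>Field r - {v}. c (p, p))"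
      by (subst sum.reindex) (auto simp: inj_on_def)
    finally show ?thesis .
  qed
  have b_mem: "b pq \<in> lie_poset_A r" if "pq \<in> r'" for pq
  proof -
    have "b pq \<in> lie_poset r" using that vv by (auto simp: lie_poset_def b_def r'_def)
    moreover have "matrix_trace (Field r) (b pq) = 0"
    proof (cases "fst pq = snd pq")
      case True
      have "fst pq \<in> Field r" using that FieldI_pair by (cases pq) (auto simp: r'_def)
      have "matrix_trace (Field r) (b pq)
          = (\<Sum>p\<in>Field r. (if p = fst pq then 1 else 0) - (if p = v then 1 else 0))"
        unfolding matrix_trace_def using True by (intro sum.cong) (auto simp: b_def prod_eq_iff)
      then show ?thesis using v \<open>fst pq \<in> Field r\<close> labelled_posetD(2)[OF r]
        by (simp add: sum_subtractf)
    next
      case False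
      then show ?thesis unfolding matrix_trace_def by (intro sum.neutral) (auto simp: b_def)
    qed
    ultimately show ?thesis by (simp add: lie_poset_A_iff)
  qed
  show ?thesis
  proof (rule pmat.dim_unique)
    show "b ` r' \<subseteq> lie_poset_A r" using b_mem by blast
    show "lie_poset_A r \<subseteq> pmat.span (b ` r')"
    proof
      fix X assume X: "X \<in> lie_poset_A r"
      have "X x = (\<Sum>pq\<in>r'. pmat_scale (X pq) (b pq)) x" for x
      proof (cases "x = (v, v)")
        case True
        have "(\<Sum>pq\<in>r'. pmat_scale (X pq) (b pq)) x
            = - (\<Sum>pq\<in>r'. if fst pq = snd pq then X pq else 0)"
          unfolding pmat_sum_apply sum_negf[symmetric] True
          by (intro sum.cong) (auto simp: pmat_scale_def b_def r'_def)
        also have "\<dots> = X (v, v) - matrix_trace (Field r) X"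
          unfolding trace_r' matrix_trace_def
          using v labelled_posetD(2)[OF r] by (simp add: sum.remove)
        finally show ?thesis using X True by (simp add: lie_poset_A_iff)
      next
        case False
        then have "X x = 0" if "x \<notin> r'"
          using X that by (auto simp: r'_def lie_poset_A_iff lie_poset_outside)
        then show ?thesis using expand[OF False, of X] by auto
      qed
      then have "X = (\<Sum>pq\<in>r'. pmat_scale (X pq) (b pq))" by blast
      then show "X \<in> pmat.span (b ` r')"
        by (metis (no_types, lifting) imageI pmat.span_base pmat.span_scale pmat.span_sum)
    qed
    show "pmat.independent (b ` r')"
    proof (rule pmat.independent_if_scalars_zero)
      show "finite (b ` r')" using fin' by simp
      fix c X assume 0: "(\<Sum>X\<in>b ` r'. pmat_scale (c X) X) = 0" and "X \<in> b ` r'"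
      then obtain pq where pq: "pq \<in> r'" "X = b pq" by blast
      have "0 = (\<Sum>pq\<in>r'. pmat_scale (c (b pq)) (b pq)) pq"
        using 0 by (simp add: sum.reindex[OF inj] o_def)
      also have "\<dots> = c (b pq)"
        using pq by (subst expand) (auto simp: r'_def)
      finally show "c X = 0" using pq by simp
    qed
    show "card (b ` r') = card r - 1"
      using card_image[OF inj] vv fin by (simp add: r'_def)
  qed
qed

section \<open>Cutting a poset along an order ideal\<close>

definition crossing :: "nat rel \<Rightarrow> nat set \<Rightarrow> nat rel" where
  "crossing r D = {(p, q) \<in> r. p \<in> D \<and> q \<notin> D}"

definition internal :: "nat rel \<Rightarrow> nat set \<Rightarrow> nat rel" where
  "internal r D = r - crossing r D"

definition down_closed :: "nat rel \<Rightarrow> nat set \<Rightarrow> bool" where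
  "down_closed r D \<longleftrightarrow> (\<forall>(x, y)\<in>r. y \<in> D \<longrightarrow> x \<in> D)"

definition supported :: "nat rel \<Rightarrow> pmat \<Rightarrow> bool" where
  "supported A X \<longleftrightarrow> (\<forall>pq. pq \<notin> A \<longrightarrow> X pq = 0)"

lemma lie_poset_eq_supported: "X \<in> lie_poset r \<longleftrightarrow> supported r X"
  unfolding lie_poset_def supported_def by blast

lemma supported_mono: "supported A X \<Longrightarrow> A \<subseteq> B \<Longrightarrow> supported B X"
  unfolding supported_def by blast

lemma supportedD: "supported A X \<Longrightarrow> pq \<notin> A \<Longrightarrow> X pq = 0"
  unfolding supported_def by blast

lemma crossing_subset: "crossing r D \<subseteq> r" and internal_subset: "internal r D \<subseteq> r"
  by (auto simp: crossing_def internal_def)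

lemma internal_iff:
  assumes "down_closed r D"
  shows "(p, q) \<in> internal r D \<longleftrightarrow> (p, q) \<in> r \<and> (p \<in> D \<longleftrightarrow> q \<in> D)"
  using assms by (auto simp: internal_def crossing_def down_closed_def)

lemma crossing_iff: "(p, q) \<in> crossing r D \<longleftrightarrow> (p, q) \<in> r \<and> p \<in> D \<and> q \<notin> D"
  by (auto simp: crossing_def)

lemma card_internal_crossing:
  assumes "finite r"
  shows "card r = card (internal r D) + card (crossing r D)"
proof -
  have "card (internal r D) = card r - card (crossing r D)"
    unfolding internal_def using assms crossing_subset by (intro card_Diff_subset) (auto intro: finite_subset)
  moreover have "card (crossing r D) \<le> card r" using assms crossing_subset by (rule card_mono)
  ultimately show ?thesis by simp
qed

lemma coad_add: "coad V f (X + Y) pq = coad V f X pq + coad V f Y pq"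
  by (cases pq) (simp add: coad_def algebra_simps sum.distrib)

lemma coad_scale: "coad V f (pmat_scale c X) pq = c * coad V f X pq"
  by (cases pq) (simp add: coad_def pmat_scale_def algebra_simps sum_distrib_left)

lemma coad_zero: "coad V f 0 pq = 0"
  by (cases pq) (simp add: coad_def)

lemma coad_sum:
  assumes "finite A"
  shows "coad V f (\<Sum>a\<in>A. pmat_scale (c a) (u a)) pq = (\<Sum>a\<in>A. coad V f (u a) pq * c a)"
  using assms
proof (induction A rule: finite_induct)
  case empty
  show ?case by (simp only: sum.empty coad_zero)
next
  case (insert a A)
  then show ?case by (simp only: sum.insert[OF insert.hyps] coad_add coad_scale mult.commute)
qed

lemma supported_combination:
  assumes "finite A"
  shows "(\<Sum>pq\<in>A. pmat_scale (c pq) (matrix_unit pq)) x = (if x \<in> A then c x else 0)"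
proof -
  have "(\<Sum>pq\<in>A. pmat_scale (c pq) (matrix_unit pq)) x = (\<Sum>pq\<in>A. if pq = x then c x else 0)"
    unfolding pmat_sum_apply by (rule sum.cong) (auto simp: pmat_scale_def matrix_unit_def)
  then show ?thesis using assms by simp
qed

text \<open>
  The existence arguments below all count equations against free entries of a matrix.
\<close>

lemma supported_solution:
  assumes "finite A" "finite J" "finite K" "card J + card K < card A"
  shows "\<exists>X. X \<noteq> 0 \<and> supported A X \<and> (\<forall>pq\<in>J. coad V f X pq = 0) \<and>
    (\<forall>k\<in>K. (\<Sum>pq\<in>A. g k pq * X pq) = 0)"
proof -
  define a where
    "a j xy = (case j of Inl pq \<Rightarrow> coad V f (matrix_unit xy) pq | Inr k \<Rightarrow> g k xy)" for j xy
  have "finite (J <+> K)" "card (J <+> K) < card A"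
    using assms by (simp_all add: card_Plus)
  from homogeneous_system_nontrivial[OF this(1) assms(1) this(2), of a]
  obtain c where c: "\<exists>xy\<in>A. c xy \<noteq> 0" "\<forall>j\<in>J <+> K. (\<Sum>xy\<in>A. a j xy * c xy) = 0" by blast
  define X where "X = (\<Sum>xy\<in>A. pmat_scale (c xy) (matrix_unit xy))"
  have X: "X x = (if x \<in> A then c x else 0)" for x
    unfolding X_def by (rule supported_combination[OF assms(1)])
  have "coad V f X pq = 0" if "pq \<in> J" for pq
    using bspec[OF c(2) InlI[OF that]] by (simp add: X_def coad_sum[OF assms(1)] a_def)
  moreover have "(\<Sum>pq\<in>A. g k pq * X pq) = 0" if "k \<in> K" for k
    using bspec[OF c(2) InrI[OF that]] by (simp add: X a_def)
  moreover have "X \<noteq> 0" using c(1) X by (metis zero_fun_apply)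
  moreover have "supported A X" by (simp add: supported_def X)
  ultimately show ?thesis by (intro exI[of _ X]) blast
qed

lemma coad_crossing_crossing:
  assumes "supported (crossing r D) Y" "p \<in> D" "q \<notin> D"
  shows "coad V f Y (p, q) = 0"
proof -
  have "Y (s, p) = 0" "Y (q, s) = 0" for s
    using assms by (auto intro!: supportedD[OF assms(1)] simp: crossing_iff)
  then show ?thesis by (simp add: coad_def)
qed

text \<open>
  A form supported on crossing relations vanishes on the internal subalgebra, in particular on its brackets.
\<close>

lemma coad_internal_internal:
  assumes D: "down_closed r D" and f: "supported (crossing r D) f"
    and X: "supported (internal r D) X" and pq: "(p, q) \<in> internal r D"
  shows "coad V f X (p, q) = 0"
proof -
  have iff: "p \<in> D \<longleftrightarrow> q \<in> D" using pq internal_iff[OF D] by blast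
  have "f (s, q) = 0 \<or> X (s, p) = 0" for s
    using supportedD[OF f, of "(s, q)"] supportedD[OF X, of "(s, p)"] iff
    unfolding crossing_iff internal_iff[OF D] by blast
  moreover have "f (p, t) = 0 \<or> X (q, t) = 0" for t
    using supportedD[OF f, of "(p, t)"] supportedD[OF X, of "(q, t)"] iff
    unfolding crossing_iff internal_iff[OF D] by blast
  ultimately have "(\<Sum>s\<in>V. f (s, q) * X (s, p)) = 0" "(\<Sum>t\<in>V. f (p, t) * X (q, t)) = 0"
    by (auto intro!: sum.neutral)
  then show ?thesis by (simp add: coad_def)
qed

text \<open>
  The crossing part is an abelian ideal on which the diagonal matrix \<open>h\<close> with ones on \<open>D\<close> acts as the
  identity. If it is at least as large as the rest, some nonzero \<open>Y\<close> in it is in the kernel of \<open>d\<phi>\<close>,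
  and then \<open>\<phi> Y = \<phi> [h, Y] = 0\<close>, whatever the form \<open>\<phi>\<close>. One equation is saved because the identity
  matrix is central.
\<close>

lemma crossing_kernel:
  assumes r: "labelled_poset r" and D: "down_closed r D" and v: "v \<in> Field r"
    and card: "card (internal r D) \<le> card (crossing r D)"
  shows "\<exists>Y. Y \<noteq> 0 \<and> supported (crossing r D) Y \<and> (\<forall>pq\<in>r. coad (Field r) f Y pq = 0) \<and>
    (\<Sum>pq\<in>r. f pq * Y pq) = 0"
proof -
  let ?V = "Field r"
  note fin = labelled_posetD(1,2)[OF r]
  have vv: "(v, v) \<in> internal r D"
    using labelled_posetD(5)[OF r v] by (simp add: internal_iff[OF D])
  have fin': "finite (crossing r D)" "finite (internal r D)"
    using fin crossing_subset internal_subset finite_subset by metis+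
  have "card (internal r D - {(v, v)}) + card {} < card (crossing r D)"
  proof -
    have "0 < card (internal r D)" using vv fin'(2) by (metis card_gt_0_iff empty_iff)
    then show ?thesis using vv card by (simp add: card_Diff_singleton)
  qed
  from supported_solution[OF fin'(1) _ _ this, of ?V f "\<lambda>_ _. 0"] fin'
  obtain Y where Y: "Y \<noteq> 0" "supported (crossing r D) Y"
    and eq: "\<forall>pq\<in>internal r D - {(v, v)}. coad ?V f Y pq = 0" by auto
  have "(\<Sum>p\<in>?V. coad ?V f Y (p, p)) = (\<Sum>p\<in>?V. if p = v then coad ?V f Y (v, v) else 0)"
    by (rule sum.cong) (use eq labelled_posetD(5)[OF r] in \<open>auto simp: internal_iff[OF D]\<close>)
  then have coad_vv: "coad ?V f Y (v, v) = 0"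
    using coad_trace[OF r] v fin by simp
  have coad: "coad ?V f Y pq = 0" if "pq \<in> r" for pq
  proof (cases "pq \<in> crossing r D")
    case True
    then show ?thesis
      using coad_crossing_crossing[OF Y(2)] by (cases pq) (auto simp: crossing_iff)
  next
    case False
    then show ?thesis using eq coad_vv that by (cases "pq = (v, v)") (auto simp: internal_def)
  qed
  have "(\<Sum>pq\<in>r. f pq * Y pq) = (\<Sum>p\<in>?V. \<Sum>t\<in>?V. f (p, t) * Y (p, t))"
    by (rule sum_over_relation[OF r]) (auto simp: crossing_iff intro!: supportedD[OF Y(2)])
  also have "\<dots> = (\<Sum>p\<in>?V. if p \<in> D then \<Sum>t\<in>?V. f (p, t) * Y (p, t) else 0)"
    by (intro sum.cong refl) (auto simp: crossing_iff intro!: sum.neutral supportedD[OF Y(2)])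
  also have "\<dots> = (\<Sum>p\<in>?V. if p \<in> D then - coad ?V f Y (p, p) else 0)"
    by (intro sum.cong refl)
      (auto simp: coad_def crossing_iff intro!: sum.neutral supportedD[OF Y(2)])
  also have "\<dots> = 0"
    by (intro sum.neutral) (use coad labelled_posetD(5)[OF r] in auto)
  finally show ?thesis using Y coad by (intro exI[of _ Y]) blast
qed

section \<open>One-forms supported on crossing relations\<close>

definition edge_indicator :: "nat rel \<Rightarrow> pmat" where
  "edge_indicator E = (\<lambda>pq. if pq \<in> E then 1 else 0)"

lemma coord_form_eq:
  assumes "finite r" "E \<subseteq> r"
  shows "coord_form E X = (\<Sum>pq\<in>r. edge_indicator E pq * X pq)"
proof -
  have "(\<Sum>pq\<in>r. edge_indicator E pq * X pq) = (\<Sum>pq\<in>r. if pq \<in> E then X pq else 0)"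
    by (rule sum.cong) (auto simp: edge_indicator_def)
  also have "\<dots> = (\<Sum>pq\<in>r \<inter> E. X pq)" using assms(1) by (simp add: sum.inter_restrict)
  also have "r \<inter> E = E" using assms(2) by blast
  finally show ?thesis by (simp add: coord_form_def)
qed

lemma one_form_coord_form: "one_form G (coord_form E)"
  by (simp add: one_form_def coord_form_def sum.distrib pmat_scale_def sum_distrib_left)

lemma bracket_diagonal:
  assumes r: "labelled_poset r" and "X \<in> lie_poset r" "Y \<in> lie_poset r"
  shows "poset_bracket r X Y (p, p) = 0"
proof -
  have "X (p, q) * Y (q, p) = Y (p, q) * X (q, p)" for q
  proof (cases "p = q")
    case False
    then have "(p, q) \<notin> r \<or> (q, p) \<notin> r"
      using labelled_posetD(4)[OF r] by (auto dest: antisymD)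
    then show ?thesis using lie_poset_outside[OF assms(2)] lie_poset_outside[OF assms(3)] by auto
  qed simp
  then show ?thesis by (simp add: bracket_apply)
qed

lemma coord_form_bracket:
  assumes r: "labelled_poset r" and E: "E \<subseteq> r" and X: "X \<in> lie_poset r" and Y: "Y \<in> lie_poset r"
  shows "coord_form E (poset_bracket r X Y)
    = (\<Sum>pq\<in>r. Y pq * coad (Field r) (edge_indicator E) X pq)"
  using coord_form_eq[OF labelled_posetD(1)[OF r] E] bracket_pairing[OF r X Y] by simp

text \<open>
  The kernel conditions of the forms of toral-pairs and contact toral-pairs. The summand
  \<open>E\<^sup>*\<^bsub>v,v\<^esub>\<close> of a contact form enters only through the value of the form, because brackets have zero
  diagonal.
\<close>

definition frobenius_kernel :: "nat rel \<Rightarrow> nat rel \<Rightarrow> bool" where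
  "frobenius_kernel r E \<longleftrightarrow>
     (\<forall>X\<in>lie_poset_A r. (\<forall>pq\<in>r. coad (Field r) (edge_indicator E) X pq = 0) \<longrightarrow> X = 0)"

definition contact_kernel :: "nat rel \<Rightarrow> nat rel \<Rightarrow> nat \<Rightarrow> bool" where
  "contact_kernel r E v \<longleftrightarrow>
     (\<forall>X\<in>lie_poset_A r. (\<forall>pq\<in>r. coad (Field r) (edge_indicator E) X pq = 0) \<longrightarrow>
        coord_form E X = 0 \<longrightarrow> X (v, v) = 0 \<longrightarrow> X = 0)"

lemma frobenius_form_kernel:
  assumes r: "labelled_poset r" and E: "E \<subseteq> r"
    and ker: "form_kernel (lie_poset_A r) (poset_bracket r) (coord_form E) = {0}"
  shows "frobenius_kernel r E"
  unfolding frobenius_kernel_def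
proof (intro ballI impI)
  fix X assume X: "X \<in> lie_poset_A r" "\<forall>pq\<in>r. coad (Field r) (edge_indicator E) X pq = 0"
  have "coord_form E (poset_bracket r X Y) = 0" if "Y \<in> lie_poset_A r" for Y
    using X that coord_form_bracket[OF r E, of X Y] by (simp add: lie_poset_A_iff)
  then have "X \<in> form_kernel (lie_poset_A r) (poset_bracket r) (coord_form E)"
    using X by (simp add: form_kernel_def)
  then show "X = 0" using ker by simp
qed

lemma contact_form_kernel:
  assumes r: "labelled_poset r" and E: "E \<subseteq> r" "(v, v) \<notin> E" and v: "v \<in> Field r"
    and contact: "contact_form (lie_poset_A r) (poset_bracket r) (coord_form (insert (v, v) E))"
  shows "contact_kernel r E v"
  unfolding contact_kernel_def
proof (intro ballI impI)
  fix X assume X: "X \<in> lie_poset_A r" "\<forall>pq\<in>r. coad (Field r) (edge_indicator E) X pq = 0"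
    "coord_form E X = 0" "X (v, v) = 0"
  have "finite E" using E labelled_posetD(1)[OF r] finite_subset by blast
  then have ins: "coord_form (insert (v, v) E) Z = Z (v, v) + coord_form E Z" for Z
    using E(2) by (simp add: coord_form_def)
  show "X = 0"
  proof (rule contact_form_nondegenerate[OF bracket_on_lie_poset_A[OF r] contact X(1)])
    show "coord_form (insert (v, v) E) X = 0" using X by (simp add: ins)
    fix Y assume "Y \<in> lie_poset_A r"
    then have mem: "X \<in> lie_poset r" "Y \<in> lie_poset r" using X by (simp_all add: lie_poset_A_iff)
    show "coord_form (insert (v, v) E) (poset_bracket r X Y) = 0"
      using X(2) by (simp add: ins bracket_diagonal[OF r mem] coord_form_bracket[OF r E(1) mem])
  qed
qed

text \<open>
  The traceless part of an element of the kernel is again in the kernel, so passing to the full algebra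
  adds nothing but scalars.
\<close>

lemma frobenius_kernel_scalar:
  assumes r: "labelled_poset r" and ker: "frobenius_kernel r E" and v: "v \<in> Field r"
    and X: "X \<in> lie_poset r" "\<And>pq. pq \<in> r \<Longrightarrow> coad (Field r) (edge_indicator E) X pq = 0"
  shows "X = scalar_matrix (Field r) (X (v, v))"
proof -
  let ?V = "Field r"
  have "coad ?V (edge_indicator E) (traceless_part ?V X) pq = 0" if "pq \<in> r" for pq
  proof -
    have "fst pq \<in> ?V" "snd pq \<in> ?V" using that by (cases pq; auto simp: Field_def)+
    from coad_subtract_scalar[OF labelled_posetD(2)[OF r] this] show ?thesis
      using X(2)[OF that] by (simp add: traceless_part_def)
  qed
  moreover have "traceless_part ?V X \<in> lie_poset_A r"
    using traceless_part_in_lie_poset_A[OF r _ X(1)] v by blast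
  ultimately have "traceless_part ?V X = 0" using ker by (simp add: frobenius_kernel_def)
  then obtain c where scalar: "X = scalar_matrix ?V c" by (simp add: traceless_part_def)
  then have "X (v, v) = c" using v by (simp add: scalar_matrix_def)
  then show ?thesis using scalar by simp
qed

lemma supported_edge_indicator: "E \<subseteq> A \<Longrightarrow> supported A (edge_indicator E)"
  by (auto simp: supported_def edge_indicator_def)

lemma coad_internal_all:
  assumes D: "down_closed r D" and f: "supported (crossing r D) f"
    and X: "supported (internal r D) X" and eq: "\<And>pq. pq \<in> crossing r D \<Longrightarrow> coad V f X pq = 0"
    and pq: "pq \<in> r"
  shows "coad V f X pq = 0"
proof (cases "pq \<in> crossing r D")
  case False
  then have "pq \<in> internal r D" using pq by (simp add: internal_def)
  then show ?thesis using coad_internal_internal[OF D f X] by (cases pq) simp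
qed (rule eq)

text \<open>
  A form supported on crossing relations pairs the internal with the crossing part. When its kernel is
  as small as possible, both parts have the same dimension, or for contact forms the internal part
  has one more; the internal relations also count the identity matrix.
\<close>

lemma card_internal_frobenius:
  assumes r: "labelled_poset r" and D: "down_closed r D" and E: "E \<subseteq> crossing r D"
    and v: "v \<in> Field r" and ker: "frobenius_kernel r E"
  shows "card (internal r D) = card (crossing r D) + 1"
proof (rule antisym)
  let ?V = "Field r" and ?f = "edge_indicator E"
  have f: "supported (crossing r D) ?f" using E by (rule supported_edge_indicator)
  have fin': "finite (crossing r D)" "finite (internal r D)"
    using labelled_posetD(1)[OF r] crossing_subset internal_subset finite_subset by metis+
  have vv: "(v, v) \<in> internal r D"
    using labelled_posetD(5)[OF r v] by (simp add: internal_iff[OF D])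
  show "card (internal r D) \<le> card (crossing r D) + 1"
  proof (rule ccontr)
    assume "\<not> ?thesis"
    then have "card (crossing r D) + card {} < card (internal r D - {(v, v)})"
      using vv fin' by (simp add: card_Diff_singleton)
    from supported_solution[OF _ fin'(1) _ this, of ?V ?f "\<lambda>_ _. 0"] fin'
    obtain X where X: "X \<noteq> 0" "supported (internal r D - {(v, v)}) X"
      "\<forall>pq\<in>crossing r D. coad ?V ?f X pq = 0" by auto
    have X': "supported (internal r D) X" using X(2) by (rule supported_mono) blast
    then have "X \<in> lie_poset r"
      unfolding lie_poset_eq_supported using internal_subset by (rule supported_mono)
    moreover have "coad ?V ?f X pq = 0" if "pq \<in> r" for pq
      by (rule coad_internal_all[OF D f X' _ that]) (use X(3) in blast)
    ultimately have "X = scalar_matrix ?V (X (v, v))"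
      by (rule frobenius_kernel_scalar[OF r ker v])
    moreover have "X (v, v) = 0" using supportedD[OF X(2)] by blast
    ultimately have "X = scalar_matrix ?V 0" by metis
    then have "X = 0" by (auto simp: scalar_matrix_def fun_eq_iff)
    with X(1) show False by simp
  qed
  show "card (crossing r D) + 1 \<le> card (internal r D)"
  proof (rule ccontr)
    assume "\<not> ?thesis"
    then have "card (internal r D) \<le> card (crossing r D)" by simp
    from crossing_kernel[OF r D v this, of ?f] obtain Y where
      Y: "Y \<noteq> 0" "supported (crossing r D) Y" "\<forall>pq\<in>r. coad ?V ?f Y pq = 0" by blast
    have "Y \<in> lie_poset_A r"
      unfolding lie_poset_A_iff lie_poset_eq_supported matrix_trace_def
      using supported_mono[OF Y(2) crossing_subset]
      by (auto intro!: sum.neutral supportedD[OF Y(2)] simp: crossing_iff)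
    with ker Y show False by (simp add: frobenius_kernel_def)
  qed
qed

lemma card_internal_contact:
  assumes r: "labelled_poset r" and D: "down_closed r D" and E: "E \<subseteq> crossing r D"
    and v: "v \<in> Field r" and ker: "contact_kernel r E v" and odd: "card r - 1 = 2 * k + 1"
  shows "card (internal r D) = card (crossing r D) + 2"
proof -
  let ?V = "Field r" and ?f = "edge_indicator E"
  note fin = labelled_posetD(1)[OF r]
  have f: "supported (crossing r D) ?f" using E by (rule supported_edge_indicator)
  have fin': "finite (crossing r D)" "finite (internal r D)"
    using fin crossing_subset internal_subset finite_subset by metis+
  have vv: "(v, v) \<in> internal r D"
    using labelled_posetD(5)[OF r v] by (simp add: internal_iff[OF D])
  have E': "coord_form E X = (\<Sum>pq\<in>r. ?f pq * X pq)" for X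
    using E crossing_subset by (intro coord_form_eq[OF fin]) blast
  have 1: "card (internal r D) \<le> card (crossing r D) + 2"
  proof (rule ccontr)
    assume "\<not> ?thesis"
    then have "card (crossing r D) + card {()} < card (internal r D - {(v, v)})"
      using vv fin' by (simp add: card_Diff_singleton)
    from supported_solution[OF _ fin'(1) _ this, of ?V ?f "\<lambda>_ pq. if fst pq = snd pq then 1 else 0"] fin'
    obtain X where X: "X \<noteq> 0" "supported (internal r D - {(v, v)}) X"
      "\<forall>pq\<in>crossing r D. coad ?V ?f X pq = 0"
      and tr: "(\<Sum>pq\<in>internal r D - {(v, v)}. (if fst pq = snd pq then 1 else 0) * X pq) = 0" by auto
    have X': "supported (internal r D) X" using X(2) by (rule supported_mono) blast
    have Xr: "X \<in> lie_poset r"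
      unfolding lie_poset_eq_supported using X' internal_subset by (rule supported_mono)
    have "matrix_trace ?V X = (\<Sum>pq\<in>(\<lambda>p. (p, p)) ` ?V. (if fst pq = snd pq then 1 else 0) * X pq)"
      unfolding matrix_trace_def by (subst sum.reindex) (auto simp: inj_on_def)
    also have "\<dots> = (\<Sum>pq\<in>r. (if fst pq = snd pq then 1 else 0) * X pq)"
      using fin labelled_posetD(5)[OF r] by (intro sum.mono_neutral_left) (auto simp: Field_def)
    also have "\<dots> = (\<Sum>pq\<in>internal r D - {(v, v)}. (if fst pq = snd pq then 1 else 0) * X pq)"
      using fin internal_subset[of r D] by (intro sum.mono_neutral_right) (auto simp: supportedD[OF X(2)])
    finally have "matrix_trace ?V X = 0" using tr by simp
    then have "X \<in> lie_poset_A r" using Xr by (simp add: lie_poset_A_iff)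
    moreover have "coad ?V ?f X pq = 0" if "pq \<in> r" for pq
      by (rule coad_internal_all[OF D f X' _ that]) (use X(3) in blast)
    moreover have "coord_form E X = 0"
      unfolding coord_form_def using E by (intro sum.neutral) (auto simp: internal_def intro!: supportedD[OF X'])
    moreover have "X (v, v) = 0" using supportedD[OF X(2)] by blast
    ultimately show False using ker X(1) by (simp add: contact_kernel_def)
  qed
  have 2: "card (crossing r D) < card (internal r D)"
  proof (rule ccontr)
    assume "\<not> ?thesis"
    then have "card (internal r D) \<le> card (crossing r D)" by simp
    from crossing_kernel[OF r D v this, of ?f] obtain Y where
      Y: "Y \<noteq> 0" "supported (crossing r D) Y" "\<forall>pq\<in>r. coad ?V ?f Y pq = 0"
      "(\<Sum>pq\<in>r. ?f pq * Y pq) = 0" by blast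
    have diag: "Y (p, p) = 0" for p by (auto intro!: supportedD[OF Y(2)] simp: crossing_iff)
    have "Y \<in> lie_poset_A r"
      unfolding lie_poset_A_iff lie_poset_eq_supported matrix_trace_def
      using supported_mono[OF Y(2) crossing_subset] diag by simp
    with ker Y E' diag show False by (simp add: contact_kernel_def)
  qed
  have "card r = card (internal r D) + card (crossing r D)" by (rule card_internal_crossing[OF fin])
  with odd 1 2 show ?thesis by presburger
qed

section \<open>Toral-pairs as cut posets\<close>

text \<open>
  The combinatorial conditions that toral-pairs and contact toral-pairs have in common.
\<close>

definition spanning_cut :: "nat rel \<Rightarrow> nat rel \<Rightarrow> bool" where
  "spanning_cut r E \<longleftrightarrow> labelled_poset r \<and> card (Ext r) \<in> {2, 3} \<and> small r E \<and>
     order_ideal r (sources (Field r) E) \<and> other_vertices (Field r) E = {} \<and>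
     (\<forall>p\<in>Ext r. \<forall>q\<in>Ext r. (p, q) \<in> Rel r \<longrightarrow> (p, q) \<in> E)"

lemma exists_minimal_below:
  assumes r: "labelled_poset r" and x: "x \<in> Field r"
  shows "\<exists>m\<in>minimal_elements r. (m, x) \<in> r"
proof -
  define A where "A = {y. (y, x) \<in> r}"
  have "x \<in> A" using labelled_posetD(5)[OF r x] by (simp add: A_def)
  define m where "m = (LEAST y. y \<in> A)"
  have m: "m \<in> A" unfolding m_def using \<open>x \<in> A\<close> by (rule LeastI)
  have "(y, m) \<notin> Rel r" for y
  proof
    assume "(y, m) \<in> Rel r"
    then have y: "(y, m) \<in> r" "y \<noteq> m" by (auto simp: Rel_def)
    then have "y \<in> A" using m labelled_posetD(3)[OF r] by (auto simp: A_def dest: transD)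
    then have "m \<le> y" unfolding m_def by (rule Least_le)
    with y labelled_posetD(6)[OF r y(1)] show False by simp
  qed
  then show ?thesis using m by (auto simp: minimal_elements_def A_def Field_def)
qed

lemma exists_maximal_above:
  assumes r: "labelled_poset r" and x: "x \<in> Field r"
  shows "\<exists>m\<in>maximal_elements r. (x, m) \<in> r"
proof -
  define A where "A = {y. (x, y) \<in> r}"
  have fin: "finite A" using labelled_posetD(2)[OF r] by (rule rev_finite_subset) (auto simp: A_def Field_def)
  have "x \<in> A" using labelled_posetD(5)[OF r x] by (simp add: A_def)
  define m where "m = Max A"
  have m: "m \<in> A" unfolding m_def using fin \<open>x \<in> A\<close> by (intro Max_in) auto
  have "(m, y) \<notin> Rel r" for y
  proof
    assume "(m, y) \<in> Rel r"
    then have y: "(m, y) \<in> r" "y \<noteq> m" by (auto simp: Rel_def)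
    then have "y \<in> A" using m labelled_posetD(3)[OF r] by (auto simp: A_def dest: transD)
    then have "y \<le> m" unfolding m_def using fin by simp
    with y labelled_posetD(6)[OF r y(1)] show False by simp
  qed
  then show ?thesis using m by (auto simp: maximal_elements_def A_def Field_def)
qed

lemma spanning_cut_incident:
  assumes cut: "spanning_cut r E" and p: "p \<in> Field r"
  shows "\<exists>q. (p, q) \<in> E \<or> (q, p) \<in> E"
proof -
  have "finite (Ext r)" "Ext r \<subseteq> Field r" "2 \<le> card (Ext r)"
    using cut labelled_posetD(2)[of r]
    by (auto simp: spanning_cut_def Ext_def minimal_elements_def maximal_elements_def
        intro: rev_finite_subset)
  moreover have "\<not> Ext r \<subseteq> {p}"
  proof
    assume "Ext r \<subseteq> {p}"
    then have "card (Ext r) \<le> 1" using card_mono[of "{p}" "Ext r"] by simp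
    with \<open>2 \<le> card (Ext r)\<close> show False by simp
  qed
  ultimately obtain q where q: "q \<in> Field r" "q \<noteq> p" by blast
  have "(p, q) \<in> (E \<union> E\<inverse>)\<^sup>*"
    using cut p q by (auto simp: spanning_cut_def small_def graph_connected_def)
  then show ?thesis using q(2) by (auto elim: converse_rtranclE)
qed

text \<open>
  Every vertex is a source or a sink but not both, so all edges cross from the sources to the sinks.
  With at most three extremal elements, either the minimal or the maximal element is unique; hence
  every minimal element lies below every maximal one.
\<close>

lemma spanning_cut_properties:
  assumes cut: "spanning_cut r E"
  defines "D \<equiv> sources (Field r) E"
  shows "E \<subseteq> crossing r D" "down_closed r D" "minimal_elements r \<subseteq> D" "maximal_elements r \<inter> D = {}"
    "minimal_elements r \<times> maximal_elements r \<subseteq> E"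
    "card (Ext r) = Suc (card (minimal_elements r \<times> maximal_elements r))" "Ext r \<noteq> {}" "D \<subseteq> Field r"
proof -
  note r = cut[unfolded spanning_cut_def, THEN conjunct1]
  have E: "E \<subseteq> Rel r" using cut by (simp add: spanning_cut_def small_def)
  note inc = spanning_cut_incident[OF cut]
  have EV: "p \<in> Field r" "q \<in> Field r" if "(p, q) \<in> E" for p q
    using E that by (auto simp: Rel_def Field_def)
  have sinks: "p \<in> D \<or> (\<forall>q. (p, q) \<notin> E)" if "p \<in> Field r" for p
    using cut that by (auto simp: spanning_cut_def other_vertices_def sinks_def D_def)
  show "E \<subseteq> crossing r D"
  proof
    fix x assume x: "x \<in> E"
    obtain p q where pq: "x = (p, q)" by (cases x)
    have "p \<in> D" using sinks EV x pq by blast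
    moreover have "q \<notin> D" using x pq by (auto simp: D_def sources_def)
    ultimately show "x \<in> crossing r D" using E x pq by (auto simp: crossing_iff Rel_def)
  qed
  show "down_closed r D"
    using cut by (fastforce simp: spanning_cut_def order_ideal_def down_closed_def D_def Rel_def)
  show min: "minimal_elements r \<subseteq> D"
    using E by (auto simp: D_def sources_def minimal_elements_def)
  show max: "maximal_elements r \<inter> D = {}"
    using E inc by (fastforce simp: D_def sources_def maximal_elements_def)
  show "D \<subseteq> Field r" by (auto simp: D_def sources_def)
  have fin: "finite (minimal_elements r)" "finite (maximal_elements r)"
    using labelled_posetD(2)[OF r]
    by (auto simp: minimal_elements_def maximal_elements_def)
  have card3: "card (Ext r) \<in> {2, 3}" using cut by (simp add: spanning_cut_def)
  then show ne: "Ext r \<noteq> {}" by auto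
  then obtain x where "x \<in> Field r"
    by (auto simp: Ext_def minimal_elements_def maximal_elements_def)
  then have "minimal_elements r \<noteq> {}" "maximal_elements r \<noteq> {}"
    using exists_minimal_below[OF r] exists_maximal_above[OF r] by blast+
  then have pos: "0 < card (minimal_elements r)" "0 < card (maximal_elements r)"
    using fin by (simp_all add: card_gt_0_iff)
  have "minimal_elements r \<inter> maximal_elements r = {}" using min max by blast
  then have card_Ext: "card (Ext r) = card (minimal_elements r) + card (maximal_elements r)"
    unfolding Ext_def using fin by (intro card_Un_disjoint)
  have one: "card (minimal_elements r) = 1 \<or> card (maximal_elements r) = 1"
    using card3 card_Ext pos by auto
  then show "card (Ext r) = Suc (card (minimal_elements r \<times> maximal_elements r))"
    using card_Ext by (auto simp: card_cartesian_product)
  show "minimal_elements r \<times> maximal_elements r \<subseteq> E"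
  proof clarify
    fix p q assume p: "p \<in> minimal_elements r" and q: "q \<in> maximal_elements r"
    have V: "p \<in> Field r" "q \<in> Field r"
      using p q by (auto simp: minimal_elements_def maximal_elements_def)
    have "(p, q) \<in> r"
      using one
    proof
      assume "card (minimal_elements r) = 1"
      then have "minimal_elements r = {p}" using p by (auto simp: card_1_singleton_iff)
      then show ?thesis using exists_minimal_below[OF r V(2)] by auto
    next
      assume "card (maximal_elements r) = 1"
      then have "maximal_elements r = {q}" using q by (auto simp: card_1_singleton_iff)
      then show ?thesis using exists_maximal_above[OF r V(1)] by auto
    qed
    moreover have "p \<noteq> q" using p q min max by blast
    ultimately show "(p, q) \<in> E"
      using cut p q by (auto simp: spanning_cut_def Ext_def Rel_def)
  qed
qed

lemma toral_pair_cut: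
  assumes "toral_pair r \<phi>"
  shows "\<exists>E. spanning_cut r E \<and> frobenius_kernel r E"
proof -
  from assms obtain E where E: "E \<subseteq> Rel r" "labelled_poset r" "spanning_cut r E"
    "frobenius_form (lie_poset_A r) (poset_bracket r) (coord_form E)"
    unfolding toral_pair_def spanning_cut_def by blast
  then have "E \<subseteq> r" by (auto simp: Rel_def)
  then show ?thesis
    using E frobenius_form_kernel[OF E(2)] unfolding frobenius_form_def by blast
qed

lemma one_in_Field:
  assumes "labelled_poset r" "Field r \<noteq> {}"
  shows "1 \<in> Field r" "1 \<in> minimal_elements r"
proof -
  obtain n where n: "Field r = {1..n}" using labelled_poset_Field[OF assms(1)] by blast
  then show one: "1 \<in> Field r" using assms(2) by auto
  have "(y, 1) \<notin> Rel r" for y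
  proof
    assume "(y, 1) \<in> Rel r"
    then have y: "(y, 1) \<in> r" "y \<noteq> 1" by (auto simp: Rel_def)
    have "1 \<le> y" using FieldI_pair(1)[OF y(1)] n by simp
    with labelled_posetD(6)[OF assms(1) y(1)] y(2) show False by simp
  qed
  then show "1 \<in> minimal_elements r" using one by (simp add: minimal_elements_def)
qed

lemma contact_toral_pair_cut:
  assumes "contact_toral_pair r \<phi>"
  shows "\<exists>E k. spanning_cut r E \<and> contact_kernel r E 1 \<and> card r - 1 = 2 * k + 1"
proof -
  from assms obtain E where E: "E \<subseteq> Rel r \<union> Id_on (Field r)"
    and contact: "contact_form (lie_poset_A r) (poset_bracket r) (coord_form E)"
    and diag: "\<forall>p\<in>Field r. (p, p) \<in> E \<longleftrightarrow> p = 1" and cut: "spanning_cut r (E - {(1, 1)})"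
    unfolding contact_toral_pair_def spanning_cut_def Let_def by blast
  have r: "labelled_poset r" using cut by (simp add: spanning_cut_def)
  have ne: "Field r \<noteq> {}"
    using spanning_cut_properties(7)[OF cut]
    by (auto simp: Ext_def minimal_elements_def maximal_elements_def)
  note one = one_in_Field(1)[OF r ne]
  have "insert (1, 1) (E - {(1, 1)}) = E" using diag one by blast
  moreover have "E - {(1, 1)} \<subseteq> r"
    using cut by (auto simp: spanning_cut_def small_def Rel_def)
  ultimately have "contact_kernel r (E - {(1, 1)}) 1"
    using contact by (intro contact_form_kernel[OF r _ _ one]) auto
  moreover obtain k where "pmat.dim (lie_poset_A r) = 2 * k + 1"
    using contact by (auto simp: contact_form_def)
  then have "card r - 1 = 2 * k + 1" using dim_lie_poset_A[OF r ne] by simp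
  ultimately show ?thesis using cut by blast
qed

section \<open>Amalgams of pieces along extremal elements\<close>

text \<open>
  Two pieces share only elements that are minimal in both or maximal in both, whatever rules were
  applied; the rules differ only in the number of shared vertices and relations.
\<close>

locale amalgam =
  fixes P :: "nat rel" and I :: "'i set" and T :: "'i \<Rightarrow> nat rel" and D :: "nat set"
  assumes P: "labelled_poset P" and fin_I: "finite I" and P_eq: "P = (\<Union>i\<in>I. T i)"
    and refl_T: "\<And>i p. i \<in> I \<Longrightarrow> p \<in> Field (T i) \<Longrightarrow> (p, p) \<in> T i"
    and down_T: "\<And>i. i \<in> I \<Longrightarrow> down_closed (T i) D"
    and min_D: "\<And>i. i \<in> I \<Longrightarrow> minimal_elements (T i) \<subseteq> D"
    and max_D: "\<And>i. i \<in> I \<Longrightarrow> maximal_elements (T i) \<inter> D = {}"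
    and min_max_T: "\<And>i. i \<in> I \<Longrightarrow> minimal_elements (T i) \<times> maximal_elements (T i) \<subseteq> T i"
    and card_Ext_T: "\<And>i. i \<in> I \<Longrightarrow>
      card (Ext (T i)) = Suc (card (minimal_elements (T i) \<times> maximal_elements (T i)))"
    and overlap: "\<And>i j v. i \<in> I \<Longrightarrow> j \<in> I \<Longrightarrow> i \<noteq> j \<Longrightarrow> v \<in> Field (T i) \<Longrightarrow> v \<in> Field (T j) \<Longrightarrow>
      v \<in> minimal_elements (T i) \<and> v \<in> minimal_elements (T j) \<or>
      v \<in> maximal_elements (T i) \<and> v \<in> maximal_elements (T j)"
begin

abbreviation V :: "nat set" where "V \<equiv> Field P"

text \<open>
  The extremal diagonal is removed because it is the only place where pieces share internal relations.
\<close>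

definition local_entries :: "'i \<Rightarrow> nat rel" where
  "local_entries i = internal (T i) D - Id_on (Ext (T i))"

lemma T_subset: "i \<in> I \<Longrightarrow> T i \<subseteq> P"
  using P_eq by blast

lemma in_T: "pq \<in> P \<Longrightarrow> \<exists>i\<in>I. pq \<in> T i"
  using P_eq by blast

lemma finite_P: "finite P" and finite_V: "finite V"
  using labelled_posetD[OF P] by blast+

lemma finite_T: "i \<in> I \<Longrightarrow> finite (T i)"
  using T_subset finite_P finite_subset by blast

lemma Field_T: "i \<in> I \<Longrightarrow> Field (T i) \<subseteq> V"
  using T_subset mono_Field by blast

lemma Ext_Field: "Ext (T i) \<subseteq> Field (T i)"
  by (auto simp: Ext_def minimal_elements_def maximal_elements_def)

lemma down_P: "down_closed P D"
  unfolding down_closed_def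
proof clarify
  fix x y assume xy: "(x, y) \<in> P" "y \<in> D"
  then obtain i where "i \<in> I" "(x, y) \<in> T i" using in_T by blast
  then show "x \<in> D" using down_T xy unfolding down_closed_def by blast
qed

lemma below_min: "(s, p) \<in> T i \<Longrightarrow> p \<in> minimal_elements (T i) \<Longrightarrow> s = p"
  by (auto simp: minimal_elements_def Rel_def)

lemma above_max: "(q, t) \<in> T i \<Longrightarrow> q \<in> maximal_elements (T i) \<Longrightarrow> t = q"
  by (auto simp: maximal_elements_def Rel_def)

text \<open>
  An element of \<open>D\<close> shared by two pieces is minimal in both, so everything below an element of \<open>D\<close>
  stays in its piece; dually above the elements outside \<open>D\<close>.
\<close>

lemma below_local:
  assumes "i \<in> I" "(p, q) \<in> P" "q \<in> Field (T i)" "q \<in> D"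
  shows "(p, q) \<in> T i"
proof -
  obtain j where j: "j \<in> I" "(p, q) \<in> T j" using in_T[OF assms(2)] by blast
  show ?thesis
  proof (cases "i = j")
    case False
    have "q \<in> Field (T j)" using j by (auto simp: Field_def)
    then have "q \<in> minimal_elements (T j)"
      using overlap[OF assms(1) j(1) False assms(3)] max_D[OF assms(1)] assms(4) by blast
    then have "p = q" using below_min j by blast
    then show ?thesis using refl_T[OF assms(1,3)] by simp
  qed (use j in simp)
qed

lemma above_local:
  assumes "i \<in> I" "(p, q) \<in> P" "p \<in> Field (T i)" "p \<notin> D"
  shows "(p, q) \<in> T i"
proof -
  obtain j where j: "j \<in> I" "(p, q) \<in> T j" using in_T[OF assms(2)] by blast
  show ?thesis
  proof (cases "i = j")
    case False
    have "p \<in> Field (T j)" using j by (auto simp: Field_def)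
    then have "p \<in> maximal_elements (T j)"
      using overlap[OF assms(1) j(1) False assms(3)] min_D[OF assms(1)] assms(4) by blast
    then have "q = p" using above_max j by blast
    then show ?thesis using refl_T[OF assms(1,3)] by simp
  qed (use j in simp)
qed

lemma overlap_min:
  assumes "i \<in> I" "j \<in> I" "i \<noteq> j" "v \<in> Field (T i)" "v \<in> Field (T j)" "v \<in> D"
  shows "v \<in> minimal_elements (T i)"
  using overlap[OF assms(1-5)] max_D[OF assms(1)] assms(6) by blast

lemma overlap_max:
  assumes "i \<in> I" "j \<in> I" "i \<noteq> j" "v \<in> Field (T i)" "v \<in> Field (T j)" "v \<notin> D"
  shows "v \<in> maximal_elements (T i)"
  using overlap[OF assms(1-5)] min_D[OF assms(1)] assms(6) by blast

lemma local_entriesD: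
  assumes "i \<in> I" "(p, q) \<in> local_entries i"
  shows "(p, q) \<in> T i" "(p, q) \<in> internal P D" "p \<in> Field (T i)" "q \<in> Field (T i)"
    "q \<in> D \<Longrightarrow> q \<notin> minimal_elements (T i)" "p \<notin> D \<Longrightarrow> p \<notin> maximal_elements (T i)"
proof -
  show T: "(p, q) \<in> T i" using assms internal_subset by (auto simp: local_entries_def)
  show "(p, q) \<in> internal P D"
    using assms T_subset internal_iff[OF down_T[OF assms(1)]] internal_iff[OF down_P]
    by (auto simp: local_entries_def)
  show "p \<in> Field (T i)" "q \<in> Field (T i)" using T by (auto simp: Field_def)
  show "q \<notin> minimal_elements (T i)"
  proof
    assume "q \<in> minimal_elements (T i)"
    with below_min[OF T this] assms(2) show False by (auto simp: local_entries_def Ext_def)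
  qed
  show "p \<notin> maximal_elements (T i)"
  proof
    assume "p \<in> maximal_elements (T i)"
    with above_max[OF T this] assms(2) show False by (auto simp: local_entries_def Ext_def)
  qed
qed

lemma local_entries_disjoint:
  assumes "i \<in> I" "j \<in> I" "i \<noteq> j"
  shows "local_entries i \<inter> local_entries j = {}"
proof (rule ccontr)
  assume "\<not> ?thesis"
  then obtain p q where i: "(p, q) \<in> local_entries i" and j: "(p, q) \<in> local_entries j" by auto
  have "p \<in> D \<longleftrightarrow> q \<in> D" using local_entriesD(2)[OF assms(1) i] internal_iff[OF down_P] by blast
  then show False
    using overlap_min[OF assms local_entriesD(4)[OF assms(1) i] local_entriesD(4)[OF assms(2) j]]
      overlap_max[OF assms local_entriesD(3)[OF assms(1) i] local_entriesD(3)[OF assms(2) j]]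
      local_entriesD(5,6)[OF assms(1) i] by blast
qed

text \<open>
  An entry of \<open>X\<close> that contributes to \<open>coad V f X (p, q)\<close> makes \<open>p\<close> or \<open>q\<close> a non-extremal element of
  the piece, and then \<open>(p, q)\<close> is a relation of the piece. In particular nothing contributes between
  extremal elements.
\<close>

lemma local_coad:
  assumes i: "i \<in> I" and X: "supported (local_entries i) X"
    and eq: "\<And>pq. pq \<in> crossing (T i) D - minimal_elements (T i) \<times> maximal_elements (T i) \<Longrightarrow>
      coad V f X pq = 0"
    and pq: "pq \<in> crossing P D"
  shows "coad V f X pq = 0"
proof -
  obtain p q where p_q: "pq = (p, q)" "p \<in> D" "q \<notin> D" "(p, q) \<in> P"
    using pq by (cases pq) (auto simp: crossing_iff)
  show ?thesis
  proof (cases "pq \<in> crossing (T i) D - minimal_elements (T i) \<times> maximal_elements (T i)")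
    case False
    have "X (s, p) = 0" for s
    proof (rule ccontr)
      assume "X (s, p) \<noteq> 0"
      then have sp: "(s, p) \<in> local_entries i" using supportedD[OF X] by blast
      note p = local_entriesD(4)[OF i sp] local_entriesD(5)[OF i sp p_q(2)]
      obtain j where j: "j \<in> I" "(p, q) \<in> T j" using in_T[OF p_q(4)] by blast
      have "p \<in> Field (T j)" using j by (auto simp: Field_def)
      then have "j = i" using overlap_min[OF i j(1) _ p(1) _ p_q(2)] p(2) by blast
      then show False using False j p p_q by (auto simp: crossing_iff)
    qed
    moreover have "X (q, t) = 0" for t
    proof (rule ccontr)
      assume "X (q, t) \<noteq> 0"
      then have qt: "(q, t) \<in> local_entries i" using supportedD[OF X] by blast
      note q = local_entriesD(3)[OF i qt] local_entriesD(6)[OF i qt p_q(3)]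
      obtain j where j: "j \<in> I" "(p, q) \<in> T j" using in_T[OF p_q(4)] by blast
      have "q \<in> Field (T j)" using j by (auto simp: Field_def)
      then have "j = i" using overlap_max[OF i j(1) _ q(1) _ p_q(3)] q(2) by blast
      then show False using False j q p_q by (auto simp: crossing_iff)
    qed
    ultimately show ?thesis by (simp add: coad_def p_q(1))
  qed (rule eq)
qed

text \<open>
  A middle element \<open>p\<close> of a nonzero product would be shared, hence extremal in both pieces, but local
  entries do not end at minimal nor start at maximal elements.
\<close>

lemma local_product_zero:
  assumes i: "i \<in> I" "supported (local_entries i) X" and j: "j \<in> I" "supported (local_entries j) Y"
    and "i \<noteq> j"
  shows "X (s, p) * Y (p, q) = 0"
proof (rule ccontr)
  assume "X (s, p) * Y (p, q) \<noteq> 0"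
  then have sp: "(s, p) \<in> local_entries i" and pq: "(p, q) \<in> local_entries j"
    using supportedD[OF i(2), of "(s, p)"] supportedD[OF j(2), of "(p, q)"] by auto
  show False
  proof (cases "p \<in> D")
    case True
    with overlap_min[OF i(1) j(1) assms(5) local_entriesD(4)[OF i(1) sp] local_entriesD(3)[OF j(1) pq]]
      local_entriesD(5)[OF i(1) sp] show False by blast
  next
    case False
    with overlap_max[OF j(1) i(1) assms(5)[symmetric] local_entriesD(3)[OF j(1) pq]
        local_entriesD(4)[OF i(1) sp]] local_entriesD(6)[OF j(1) pq] show False by blast
  qed
qed

lemma local_in_lie_poset: "i \<in> I \<Longrightarrow> supported (local_entries i) X \<Longrightarrow> X \<in> lie_poset P"
  unfolding lie_poset_eq_supported
  by (erule supported_mono) (use local_entriesD(2) internal_subset in fastforce)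

lemma local_pairing_zero:
  assumes z: "\<And>i. i \<in> C \<Longrightarrow> supported (local_entries i) (z i)" and C: "C \<subseteq> I"
    and ij: "i \<in> C" "j \<in> C"
  shows "(\<Sum>pq\<in>P. z j pq * coad V f (z i) pq) = 0"
proof (cases "i = j")
  case True
  have "z i \<in> lie_poset P" using local_in_lie_poset z C ij by blast
  from coad_skew[OF P this this, of f] True show ?thesis by simp
next
  case False
  have iI: "i \<in> I" "j \<in> I" using C ij by auto
  have 0: "z j (p, q) * (f (s, q) * z i (s, p)) = 0" "z j (p, q) * (f (p, t) * z i (q, t)) = 0"
    for p q s t
    using local_product_zero[OF iI(1) z[OF ij(1)] iI(2) z[OF ij(2)] False, of s p q]
      local_product_zero[OF iI(2) z[OF ij(2)] iI(1) z[OF ij(1)] False[symmetric], of p q t] by auto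
  have "z j (p, q) * coad V f (z i) (p, q) = 0" for p q
    unfolding coad_def prod.case right_diff_distrib sum_distrib_left
    by (simp only: 0 sum.neutral_const diff_self)
  then show ?thesis by (intro sum.neutral) auto
qed

text \<open>
  In a piece with excess, the entries away from the extremal diagonal outnumber the equations that
  make a matrix act trivially on the crossing part: between extremal elements these equations hold
  anyway, and there is one of them less than extremal elements.
\<close>

lemma local_solution:
  assumes i: "i \<in> I" and excess: "card (crossing (T i) D) + 1 < card (internal (T i) D)"
  shows "\<exists>z. z \<noteq> 0 \<and> supported (local_entries i) z \<and> (\<forall>pq\<in>crossing P D. coad V f z pq = 0)"
proof -
  let ?M = "minimal_elements (T i) \<times> maximal_elements (T i)"
  have fin: "finite (crossing (T i) D)" "finite (internal (T i) D)"
    using finite_T[OF i] crossing_subset internal_subset finite_subset by metis+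
  have M: "?M \<subseteq> crossing (T i) D"
    using min_max_T[OF i] min_D[OF i] max_D[OF i] by (auto simp: crossing_iff)
  have finM: "finite ?M" using M fin(1) by (rule finite_subset)
  have finE: "finite (Ext (T i))"
    using Ext_Field finite_T[OF i] by (metis finite_Field finite_subset)
  have E: "Id_on (Ext (T i)) \<subseteq> internal (T i) D"
    using refl_T[OF i] Ext_Field[of i] by (auto simp: internal_iff[OF down_T[OF i]])
  have "Id_on (Ext (T i)) = (\<lambda>p. (p, p)) ` Ext (T i)" by auto
  then have cardE: "card (Id_on (Ext (T i))) = Suc (card ?M)"
    using card_Ext_T[OF i] by (simp add: card_image inj_on_def)
  have finId: "finite (Id_on (Ext (T i)))" using E fin(2) by (rule finite_subset)
  have le: "card ?M \<le> card (crossing (T i) D)" using fin(1) M by (rule card_mono)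
  have "card (crossing (T i) D - ?M) + card {} < card (local_entries i)"
    unfolding local_entries_def
    using excess le by (simp add: card_Diff_subset[OF finM M] card_Diff_subset[OF finId E] cardE)
  from supported_solution[OF _ _ _ this, of V f "\<lambda>_ _. 0"] fin
  obtain z where z: "z \<noteq> 0" "supported (local_entries i) z"
    and eq: "\<forall>pq\<in>crossing (T i) D - ?M. coad V f z pq = 0" by (auto simp: local_entries_def)
  have "coad V f z pq = 0" if "pq \<in> crossing P D" for pq
    by (rule local_coad[OF i z(2) _ that]) (use eq in blast)
  with z show ?thesis by blast
qed

text \<open>
  The crossing part together with one such matrix from every piece with excess spans an isotropic
  subspace for \<open>d\<phi>\<close>. For a contact form, an isotropic subspace has at most half the dimension, rounded
  up. Explicitly, an element of it that is orthogonal to a complement and in the kernel of \<open>\<phi>\<close> vanishes.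
\<close>

lemma isotropic_bound:
  assumes C: "C \<subseteq> I" "\<And>i. i \<in> C \<Longrightarrow> card (crossing (T i) D) + 1 < card (internal (T i) D)"
    and v: "i0 \<in> I" "v \<in> Ext (T i0)"
    and nondeg: "\<And>X. X \<in> lie_poset P \<Longrightarrow> X (v, v) = 0 \<Longrightarrow> (\<Sum>pq\<in>P. f pq * X pq) = 0 \<Longrightarrow>
      (\<And>pq. pq \<in> P \<Longrightarrow> coad V f X pq = 0) \<Longrightarrow> X = 0"
  shows "card (crossing P D) + 2 * card C \<le> card (internal P D)"
proof (rule ccontr)
  assume neg: "\<not> ?thesis"
  have "\<forall>i\<in>C. \<exists>z. z \<noteq> 0 \<and> supported (local_entries i) z \<and> (\<forall>pq\<in>crossing P D. coad V f z pq = 0)"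
    using local_solution C by blast
  from bchoice[OF this] obtain z where zC: "\<forall>i\<in>C. z i \<noteq> 0 \<and> supported (local_entries i) (z i) \<and>
      (\<forall>pq\<in>crossing P D. coad V f (z i) pq = 0)" by blast
  have z: "z i \<noteq> 0" and z_supp: "supported (local_entries i) (z i)"
    and z_coad: "pq \<in> crossing P D \<Longrightarrow> coad V f (z i) pq = 0" if "i \<in> C" for i pq
    using zC that by blast+
  have "\<forall>i\<in>C. \<exists>pq. z i pq \<noteq> 0" using z by (auto simp: fun_eq_iff)
  then obtain \<pi> where \<pi>: "\<And>i. i \<in> C \<Longrightarrow> z i (\<pi> i) \<noteq> 0"
    using bchoice[of C "\<lambda>i pq. z i pq \<noteq> 0"] by blast
  have \<pi>_mem: "\<pi> i \<in> local_entries i" if "i \<in> C" for i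
    using supportedD[OF z_supp[OF that]] \<pi>[OF that] by blast
  have z_\<pi>: "z j (\<pi> i) = 0" if "i \<in> C" "j \<in> C" "i \<noteq> j" for i j
    using supportedD[OF z_supp[OF that(2)]] \<pi>_mem[OF that(1)] local_entries_disjoint[of i j] that C
    by blast
  have \<pi>_int: "\<pi> i \<in> internal P D" if "i \<in> C" for i
    using local_entriesD(2)[of i] \<pi>_mem[OF that] that C by (cases "\<pi> i") auto
  have inj: "inj_on \<pi> C" by (rule inj_onI) (metis \<pi> z_\<pi>)
  have vV: "v \<in> V" using v Ext_Field Field_T by blast
  have z_vv: "z i (v, v) = 0" if "i \<in> C" for i
  proof -
    have "(v, v) \<notin> local_entries i"
    proof
      assume vv: "(v, v) \<in> local_entries i"
      have i: "i \<in> I" using that C by blast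
      have vi: "v \<in> Field (T i)" using local_entriesD(3)[OF i vv] .
      have "v \<in> Ext (T i)"
      proof (cases "i = i0")
        case False
        then show ?thesis using overlap[OF i v(1) False vi] v Ext_Field by (auto simp: Ext_def)
      qed (use v in simp)
      then show False using vv by (auto simp: local_entries_def)
    qed
    then show ?thesis using supportedD[OF z_supp[OF that]] by blast
  qed
  have fin: "finite (crossing P D)" "finite (internal P D)" "finite C"
    using finite_P crossing_subset internal_subset finite_subset C(1) fin_I by metis+
  \<comment> \<open>the complement: one nonzero entry of each \<open>z i\<close> and the normalized entry are left out\<close>
  define J where "J = internal P D - insert (v, v) (\<pi> ` C)"
  have vv_int: "(v, v) \<in> internal P D"
    using labelled_posetD(5)[OF P vV] by (simp add: internal_iff[OF down_P])
  have "(v, v) \<notin> \<pi> ` C" using \<pi> z_vv by force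
  then have "card (insert (v, v) (\<pi> ` C)) = Suc (card C)"
    using fin(3) by (simp add: card_image[OF inj])
  moreover have sub: "insert (v, v) (\<pi> ` C) \<subseteq> internal P D" using \<pi>_int vv_int by blast
  moreover have "card (insert (v, v) (\<pi> ` C)) \<le> card (internal P D)"
    using fin(2) sub by (rule card_mono)
  moreover have "card J = card (internal P D) - card (insert (v, v) (\<pi> ` C))"
    unfolding J_def using fin sub by (intro card_Diff_subset) auto
  ultimately have cardJ: "card J + Suc (card C) = card (internal P D)" by simp
  have finJ: "finite J" using fin by (simp add: J_def)
  define mat where "mat w = (case w of Inl pq \<Rightarrow> matrix_unit pq | Inr i \<Rightarrow> z i)" for w
  define W where "W = crossing P D <+> C"
  define a where "a j w = (case j of None \<Rightarrow> (\<Sum>pq\<in>P. f pq * mat w pq)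
    | Some pq \<Rightarrow> coad V f (mat w) pq)" for j w
  have finW: "finite W" using fin by (simp add: W_def)
  have "card (insert None (Some ` J)) = Suc (card J)"
    using finJ by (subst card_insert_disjoint) (auto simp: card_image)
  moreover have "card W = card (crossing P D) + card C" using fin by (simp add: W_def card_Plus)
  ultimately have "card (insert None (Some ` J)) < card W" using neg cardJ by simp
  from homogeneous_system_nontrivial[OF _ finW this, of a] finJ obtain c where
    c: "\<exists>w\<in>W. c w \<noteq> 0" "\<forall>j\<in>insert None (Some ` J). (\<Sum>w\<in>W. a j w * c w) = 0" by blast
  define X where "X = (\<Sum>w\<in>W. pmat_scale (c w) (mat w))"
  have X_apply: "X pq = (\<Sum>w\<in>W. c w * mat w pq)" for pq
    unfolding X_def pmat_sum_apply by (simp add: pmat_scale_def)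
  have coad_X: "coad V f X pq = (\<Sum>w\<in>W. coad V f (mat w) pq * c w)" for pq
    unfolding X_def by (rule coad_sum[OF finW])
  have mat_mem: "mat w \<in> lie_poset P" if "w \<in> W" for w
  proof (cases w)
    case (Inl xy)
    then have "xy \<in> P" using that crossing_subset by (auto simp: W_def)
    then show ?thesis using Inl by (simp add: mat_def matrix_unit_in_lie_poset)
  next
    case (Inr i)
    then have i: "i \<in> C" using that by (auto simp: W_def)
    then have "z i \<in> lie_poset P" using C(1) local_in_lie_poset z_supp by blast
    then show ?thesis using Inr by (simp add: mat_def)
  qed
  have mat_coad: "coad V f (mat w) pq = 0" if "w \<in> W" "pq \<in> crossing P D" for w pq
  proof (cases w)
    case (Inl xy)
    then have "supported (crossing P D) (mat w)"
      using that(1) by (auto simp: W_def mat_def supported_def matrix_unit_def)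
    then show ?thesis using coad_crossing_crossing that(2) by (cases pq) (auto simp: crossing_iff)
  next
    case (Inr i)
    then show ?thesis using that z_coad[of i pq] by (auto simp: W_def mat_def)
  qed
  have X_mem: "X \<in> lie_poset P"
    unfolding X_def using mat_mem
    by (intro pmat.subspace_sum pmat.subspace_scale subspace_lie_poset) auto
  have "X = 0"
  proof (rule nondeg[OF X_mem])
    show "X (v, v) = 0"
      unfolding X_apply by (rule sum.neutral)
        (auto simp: W_def mat_def z_vv matrix_unit_def crossing_iff split: if_splits)
    have "(\<Sum>pq\<in>P. f pq * X pq) = (\<Sum>w\<in>W. \<Sum>pq\<in>P. f pq * mat w pq * c w)"
      unfolding X_apply sum_distrib_left by (subst sum.swap) (simp add: mult_ac)
    also have "\<dots> = (\<Sum>w\<in>W. a None w * c w)"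
      by (simp add: a_def sum_distrib_right)
    finally show "(\<Sum>pq\<in>P. f pq * X pq) = 0" using c(2) by simp
    have J: "coad V f X pq = 0" if "pq \<in> J" for pq
      using c(2) that by (simp add: coad_X a_def)
    have cross: "coad V f X pq = 0" if "pq \<in> crossing P D" for pq
      unfolding coad_X by (rule sum.neutral) (simp add: mat_coad that)
    \<comment> \<open>orthogonality to \<open>z i\<close> is automatic, and it is an equation for the omitted entry\<close>
    have at_\<pi>: "coad V f X (\<pi> i) = 0" if i: "i \<in> C" for i
    proof -
      have zi: "z i \<in> lie_poset P" using i C(1) z_supp local_in_lie_poset by blast
      have "(\<Sum>pq\<in>P. z i pq * coad V f (mat w) pq) = 0" if "w \<in> W" for w
      proof (cases w)
        case (Inl xy)
        then have xy: "xy \<in> crossing P D" using that by (auto simp: W_def)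
        have "(\<Sum>pq\<in>P. mat w pq * coad V f (z i) pq)
            = (\<Sum>pq\<in>P. if pq = xy then coad V f (z i) xy else 0)"
          using Inl by (intro sum.cong) (auto simp: mat_def matrix_unit_def)
        also have "\<dots> = 0" using z_coad[OF i xy] finite_P by simp
        finally show ?thesis using coad_skew[OF P mat_mem[OF that] zi, of f] by simp
      next
        case (Inr j)
        then show ?thesis
          using that i by (auto simp: W_def mat_def intro!: local_pairing_zero[OF z_supp C(1)])
      qed
      then have "(\<Sum>w\<in>W. (\<Sum>pq\<in>P. z i pq * coad V f (mat w) pq) * c w) = 0" by simp
      moreover have "(\<Sum>pq\<in>P. z i pq * coad V f X pq)
          = (\<Sum>w\<in>W. (\<Sum>pq\<in>P. z i pq * coad V f (mat w) pq) * c w)"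
        unfolding coad_X sum_distrib_left sum_distrib_right
        by (subst sum.swap) (simp add: mult.assoc)
      moreover have "(\<Sum>pq\<in>P. z i pq * coad V f X pq)
          = (\<Sum>pq\<in>P. if pq = \<pi> i then z i (\<pi> i) * coad V f X (\<pi> i) else 0)"
      proof (rule sum.cong[OF refl])
        fix pq assume "pq \<in> P"
        then consider "pq \<in> crossing P D" | "pq \<in> J" | "pq = (v, v)" | j where "j \<in> C" "pq = \<pi> j"
          by (auto simp: J_def internal_def)
        then show "z i pq * coad V f X pq
            = (if pq = \<pi> i then z i (\<pi> i) * coad V f X (\<pi> i) else 0)"
        proof cases
          case 1
          then show ?thesis using cross[OF 1] by auto
        next
          case 2
          then show ?thesis using J[OF 2] by auto
        next
          case 3
          have "\<pi> i \<noteq> (v, v)" using \<pi>[OF i] z_vv[OF i] by metis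
          then show ?thesis using z_vv[OF i] 3 by simp
        next
          case 4
          then show ?thesis using z_\<pi>[OF 4(1) i] by (cases "i = j") auto
        qed
      qed
      moreover have "\<pi> i \<in> P" using \<pi>_int[OF i] internal_subset by blast
      ultimately have "z i (\<pi> i) * coad V f X (\<pi> i) = 0" using finite_P by simp
      then show ?thesis using \<pi>[OF i] by simp
    qed
    have off_vv: "coad V f X pq = 0" if pq: "pq \<in> P" "pq \<noteq> (v, v)" for pq
    proof -
      consider "pq \<in> crossing P D" | "pq \<in> J" | j where "j \<in> C" "pq = \<pi> j"
        using pq unfolding J_def internal_def by blast
      then show ?thesis
      proof cases
        case 1
        then show ?thesis by (rule cross)
      next
        case 2
        then show ?thesis by (rule J)
      next
        case 3
        then show ?thesis using at_\<pi> by simp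
      qed
    qed
    have "(\<Sum>p\<in>V. coad V f X (p, p)) = (\<Sum>p\<in>V. if p = v then coad V f X (v, v) else 0)"
      by (rule sum.cong) (use off_vv labelled_posetD(5)[OF P] in auto)
    then have "coad V f X (v, v) = 0"
      using coad_trace[OF P] vV finite_V by simp
    with off_vv show "coad V f X pq = 0" if "pq \<in> P" for pq using that by blast
  qed
  have "c (Inr i) = 0" if i: "i \<in> C" for i
  proof -
    have "X (\<pi> i) = (\<Sum>w\<in>W. if w = Inr i then c (Inr i) * z i (\<pi> i) else 0)"
      unfolding X_apply
    proof (rule sum.cong[OF refl])
      fix w assume w: "w \<in> W"
      show "c w * mat w (\<pi> i) = (if w = Inr i then c (Inr i) * z i (\<pi> i) else 0)"
      proof (cases w)
        case (Inl xy)
        then have "\<pi> i \<noteq> xy" using w \<pi>_int[OF i] by (auto simp: W_def internal_def)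
        then show ?thesis using Inl by (simp add: mat_def matrix_unit_def)
      next
        case (Inr j)
        then have "j \<in> C" using w by (auto simp: W_def)
        then show ?thesis using Inr z_\<pi>[OF i, of j] by (cases "i = j") (auto simp: mat_def)
      qed
    qed
    also have "\<dots> = c (Inr i) * z i (\<pi> i)" using finW i by (auto simp: W_def)
    finally show ?thesis using \<open>X = 0\<close> \<pi>[OF i] by simp
  qed
  moreover have "c (Inl xy) = 0" if xy: "xy \<in> crossing P D" for xy
  proof -
    have "X xy = (\<Sum>w\<in>W. if w = Inl xy then c (Inl xy) else 0)"
      unfolding X_apply
    proof (rule sum.cong[OF refl])
      fix w assume w: "w \<in> W"
      show "c w * mat w xy = (if w = Inl xy then c (Inl xy) else 0)"
      proof (cases w)
        case (Inr j)
        then have "c w = 0" using w calculation by (auto simp: W_def)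
        then show ?thesis using Inr by simp
      qed (simp add: mat_def matrix_unit_def)
    qed
    also have "\<dots> = c (Inl xy)" using finW xy by (auto simp: W_def)
    finally show ?thesis using \<open>X = 0\<close> by simp
  qed
  ultimately show False using c(1) by (auto simp: W_def)
qed

text \<open>
  An edge of another piece between two elements of this piece joins a minimal to a maximal element of
  it, and all such pairs are edges of the piece itself.
\<close>

lemma edges_local:
  assumes E: "\<And>i. i \<in> I \<Longrightarrow> E i \<subseteq> crossing (T i) D"
    "\<And>i. i \<in> I \<Longrightarrow> minimal_elements (T i) \<times> maximal_elements (T i) \<subseteq> E i"
    and i: "i \<in> I" "p \<in> Field (T i)" "q \<in> Field (T i)"
  shows "(p, q) \<in> (\<Union>i\<in>I. E i) \<longleftrightarrow> (p, q) \<in> E i"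
proof
  assume "(p, q) \<in> (\<Union>i\<in>I. E i)"
  then obtain j where j: "j \<in> I" "(p, q) \<in> E j" by blast
  then have pq: "(p, q) \<in> T j" "p \<in> D" "q \<notin> D"
    using E(1)[OF j(1)] crossing_iff by blast+
  show "(p, q) \<in> E i"
  proof (cases "j = i")
    case False
    have "p \<in> minimal_elements (T i)" "q \<in> maximal_elements (T i)"
      using overlap_min[OF i(1) j(1) False[symmetric] i(2) FieldI_pair(1)[OF pq(1)] pq(2)]
        overlap_max[OF i(1) j(1) False[symmetric] i(3) FieldI_pair(2)[OF pq(1)] pq(3)] by blast+
    then show ?thesis using E(2)[OF i(1)] by blast
  qed (use j in simp)
qed (use i in blast)

text \<open>
  Hence at the crossing relations of a piece, the equations of the whole poset are those of the piece.
\<close>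

lemma coad_local_edges:
  assumes E: "\<And>i. i \<in> I \<Longrightarrow> E i \<subseteq> crossing (T i) D"
    "\<And>i. i \<in> I \<Longrightarrow> minimal_elements (T i) \<times> maximal_elements (T i) \<subseteq> E i"
    and X: "supported (internal P D) X" and i: "i \<in> I" and pq: "(p, q) \<in> crossing (T i) D"
  shows "coad V (edge_indicator (\<Union>i\<in>I. E i)) X (p, q)
    = coad (Field (T i)) (edge_indicator (E i)) X (p, q)"
proof -
  let ?G = "edge_indicator (\<Union>i\<in>I. E i)" and ?F = "Field (T i)"
  have pq': "p \<in> ?F" "q \<in> ?F" "p \<in> D" "q \<notin> D"
    using pq by (auto simp: crossing_iff Field_def)
  have s: "s \<in> ?F" if "X (s, p) \<noteq> 0" for s
  proof -
    have "(s, p) \<in> P" using that supportedD[OF X] internal_subset by blast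
    from below_local[OF i this pq'(1,3)] show ?thesis by (rule FieldI_pair)
  qed
  have t: "t \<in> ?F" if "X (q, t) \<noteq> 0" for t
  proof -
    have "(q, t) \<in> P" using that supportedD[OF X] internal_subset by blast
    from above_local[OF i this pq'(2,4)] show ?thesis by (rule FieldI_pair)
  qed
  have G: "?G (a, b) = edge_indicator (E i) (a, b)" if "a \<in> ?F" "b \<in> ?F" for a b
    using edges_local[OF E i that] by (simp add: edge_indicator_def)
  have "(\<Sum>s\<in>V. ?G (s, q) * X (s, p)) = (\<Sum>s\<in>?F. ?G (s, q) * X (s, p))"
    using s finite_V Field_T[OF i] by (intro sum.mono_neutral_right) auto
  moreover have "(\<Sum>t\<in>V. ?G (p, t) * X (q, t)) = (\<Sum>t\<in>?F. ?G (p, t) * X (q, t))"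
    using t finite_V Field_T[OF i] by (intro sum.mono_neutral_right) auto
  ultimately show ?thesis by (simp add: coad_def G pq')
qed

text \<open>
  At an edge from a minimal to a maximal element, only diagonal entries contribute to \<open>coad\<close>.
\<close>

lemma extremal_diagonal_equal:
  assumes E: "\<And>i. i \<in> I \<Longrightarrow> E i \<subseteq> crossing (T i) D"
    "\<And>i. i \<in> I \<Longrightarrow> minimal_elements (T i) \<times> maximal_elements (T i) \<subseteq> E i"
    and X: "supported (internal P D) X"
    and eq: "\<And>pq. pq \<in> crossing P D \<Longrightarrow> coad V (edge_indicator (\<Union>i\<in>I. E i)) X pq = 0"
    and i: "i \<in> I" and uw: "u \<in> Ext (T i)" "w \<in> Ext (T i)"
  shows "X (u, u) = X (w, w)"
proof -
  let ?G = "edge_indicator (\<Union>i\<in>I. E i)"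
  have min_max: "X (p, p) = X (q, q)" if p: "p \<in> minimal_elements (T i)" and q: "q \<in> maximal_elements (T i)"
    for p q
  proof -
    have mem: "p \<in> Field (T i)" "q \<in> Field (T i)" "p \<in> D" "q \<notin> D"
      using p q min_D[OF i] max_D[OF i] by (auto simp: minimal_elements_def maximal_elements_def)
    have G1: "?G (p, q) = 1" using E(2)[OF i] p q i by (auto simp: edge_indicator_def)
    have s: "X (s, p) = 0" if "s \<noteq> p" for s
    proof (rule ccontr)
      assume "X (s, p) \<noteq> 0"
      then have "(s, p) \<in> P" using supportedD[OF X] internal_subset by blast
      from below_min[OF below_local[OF i this mem(1,3)] p] that show False by simp
    qed
    have t: "X (q, t) = 0" if "t \<noteq> q" for t
    proof (rule ccontr)
      assume "X (q, t) \<noteq> 0"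
      then have "(q, t) \<in> P" using supportedD[OF X] internal_subset by blast
      from above_max[OF above_local[OF i this mem(2,4)] q] that show False by simp
    qed
    have "(\<Sum>s\<in>V. ?G (s, q) * X (s, p)) = (\<Sum>s\<in>V. if s = p then X (p, p) else 0)"
      by (rule sum.cong) (auto simp: s G1)
    moreover have "(\<Sum>t\<in>V. ?G (p, t) * X (q, t)) = (\<Sum>t\<in>V. if t = q then X (q, q) else 0)"
      by (rule sum.cong) (auto simp: t G1)
    moreover have "p \<in> V" "q \<in> V" using mem Field_T[OF i] by blast+
    ultimately have "coad V ?G X (p, q) = X (p, p) - X (q, q)"
      using finite_V by (simp add: coad_def)
    moreover have "(p, q) \<in> crossing P D"
      using min_max_T[OF i] p q mem T_subset[OF i] by (auto simp: crossing_iff)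
    ultimately show ?thesis using eq by simp
  qed
  show ?thesis
  proof (cases "minimal_elements (T i) = {} \<or> maximal_elements (T i) = {}")
    case True
    then have "card (Ext (T i)) = 1" using card_Ext_T[OF i] by auto
    then show ?thesis using uw by (auto simp: card_1_singleton_iff)
  next
    case False
    then obtain m M where "m \<in> minimal_elements (T i)" "M \<in> maximal_elements (T i)" by blast
    then show ?thesis using uw min_max unfolding Ext_def by (metis Un_iff)
  qed
qed

end

section \<open>A contact form from a trivial kernel\<close>

text \<open>
  Let the internal part have exactly one dimension more than the crossing part. Then the map that sends
  an internal matrix to its \<open>coad\<close> on the crossing relations, its entry at \<open>(v, v)\<close> and its trace is
  square. If it is injective, preimages of unit vectors form a Darboux family together with the
  matrix units of the crossing relations.
\<close>

lemma contact_poset_if_trivial_kernel: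
  assumes r: "labelled_poset r" and D: "down_closed r D" and E: "E \<subseteq> crossing r D"
    and v: "v \<in> Field r" and card: "card (internal r D) = card (crossing r D) + 2"
    and ker: "\<And>X. supported (internal r D) X \<Longrightarrow>
      (\<And>pq. pq \<in> crossing r D \<Longrightarrow> coad (Field r) (edge_indicator E) X pq = 0) \<Longrightarrow>
      X (v, v) = 0 \<Longrightarrow> matrix_trace (Field r) X = 0 \<Longrightarrow> X = 0"
  shows "contact_poset r"
proof -
  let ?V = "Field r" and ?f = "edge_indicator E" and ?br = "poset_bracket r"
  note fin = labelled_posetD(1,2)[OF r]
  have fin': "finite (crossing r D)" "finite (internal r D)"
    using fin crossing_subset internal_subset finite_subset by metis+
  have f: "supported (crossing r D) ?f" using E by (rule supported_edge_indicator)
  have Er: "E \<subseteq> r" using E crossing_subset by blast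
  define J where "J = crossing r D <+> (UNIV :: bool set)"
  define val where "val X j = (case j of Inl pq \<Rightarrow> coad ?V ?f X pq
    | Inr True \<Rightarrow> X (v, v) | Inr False \<Rightarrow> matrix_trace ?V X)" for X j
  define comb where "comb c = (\<Sum>xy\<in>internal r D. pmat_scale (c xy) (matrix_unit xy))" for c
  have comb_supp: "supported (internal r D) (comb c)" for c
    by (auto simp: supported_def comb_def supported_combination[OF fin'(2)])
  have val_comb: "(\<Sum>xy\<in>internal r D. val (matrix_unit xy) j * c xy) = val (comb c) j" for c j
  proof (cases j)
    case (Inl pq)
    then show ?thesis by (simp add: val_def comb_def coad_sum[OF fin'(2)])
  next
    case (Inr b)
    have apply_eq: "comb c x = (\<Sum>xy\<in>internal r D. matrix_unit xy x * c xy)" for x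
      unfolding comb_def pmat_sum_apply by (simp add: pmat_scale_def mult.commute)
    show ?thesis
    proof (cases b)
      case True
      then show ?thesis using Inr by (simp add: val_def apply_eq)
    next
      case False
      have "matrix_trace ?V (comb c) = (\<Sum>xy\<in>internal r D. \<Sum>p\<in>?V. matrix_unit xy (p, p) * c xy)"
        unfolding matrix_trace_def apply_eq by (rule sum.swap)
      then show ?thesis using Inr False by (simp add: val_def matrix_trace_def sum_distrib_right)
    qed
  qed
  have "\<exists>X. supported (internal r D) X \<and> (\<forall>j\<in>J. val X j = b j)" for b
  proof -
    have "\<exists>c. \<forall>j\<in>J. (\<Sum>xy\<in>internal r D. val (matrix_unit xy) j * c xy) = b j"
    proof (rule injective_system_solvable)
      show "finite J" "finite (internal r D)" using fin' by (simp_all add: J_def)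
      show "card J \<le> card (internal r D)" using card fin' by (simp add: J_def card_Plus)
      fix c xy
      assume 0: "\<And>j. j \<in> J \<Longrightarrow> (\<Sum>xy\<in>internal r D. val (matrix_unit xy) j * c xy) = 0"
        and xy: "xy \<in> internal r D"
      have val0: "val (comb c) j = 0" if "j \<in> J" for j using 0[OF that] unfolding val_comb .
      have "comb c = 0"
      proof (rule ker[OF comb_supp])
        show "coad ?V ?f (comb c) pq = 0" if "pq \<in> crossing r D" for pq
          using val0[of "Inl pq"] that by (auto simp: J_def val_def InlI)
        show "comb c (v, v) = 0" using val0[of "Inr True"] by (auto simp: J_def val_def InlI InrI)
        show "matrix_trace ?V (comb c) = 0" using val0[of "Inr False"] by (auto simp: J_def val_def InlI InrI)
      qed
      then have "comb c xy = 0" by simp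
      then show "c xy = 0" using xy by (simp add: comb_def supported_combination[OF fin'(2)])
    qed
    then obtain c where "\<forall>j\<in>J. (\<Sum>xy\<in>internal r D. val (matrix_unit xy) j * c xy) = b j" by blast
    then have "supported (internal r D) (comb c) \<and> (\<forall>j\<in>J. val (comb c) j = b j)"
      using comb_supp unfolding val_comb by blast
    then show ?thesis by (rule exI[of _ "comb c"])
  qed
  note solve = this
  have "\<exists>X. supported (internal r D) X \<and>
      (\<forall>pq\<in>crossing r D. coad ?V ?f X pq = (if pq = xy then - 1 else 0)) \<and>
      X (v, v) = 0 \<and> matrix_trace ?V X = 0" for xy
  proof -
    from solve[of "\<lambda>j. case j of Inl pq \<Rightarrow> if pq = xy then - 1 else 0 | Inr _ \<Rightarrow> 0"]
    obtain X where X: "supported (internal r D) X"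
      "\<forall>j\<in>J. val X j = (case j of Inl pq \<Rightarrow> if pq = xy then - 1 else 0 | Inr _ \<Rightarrow> 0)" by blast
    have "coad ?V ?f X pq = (if pq = xy then - 1 else 0)" if "pq \<in> crossing r D" for pq
      using X(2)[rule_format, of "Inl pq"] that by (auto simp: J_def val_def InlI)
    moreover have "X (v, v) = 0"
      using X(2)[rule_format, of "Inr True"] by (auto simp: J_def val_def InlI InrI)
    moreover have "matrix_trace ?V X = 0"
      using X(2)[rule_format, of "Inr False"] by (auto simp: J_def val_def InlI InrI)
    ultimately show ?thesis using X(1) by (intro exI[of _ X]) blast
  qed
  then have "\<forall>xy. \<exists>X. supported (internal r D) X \<and>
      (\<forall>pq\<in>crossing r D. coad ?V ?f X pq = (if pq = xy then - 1 else 0)) \<and>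
      X (v, v) = 0 \<and> matrix_trace ?V X = 0" by (rule allI)
  from choice[OF this] obtain A where A': "\<forall>xy. supported (internal r D) (A xy) \<and>
      (\<forall>pq\<in>crossing r D. coad ?V ?f (A xy) pq = (if pq = xy then - 1 else 0)) \<and>
      A xy (v, v) = 0 \<and> matrix_trace ?V (A xy) = 0" by (elim exE)
  have A: "supported (internal r D) (A xy)"
    "pq \<in> crossing r D \<Longrightarrow> coad ?V ?f (A xy) pq = (if pq = xy then - 1 else 0)"
    "matrix_trace ?V (A xy) = 0" for xy pq
    using A'[THEN spec, of xy] by blast+
  from solve[of "\<lambda>j. if j = Inr True then 1 else 0"]
  obtain R where R: "supported (internal r D) R"
    "\<forall>j\<in>J. val R j = (if j = Inr True then 1 else 0)" by blast
  have R_coad: "coad ?V ?f R pq = 0" if "pq \<in> r" for pq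
  proof (rule coad_internal_all[OF D f R(1) _ that])
    show "coad ?V ?f R pq = 0" if "pq \<in> crossing r D" for pq
      using R(2)[rule_format, of "Inl pq"] that by (auto simp: J_def val_def InlI)
  qed
  have R_vv: "R (v, v) = 1" using R(2)[rule_format, of "Inr True"] by (auto simp: J_def val_def InlI InrI)
  have R_tr: "matrix_trace ?V R = 0" using R(2)[rule_format, of "Inr False"] by (auto simp: J_def val_def InlI InrI)
  have int_mem: "X \<in> lie_poset r" if "supported (internal r D) X" for X
    unfolding lie_poset_eq_supported using that internal_subset by (rule supported_mono)
  define \<phi> where "\<phi> = coord_form (insert (v, v) E)"
  have vE: "(v, v) \<notin> E" using E by (auto simp: crossing_iff)
  have finE: "finite E" using Er fin(1) by (rule finite_subset)
  have \<phi>: "\<phi> X = X (v, v) + coord_form E X" for X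
    using vE finE by (simp add: \<phi>_def coord_form_def)
  have \<phi>_br: "\<phi> (?br X Y) = (\<Sum>pq\<in>r. Y pq * coad ?V ?f X pq)"
    if "X \<in> lie_poset r" "Y \<in> lie_poset r" for X Y
    using that by (simp add: \<phi> bracket_diagonal[OF r] coord_form_bracket[OF r Er])
  obtain h where h: "bij_betw h {0..<card (crossing r D)} (crossing r D)"
    using ex_bij_betw_nat_finite[OF fin'(1)] by blast
  have h_mem: "h i \<in> crossing r D" "h i \<in> r" if "i < card (crossing r D)" for i
    using bij_betw_apply[OF h, of i] that crossing_subset by auto
  have unit_mem: "matrix_unit (h i) \<in> lie_poset r" if "i < card (crossing r D)" for i
    using h_mem[OF that] by (intro matrix_unit_in_lie_poset)
  have sum_unit: "(\<Sum>pq\<in>r. matrix_unit xy pq * g pq) = g xy" if "xy \<in> r" for xy g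
  proof -
    have "(\<Sum>pq\<in>r. matrix_unit xy pq * g pq) = (\<Sum>pq\<in>r. if pq = xy then g xy else 0)"
      by (rule sum.cong) (auto simp: matrix_unit_def)
    then show ?thesis using that fin(1) by simp
  qed
  have "contact_form (lie_poset_A r) ?br \<phi>"
  proof (rule contact_form_if_darboux[where k = "card (crossing r D)" and R = R
        and a = "\<lambda>i. A (h i)" and b = "\<lambda>i. matrix_unit (h i)"])
    show "bracket_on (lie_poset_A r) ?br" by (rule bracket_on_lie_poset_A[OF r])
    show "one_form (lie_poset_A r) \<phi>" unfolding \<phi>_def by (rule one_form_coord_form)
    show "pmat.dim (lie_poset_A r) = 2 * card (crossing r D) + 1"
    proof -
      have "?V \<noteq> {}" using v by blast
      from dim_lie_poset_A[OF r this] show ?thesis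
        using card card_internal_crossing[OF fin(1), of D] by simp
    qed
    show "R \<in> lie_poset_A r" using int_mem[OF R(1)] R_tr by (simp add: lie_poset_A_iff)
    have "coord_form E R = 0"
      unfolding coord_form_def using E
      by (intro sum.neutral) (auto simp: internal_def intro!: supportedD[OF R(1)])
    then show "\<phi> R \<noteq> 0" by (simp add: \<phi> R_vv)
    show "\<phi> (?br R Y) = 0" if "Y \<in> lie_poset_A r" for Y
      using that R_coad by (simp add: lie_poset_A_iff \<phi>_br int_mem[OF R(1)])
    fix i assume i: "i < card (crossing r D)"
    show "A (h i) \<in> lie_poset_A r" using int_mem[OF A(1)] A(3) by (simp add: lie_poset_A_iff)
    have "matrix_unit (h i) (p, p) = 0" for p
      using h_mem(1)[OF i] by (cases "h i") (auto simp: matrix_unit_def crossing_iff)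
    then show "matrix_unit (h i) \<in> lie_poset_A r"
      using unit_mem[OF i] by (simp add: lie_poset_A_iff matrix_trace_def)
    fix j assume j: "j < card (crossing r D)"
    have zero: "A (h j) pq * coad ?V ?f (A (h i)) pq = 0" for pq
    proof (cases "pq \<in> internal r D")
      case True
      then have "coad ?V ?f (A (h i)) pq = 0"
        using coad_internal_internal[OF D f A(1)] by (cases pq) simp
      then show ?thesis by simp
    next
      case False
      then show ?thesis using supportedD[OF A(1)] by simp
    qed
    show "\<phi> (?br (A (h i)) (A (h j))) = 0"
      unfolding \<phi>_br[OF int_mem[OF A(1)] int_mem[OF A(1)]] by (intro sum.neutral ballI zero)
    have "supported (crossing r D) (matrix_unit (h i))"
      using h_mem(1)[OF i] by (auto simp: supported_def matrix_unit_def)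
    then have "coad ?V ?f (matrix_unit (h i)) (h j) = 0"
      using coad_crossing_crossing h_mem(1)[OF j] by (cases "h j") (auto simp: crossing_iff)
    then show "\<phi> (?br (matrix_unit (h i)) (matrix_unit (h j))) = 0"
      by (simp add: \<phi>_br unit_mem i j sum_unit h_mem)
    have "h i = h j \<longleftrightarrow> i = j" using h i j by (auto simp: bij_betw_def inj_on_def)
    moreover have "\<phi> (?br (matrix_unit (h i)) (A (h j)))
        = - (\<Sum>pq\<in>r. matrix_unit (h i) pq * coad ?V ?f (A (h j)) pq)"
      using coad_skew[OF r unit_mem[OF i] int_mem[OF A(1)[of "h j"]], of ?f]
      by (simp add: \<phi>_br unit_mem[OF i] int_mem[OF A(1)])
    ultimately show "\<phi> (?br (matrix_unit (h i)) (A (h j))) = (if i = j then 1 else 0)"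
      by (simp add: sum_unit h_mem[OF i] A(2))
  qed
  then show ?thesis unfolding contact_poset_def contact_def by blast
qed

section \<open>Copies of posets\<close>

locale poset_copy =
  fixes S T :: "nat rel" and e :: "nat \<Rightarrow> nat"
  assumes inj: "inj_on e (Field S)" and T: "T = map_prod e e ` S"
begin

lemma Field_copy: "Field T = e ` Field S"
  unfolding T Field_def by force

lemma copy_eq: "p \<in> Field S \<Longrightarrow> q \<in> Field S \<Longrightarrow> e p = e q \<longleftrightarrow> p = q"
  using inj by (auto dest: inj_onD)

lemma copy_iff:
  assumes "p \<in> Field S" "q \<in> Field S"
  shows "(e p, e q) \<in> T \<longleftrightarrow> (p, q) \<in> S"
proof
  assume "(e p, e q) \<in> T"
  then obtain x y where xy: "(x, y) \<in> S" "e p = e x" "e q = e y" unfolding T by auto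
  then have "p = x" "q = y" using assms copy_eq FieldI_pair[OF xy(1)] by blast+
  then show "(p, q) \<in> S" using xy by simp
next
  assume "(p, q) \<in> S"
  then show "(e p, e q) \<in> T" unfolding T by (rule map_prod_imageI)
qed

lemma minimal_copy: "minimal_elements T = e ` minimal_elements S"
proof -
  have "(\<forall>y. (y, e p) \<notin> Rel T) \<longleftrightarrow> (\<forall>y. (y, p) \<notin> Rel S)" if p: "p \<in> Field S" for p
  proof
    assume l: "\<forall>y. (y, e p) \<notin> Rel T"
    show "\<forall>y. (y, p) \<notin> Rel S"
    proof (intro allI notI)
      fix y assume y: "(y, p) \<in> Rel S"
      then have "y \<in> Field S" by (auto simp: Rel_def Field_def)
      then have "(e y, e p) \<in> Rel T" using y p copy_iff copy_eq by (auto simp: Rel_def)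
      then show False using l by blast
    qed
  next
    assume l: "\<forall>y. (y, p) \<notin> Rel S"
    show "\<forall>y. (y, e p) \<notin> Rel T"
    proof (intro allI notI)
      fix y assume y: "(y, e p) \<in> Rel T"
      then have "y \<in> Field T" by (auto simp: Rel_def Field_def)
      then obtain z where z: "y = e z" "z \<in> Field S" unfolding Field_copy by blast
      then have "(z, p) \<in> Rel S" using y p copy_iff copy_eq by (auto simp: Rel_def)
      then show False using l by blast
    qed
  qed
  then show ?thesis by (auto simp: minimal_elements_def Field_copy)
qed

lemma maximal_copy: "maximal_elements T = e ` maximal_elements S"
proof -
  have "(\<forall>y. (e p, y) \<notin> Rel T) \<longleftrightarrow> (\<forall>y. (p, y) \<notin> Rel S)" if p: "p \<in> Field S" for p
  proof
    assume l: "\<forall>y. (e p, y) \<notin> Rel T"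
    show "\<forall>y. (p, y) \<notin> Rel S"
    proof (intro allI notI)
      fix y assume y: "(p, y) \<in> Rel S"
      then have "y \<in> Field S" by (auto simp: Rel_def Field_def)
      then have "(e p, e y) \<in> Rel T" using y p copy_iff copy_eq by (auto simp: Rel_def)
      then show False using l by blast
    qed
  next
    assume l: "\<forall>y. (p, y) \<notin> Rel S"
    show "\<forall>y. (e p, y) \<notin> Rel T"
    proof (intro allI notI)
      fix y assume y: "(e p, y) \<in> Rel T"
      then have "y \<in> Field T" by (auto simp: Rel_def Field_def)
      then obtain z where z: "y = e z" "z \<in> Field S" unfolding Field_copy by blast
      then have "(p, z) \<in> Rel S" using y p copy_iff copy_eq by (auto simp: Rel_def)
      then show False using l by blast
    qed
  qed
  then show ?thesis by (auto simp: maximal_elements_def Field_copy)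
qed

lemma Ext_copy: "Ext T = e ` Ext S"
  by (simp add: Ext_def minimal_copy maximal_copy image_Un)

lemma inj_on_copy: "A \<subseteq> Field S \<times> Field S \<Longrightarrow> inj_on (map_prod e e) A"
  using map_prod_inj_on[OF inj inj] inj_on_subset by blast

lemma crossing_copy:
  assumes "\<And>p. p \<in> Field S \<Longrightarrow> e p \<in> D \<longleftrightarrow> p \<in> D'"
  shows "crossing T D = map_prod e e ` crossing S D'"
  using assms unfolding T crossing_def by (force simp: Field_def)

lemma internal_copy:
  assumes "\<And>p. p \<in> Field S \<Longrightarrow> e p \<in> D \<longleftrightarrow> p \<in> D'"
  shows "internal T D = map_prod e e ` internal S D'"
proof -
  have cross: "crossing T D = map_prod e e ` crossing S D'"
    by (rule crossing_copy) (rule assms)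
  have "S \<subseteq> Field S \<times> Field S" by (auto simp: Field_def)
  then have "inj_on (map_prod e e) S" by (rule inj_on_copy)
  then have "map_prod e e ` (S - crossing S D') = map_prod e e ` S - map_prod e e ` crossing S D'"
    by (rule inj_on_image_set_diff) (auto simp: crossing_def)
  then show ?thesis unfolding internal_def cross T[symmetric] by (rule sym)
qed

lemma card_copy:
  assumes "\<And>p. p \<in> Field S \<Longrightarrow> e p \<in> D \<longleftrightarrow> p \<in> D'"
  shows "card (crossing T D) = card (crossing S D')" "card (internal T D) = card (internal S D')"
proof -
  have "S \<subseteq> Field S \<times> Field S" by (auto simp: Field_def)
  then have sub: "crossing S D' \<subseteq> Field S \<times> Field S" "internal S D' \<subseteq> Field S \<times> Field S"
    using crossing_subset[of S D'] internal_subset[of S D'] by blast+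
  have "crossing T D = map_prod e e ` crossing S D'" by (rule crossing_copy) (rule assms)
  then show "card (crossing T D) = card (crossing S D')"
    using card_image[OF inj_on_copy[OF sub(1)]] by simp
  have "internal T D = map_prod e e ` internal S D'" by (rule internal_copy) (rule assms)
  then show "card (internal T D) = card (internal S D')"
    using card_image[OF inj_on_copy[OF sub(2)]] by simp
qed

lemma coad_copy:
  assumes E: "E \<subseteq> S" and pq: "p \<in> Field S" "q \<in> Field S"
  shows "coad (Field T) (edge_indicator (map_prod e e ` E)) X (e p, e q)
    = coad (Field S) (edge_indicator E) (\<lambda>(p, q). X (e p, e q)) (p, q)"
proof -
  have ind: "edge_indicator (map_prod e e ` E) (e a, e b) = edge_indicator E (a, b)"
    if ab: "a \<in> Field S" "b \<in> Field S" for a b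
  proof -
    have "(e a, e b) \<in> map_prod e e ` E \<longleftrightarrow> (a, b) \<in> E"
    proof
      assume "(e a, e b) \<in> map_prod e e ` E"
      then obtain x y where xy: "(x, y) \<in> E" "e a = e x" "e b = e y" by auto
      then have "x \<in> Field S" "y \<in> Field S" using E FieldI_pair[of x y S] by blast+
      then show "(a, b) \<in> E" using xy copy_eq ab by blast
    qed (rule map_prod_imageI)
    then show ?thesis by (simp add: edge_indicator_def)
  qed
  have "(\<Sum>s\<in>Field T. edge_indicator (map_prod e e ` E) (s, e q) * X (s, e p))
      = (\<Sum>s\<in>Field S. edge_indicator E (s, q) * X (e s, e p))"
    unfolding Field_copy by (subst sum.reindex[OF inj]) (simp add: ind pq)
  moreover have "(\<Sum>t\<in>Field T. edge_indicator (map_prod e e ` E) (e p, t) * X (e q, t))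
      = (\<Sum>t\<in>Field S. edge_indicator E (p, t) * X (e q, e t))"
    unfolding Field_copy by (subst sum.reindex[OF inj]) (simp add: ind pq)
  ultimately show ?thesis by (simp add: coad_def)
qed

end

section \<open>Counting relations in a gluing step\<close>

text \<open>
  The number of vertices glued, less one, less the number of relations glued: the number of cycles
  that a rule adds to the graph of extremal elements.
\<close>

fun rule_excess :: "glue_rule \<Rightarrow> nat" where
  "rule_excess Rule_B = 1"
| "rule_excess Rule_E1 = 1"
| "rule_excess Rule_E2 = 1"
| "rule_excess Rule_G1 = 1"
| "rule_excess Rule_G2 = 1"
| "rule_excess Rule_H = 2"
| "rule_excess _ = 0"

lemma rule_excess_eq_0:
  "rule_excess \<rho> = 0 \<longleftrightarrow> \<rho> \<in> {Rule_A1, Rule_A2, Rule_C, Rule_D1, Rule_D2, Rule_F}"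
  by (cases \<rho>) auto

lemma filter_pair:
  "{a. (a = x \<or> a = y) \<and> R a} = (if R x then {x} else {}) \<union> (if R y then {y} else {})"
  by auto

lemma card_identified:
  assumes "c \<noteq> a\<^sub>1" "uses_a2 \<rho> \<Longrightarrow> c \<noteq> a\<^sub>2 \<and> a\<^sub>1 \<noteq> a\<^sub>2"
    and "side_condition \<rho> Q (e c) (e a\<^sub>1) (e a\<^sub>2)"
  shows "card (identified \<rho> c a\<^sub>1 a\<^sub>2) = Suc (if c \<in> identified \<rho> c a\<^sub>1 a\<^sub>2
    then card {a \<in> identified \<rho> c a\<^sub>1 a\<^sub>2 - {c}. comparable Q (e a) (e c)} else 0) + rule_excess \<rho>"
  using assms by (cases \<rho>) (auto simp: uses_a2_def filter_pair Collect_conv_if insert_Diff_if)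

lemma identified_subset: "identified \<rho> c a\<^sub>1 a\<^sub>2 \<subseteq> {c, a\<^sub>1, a\<^sub>2}"
  by (cases \<rho>) auto

lemma identified_uses_a2: "a\<^sub>2 \<in> identified \<rho> c a\<^sub>1 a\<^sub>2 \<Longrightarrow> a\<^sub>2 \<noteq> c \<Longrightarrow> a\<^sub>2 \<noteq> a\<^sub>1 \<Longrightarrow> uses_a2 \<rho>"
  by (cases \<rho>) (auto simp: uses_a2_def)

lemma identified_nonempty: "identified \<rho> c a\<^sub>1 a\<^sub>2 \<noteq> {}"
  by (cases \<rho>) auto

lemma glued_overlap:
  fixes S Q T :: "nat rel"
  assumes "glued \<rho> Q S e R" "T = map_prod e e ` S" "v \<in> Field T" "v \<in> Field Q"
  shows "v \<in> minimal_elements T \<and> v \<in> minimal_elements Q \<or>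
    v \<in> maximal_elements T \<and> v \<in> maximal_elements Q"
proof -
  interpret poset_copy S T e using assms by unfold_locales (auto simp: glued_def)
  from assms(1) obtain c a\<^sub>1 a\<^sub>2
    where shared: "e ` Field S \<inter> Field Q = e ` identified \<rho> c a\<^sub>1 a\<^sub>2"
      and ends: "\<forall>v\<in>identified \<rho> c a\<^sub>1 a\<^sub>2. v \<in> minimal_elements S \<and> e v \<in> minimal_elements Q \<or>
         v \<in> maximal_elements S \<and> e v \<in> maximal_elements Q"
    unfolding glued_def by blast
  have "v \<in> e ` identified \<rho> c a\<^sub>1 a\<^sub>2" using assms(3,4) shared unfolding Field_copy by blast
  then obtain z where "z \<in> identified \<rho> c a\<^sub>1 a\<^sub>2" "v = e z" by blast
  then show ?thesis using ends unfolding minimal_copy maximal_copy by blast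
qed

lemma glued_meet:
  fixes S Q T :: "nat rel"
  assumes "glued \<rho> Q S e R" "T = map_prod e e ` S"
  shows "Field T \<inter> Field Q \<noteq> {}"
proof -
  interpret poset_copy S T e using assms by unfold_locales (auto simp: glued_def)
  from assms(1) obtain c a\<^sub>1 a\<^sub>2 where "e ` Field S \<inter> Field Q = e ` identified \<rho> c a\<^sub>1 a\<^sub>2"
    unfolding glued_def by blast
  then show ?thesis using identified_nonempty[of \<rho> c a\<^sub>1 a\<^sub>2] unfolding Field_copy by simp
qed

text \<open>
  All strict relations of \<open>S\<close> between identified elements involve \<open>c\<close>; whether they are relations of \<open>Q\<close> as well
  is what the side conditions of the rules decide.
\<close>

lemma card_glued_relations:
  fixes S Q T :: "nat rel"
  assumes glued: "glued \<rho> Q S e R" and T: "T = map_prod e e ` S"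
    and min: "minimal_elements T \<subseteq> D" and max: "maximal_elements T \<inter> D = {}"
    and S_refl: "\<And>p. p \<in> Field S \<Longrightarrow> (p, p) \<in> S"
  shows "card (Field T \<inter> Field Q) = Suc (card (crossing Q D \<inter> crossing T D)) + rule_excess \<rho>"
proof -
  interpret poset_copy S T e using assms by unfold_locales (auto simp: glued_def)
  from glued obtain c a\<^sub>1 a\<^sub>2 where lab: "ext_labels S c a\<^sub>1 a\<^sub>2"
    and a2: "uses_a2 \<rho> \<Longrightarrow> card (Ext S) = 3"
    and shared: "e ` Field S \<inter> Field Q = e ` identified \<rho> c a\<^sub>1 a\<^sub>2"
    and ends: "\<forall>v\<in>identified \<rho> c a\<^sub>1 a\<^sub>2. v \<in> minimal_elements S \<and> e v \<in> minimal_elements Q \<or>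
         v \<in> maximal_elements S \<and> e v \<in> maximal_elements Q"
    and side: "side_condition \<rho> Q (e c) (e a\<^sub>1) (e a\<^sub>2)"
    unfolding glued_def by blast
  define Z where "Z = identified \<rho> c a\<^sub>1 a\<^sub>2"
  have ZS: "z \<in> Field S" if "z \<in> Z" for z
    using ends that by (auto simp: Z_def minimal_elements_def maximal_elements_def)
  have finZ: "finite Z" using identified_subset[of \<rho> c a\<^sub>1 a\<^sub>2] by (auto simp: Z_def intro: finite_subset)
  have inj_Z: "inj_on e Z" using inj ZS by (auto intro: inj_on_subset)
  have c1: "c \<noteq> a\<^sub>1" using lab by (auto simp: ext_labels_def Rel_def)
  have c2: "c \<noteq> a\<^sub>2 \<and> a\<^sub>1 \<noteq> a\<^sub>2" if u: "uses_a2 \<rho>"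
  proof -
    have "card {a\<^sub>1, a\<^sub>2, c} = 3" using lab a2[OF u] by (auto simp: ext_labels_def)
    then show ?thesis by (auto simp: card_insert_if split: if_splits)
  qed
  define N where "N = {a \<in> Z - {c}. comparable Q (e a) (e c)}"
  have cardZ: "card Z = Suc (if c \<in> Z then card N else 0) + rule_excess \<rho>"
    unfolding Z_def N_def by (rule card_identified[OF c1 c2 side])
  have others: "a = a\<^sub>1 \<or> a = a\<^sub>2 \<and> card (Ext S) = 3" if a: "a \<in> Z" "a \<noteq> c" for a
  proof -
    have "a = a\<^sub>1 \<or> a = a\<^sub>2" using a identified_subset[of \<rho> c a\<^sub>1 a\<^sub>2] by (auto simp: Z_def)
    then show ?thesis using identified_uses_a2[of a\<^sub>2 \<rho> c a\<^sub>1] a a2 by (auto simp: Z_def)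
  qed
  have "card (crossing Q D \<inter> crossing T D) = (if c \<in> Z then card N else 0)"
  proof -
    have Zend: "e z \<in> D \<and> z \<in> minimal_elements S \<and> e z \<in> minimal_elements Q \<or>
        e z \<notin> D \<and> z \<in> maximal_elements S \<and> e z \<in> maximal_elements Q" if "z \<in> Z" for z
      using ends that min max unfolding Z_def minimal_copy maximal_copy by blast
    have cross: "(u, w) \<in> crossing Q D \<inter> crossing T D \<longleftrightarrow>
        (\<exists>p\<in>Z. \<exists>q\<in>Z. u = e p \<and> w = e q \<and> e p \<in> D \<and> e q \<notin> D \<and> (e p, e q) \<in> Q \<and> (p, q) \<in> S)"
      for u w
    proof
      assume uw: "(u, w) \<in> crossing Q D \<inter> crossing T D"
      then have rel: "(u, w) \<in> T" "(u, w) \<in> Q" by (auto simp: crossing_iff)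
      have "u \<in> e ` Field S \<inter> Field Q" "w \<in> e ` Field S \<inter> Field Q"
        using FieldI_pair[OF rel(1)] FieldI_pair[OF rel(2)] unfolding Field_copy by blast+
      then obtain p q where pq: "p \<in> Z" "q \<in> Z" "u = e p" "w = e q"
        unfolding shared Z_def by blast
      then have "(p, q) \<in> S" using rel(1) copy_iff[OF ZS[OF pq(1)] ZS[OF pq(2)]] by simp
      then show "\<exists>p\<in>Z. \<exists>q\<in>Z. u = e p \<and> w = e q \<and> e p \<in> D \<and> e q \<notin> D \<and> (e p, e q) \<in> Q \<and> (p, q) \<in> S"
        using uw pq by (intro bexI[of _ p] bexI[of _ q]) (auto simp: crossing_iff)
    next
      assume "\<exists>p\<in>Z. \<exists>q\<in>Z. u = e p \<and> w = e q \<and> e p \<in> D \<and> e q \<notin> D \<and> (e p, e q) \<in> Q \<and> (p, q) \<in> S"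
      then obtain p q where pq: "p \<in> Z" "q \<in> Z" "u = e p" "w = e q" "e p \<in> D" "e q \<notin> D"
        "(e p, e q) \<in> Q" "(p, q) \<in> S" by blast
      then have "(e p, e q) \<in> T" using copy_iff[OF ZS[OF pq(1)] ZS[OF pq(2)]] by simp
      then show "(u, w) \<in> crossing Q D \<inter> crossing T D" using pq by (simp add: crossing_iff)
    qed
    have "(\<forall>a\<in>Z - {c}. (c, a) \<in> Rel S) \<or> (\<forall>a\<in>Z - {c}. (a, c) \<in> Rel S)"
    proof -
      consider "(c, a\<^sub>1) \<in> Rel S" "card (Ext S) = 2" | "(c, a\<^sub>1) \<in> Rel S" "(c, a\<^sub>2) \<in> Rel S"
        | "(a\<^sub>1, c) \<in> Rel S" "(a\<^sub>2, c) \<in> Rel S"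
        using lab unfolding ext_labels_def by blast
      then show ?thesis
      proof cases
        case 1
        have "(c, a) \<in> Rel S" if "a \<in> Z - {c}" for a using others[of a] that 1 by auto
        then show ?thesis by blast
      next
        case 2
        have "(c, a) \<in> Rel S" if "a \<in> Z - {c}" for a using others[of a] that 2 by auto
        then show ?thesis by blast
      next
        case 3
        have "(a, c) \<in> Rel S" if "a \<in> Z - {c}" for a using others[of a] that 3 by auto
        then show ?thesis by blast
      qed
    qed
    then show ?thesis
    proof
      assume below: "\<forall>a\<in>Z - {c}. (c, a) \<in> Rel S"
      have amax: "e a \<notin> D \<and> e a \<in> maximal_elements Q" if "a \<in> Z - {c}" for a
        using Zend[of a] below that by (auto simp: minimal_elements_def)
      show ?thesis
      proof (cases "c \<in> Z \<and> Z \<noteq> {c}")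
        case True
        then obtain b where "b \<in> Z - {c}" by blast
        then have cmin: "e c \<in> D" "e c \<in> minimal_elements Q"
          using Zend[of c] below True by (auto simp: maximal_elements_def)
        have "crossing Q D \<inter> crossing T D = (\<lambda>a. (e c, e a)) ` N"
        proof (rule set_eqI, clarify)
          fix u w
          show "(u, w) \<in> crossing Q D \<inter> crossing T D \<longleftrightarrow> (u, w) \<in> (\<lambda>a. (e c, e a)) ` N"
          proof
            assume "(u, w) \<in> crossing Q D \<inter> crossing T D"
            then obtain p q where pq: "p \<in> Z" "q \<in> Z" "u = e p" "w = e q" "e p \<in> D" "e q \<notin> D"
              "(e p, e q) \<in> Q" using cross by blast
            then have "p = c" "q \<noteq> c" using amax cmin by blast+
            then show "(u, w) \<in> (\<lambda>a. (e c, e a)) ` N" using pq by (auto simp: N_def comparable_def)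
          next
            assume "(u, w) \<in> (\<lambda>a. (e c, e a)) ` N"
            then obtain a where a: "a \<in> Z - {c}" "comparable Q (e a) (e c)" "u = e c" "w = e a"
              by (auto simp: N_def)
            have ne: "e a \<noteq> e c" using a copy_eq ZS True by auto
            then have "(e a, e c) \<notin> Q" using cmin by (auto simp: minimal_elements_def Rel_def)
            then have "(e c, e a) \<in> Q" using a by (auto simp: comparable_def)
            moreover have "(c, a) \<in> S" using below a by (auto simp: Rel_def)
            ultimately show "(u, w) \<in> crossing Q D \<inter> crossing T D"
              unfolding cross
              by (intro bexI[of _ c] bexI[of _ a]) (use a(1,3,4) True cmin amax in auto)
          qed
        qed
        moreover have "inj_on (\<lambda>a. (e c, e a)) N"
          using inj_Z by (auto simp: inj_on_def N_def)
        ultimately show ?thesis using True by (simp add: card_image)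
      next
        case False
        have "crossing Q D \<inter> crossing T D = {}"
        proof (rule ccontr)
          assume "\<not> ?thesis"
          then obtain u w where "(u, w) \<in> crossing Q D \<inter> crossing T D" by auto
          then obtain p q where pq: "p \<in> Z" "q \<in> Z" "e p \<in> D" "e q \<notin> D" unfolding cross by blast
          then have "p = c" using amax by blast
          then show False using pq False by auto
        qed
        moreover have "N = {}" if "c \<in> Z" using False that by (auto simp: N_def)
        ultimately show ?thesis by auto
      qed
    next
      assume above: "\<forall>a\<in>Z - {c}. (a, c) \<in> Rel S"
      have amin: "e a \<in> D \<and> e a \<in> minimal_elements Q" if "a \<in> Z - {c}" for a
        using Zend[of a] above that by (auto simp: maximal_elements_def)
      show ?thesis
      proof (cases "c \<in> Z \<and> Z \<noteq> {c}")
        case True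
        then obtain b where "b \<in> Z - {c}" by blast
        then have cmax: "e c \<notin> D" "e c \<in> maximal_elements Q"
          using Zend[of c] above True by (auto simp: minimal_elements_def)
        have "crossing Q D \<inter> crossing T D = (\<lambda>a. (e a, e c)) ` N"
        proof (rule set_eqI, clarify)
          fix u w
          show "(u, w) \<in> crossing Q D \<inter> crossing T D \<longleftrightarrow> (u, w) \<in> (\<lambda>a. (e a, e c)) ` N"
          proof
            assume "(u, w) \<in> crossing Q D \<inter> crossing T D"
            then obtain p q where pq: "p \<in> Z" "q \<in> Z" "u = e p" "w = e q" "e p \<in> D" "e q \<notin> D"
              "(e p, e q) \<in> Q" using cross by blast
            then have "q = c" "p \<noteq> c" using amin cmax by blast+
            then show "(u, w) \<in> (\<lambda>a. (e a, e c)) ` N" using pq by (auto simp: N_def comparable_def)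
          next
            assume "(u, w) \<in> (\<lambda>a. (e a, e c)) ` N"
            then obtain a where a: "a \<in> Z - {c}" "comparable Q (e a) (e c)" "u = e a" "w = e c"
              by (auto simp: N_def)
            have ne: "e a \<noteq> e c" using a copy_eq ZS True by auto
            then have "(e c, e a) \<notin> Q" using cmax by (auto simp: maximal_elements_def Rel_def)
            then have "(e a, e c) \<in> Q" using a by (auto simp: comparable_def)
            moreover have "(a, c) \<in> S" using above a by (auto simp: Rel_def)
            ultimately show "(u, w) \<in> crossing Q D \<inter> crossing T D"
              unfolding cross
              by (intro bexI[of _ a] bexI[of _ c]) (use a(1,3,4) True cmax amin in auto)
          qed
        qed
        moreover have "inj_on (\<lambda>a. (e a, e c)) N"
          using inj_Z by (auto simp: inj_on_def N_def)
        ultimately show ?thesis using True by (simp add: card_image)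
      next
        case False
        have "crossing Q D \<inter> crossing T D = {}"
        proof (rule ccontr)
          assume "\<not> ?thesis"
          then obtain u w where "(u, w) \<in> crossing Q D \<inter> crossing T D" by auto
          then obtain p q where pq: "p \<in> Z" "q \<in> Z" "e p \<in> D" "e q \<notin> D" unfolding cross by blast
          then have "q = c" using amin by blast
          then show False using pq False by auto
        qed
        moreover have "N = {}" if "c \<in> Z" using False that by (auto simp: N_def)
        ultimately show ?thesis by auto
      qed
    qed
  qed
  moreover have "card (Field T \<inter> Field Q) = card Z"
    unfolding Field_copy shared Z_def[symmetric] using inj_Z by (rule card_image)
  ultimately show ?thesis using cardZ by simp
qed

lemma card_glued:
  fixes S Q T :: "nat rel"
  assumes glued: "glued \<rho> Q S e R" and T: "T = map_prod e e ` S"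
    and fin: "finite Q" "finite T"
    and refl: "\<And>p. p \<in> Field Q \<Longrightarrow> (p, p) \<in> Q" "\<And>p. p \<in> Field S \<Longrightarrow> (p, p) \<in> S"
    and min: "minimal_elements T \<subseteq> D" and max: "maximal_elements T \<inter> D = {}"
    and down: "down_closed Q D" "down_closed T D"
  shows "int (card (internal R D)) - int (card (crossing R D))
    = (int (card (internal Q D)) - int (card (crossing Q D)))
      + (int (card (internal T D)) - int (card (crossing T D))) - 1 - int (rule_excess \<rho>)"
proof -
  interpret poset_copy S T e using assms by unfold_locales (auto simp: glued_def)
  have R: "R = Q \<union> T" using glued T by (simp add: glued_def)
  have cross: "crossing R D = crossing Q D \<union> crossing T D" by (auto simp: R crossing_def)
  have int: "internal R D = internal Q D \<union> internal T D" by (auto simp: R internal_def crossing_def)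
  have fin': "finite (crossing Q D)" "finite (crossing T D)" "finite (internal Q D)" "finite (internal T D)"
    using fin crossing_subset internal_subset finite_subset by metis+
  have T_refl: "(p, p) \<in> T" if "p \<in> Field T" for p
    using that refl(2) copy_iff unfolding Field_copy by auto
  have "internal Q D \<inter> internal T D = Id_on (Field T \<inter> Field Q)"
  proof (rule set_eqI, clarify)
    fix p q
    show "(p, q) \<in> internal Q D \<inter> internal T D \<longleftrightarrow> (p, q) \<in> Id_on (Field T \<inter> Field Q)"
    proof
      assume pq: "(p, q) \<in> internal Q D \<inter> internal T D"
      then have rel: "(p, q) \<in> Q" "(p, q) \<in> T" "p \<in> D \<longleftrightarrow> q \<in> D"
        using internal_iff[OF down(1)] internal_iff[OF down(2)] by blast+
      then have V: "p \<in> Field T" "q \<in> Field T" "p \<in> Field Q" "q \<in> Field Q" by (auto simp: Field_def)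
      have "p = q"
      proof (cases "q \<in> D")
        case True
        then have "q \<in> minimal_elements T" using glued_overlap[OF glued T V(2,4)] max by blast
        then show ?thesis using rel(2) by (auto simp: minimal_elements_def Rel_def)
      next
        case False
        then have "p \<in> maximal_elements T" using glued_overlap[OF glued T V(1,3)] min rel(3) by blast
        then show ?thesis using rel(2) by (auto simp: maximal_elements_def Rel_def)
      qed
      then show "(p, q) \<in> Id_on (Field T \<inter> Field Q)" using V by auto
    next
      assume "(p, q) \<in> Id_on (Field T \<inter> Field Q)"
      then show "(p, q) \<in> internal Q D \<inter> internal T D"
        using refl(1) T_refl internal_iff[OF down(1)] internal_iff[OF down(2)] by auto
    qed
  qed
  moreover have "Id_on (Field T \<inter> Field Q) = (\<lambda>p. (p, p)) ` (Field T \<inter> Field Q)" by auto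
  ultimately have "card (internal Q D \<inter> internal T D) = card (Field T \<inter> Field Q)"
    by (simp add: card_image inj_on_def)
  moreover have "card (internal Q D) + card (internal T D)
      = card (internal R D) + card (internal Q D \<inter> internal T D)"
    unfolding int using fin' by (intro card_Un_Int)
  moreover have "card (crossing Q D) + card (crossing T D)
      = card (crossing R D) + card (crossing Q D \<inter> crossing T D)"
    unfolding cross using fin' by (intro card_Un_Int)
  moreover have "card (Field T \<inter> Field Q) = Suc (card (crossing Q D \<inter> crossing T D)) + rule_excess \<rho>"
    by (rule card_glued_relations[OF glued T min max refl(2)])
  ultimately show ?thesis by linarith
qed

section \<open>Construction sequences\<close>

locale construction =
  fixes P :: "nat rel" and n :: nat and S Q :: "nat \<Rightarrow> nat rel" and \<phi> :: "nat \<Rightarrow> pmat \<Rightarrow> complex"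
    and e :: "nat \<Rightarrow> nat \<Rightarrow> nat" and \<rho> :: "nat \<Rightarrow> glue_rule" and E :: "nat \<Rightarrow> nat rel"
  assumes seq: "construction_sequence P n S \<phi> Q e \<rho>"
    and cut: "\<And>i. i \<in> {1..n} \<Longrightarrow> spanning_cut (S i) (E i)"
    and contact_E: "\<And>i. i \<in> {1..n} \<Longrightarrow> contact_toral_pair (S i) (\<phi> i) \<Longrightarrow>
      contact_kernel (S i) (E i) 1 \<and> (\<exists>k. card (S i) - 1 = 2 * k + 1)"
    and toral_E: "\<And>i. i \<in> {1..n} \<Longrightarrow> \<not> contact_toral_pair (S i) (\<phi> i) \<Longrightarrow>
      frobenius_kernel (S i) (E i)"
begin

definition T :: "nat \<Rightarrow> nat rel" where "T i = map_prod (e i) (e i) ` S i"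

definition S_sources :: "nat \<Rightarrow> nat set" where "S_sources i = sources (Field (S i)) (E i)"

definition D :: "nat set" where "D = (\<Union>i\<in>{1..n}. e i ` S_sources i)"

definition contact_indices :: "nat set" where
  "contact_indices = {i \<in> {1..n}. contact_toral_pair (S i) (\<phi> i)}"

lemma n_pos: "1 \<le> n" and P_poset: "labelled_poset P" and Q_n: "Q n = P"
  and glued_Q: "i \<in> {2..n} \<Longrightarrow> glued (\<rho> i) (Q (i - 1)) (S i) (e i) (Q i)"
  using seq by (auto simp: construction_sequence_def)

lemma S_poset: "i \<in> {1..n} \<Longrightarrow> labelled_poset (S i)"
  using cut by (simp add: spanning_cut_def)

lemmas cut_properties = spanning_cut_properties[OF cut, folded S_sources_def]

lemma copy:
  assumes "i \<in> {1..n}"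
  shows "poset_copy (S i) (T i) (e i)"
proof
  show "inj_on (e i) (Field (S i))"
  proof (cases "i = 1")
    case True
    then show ?thesis using seq by (simp add: construction_sequence_def)
  next
    case False
    then show ?thesis using glued_Q[of i] assms by (simp add: glued_def)
  qed
qed (rule T_def)

lemma Q_eq:
  assumes "1 \<le> m" "m \<le> n"
  shows "Q m = (\<Union>i\<in>{1..m}. T i)"
  using assms
proof (induction m rule: dec_induct)
  case base
  then show ?case using seq by (simp add: construction_sequence_def T_def)
next
  case (step m)
  then have "Q (Suc m) = Q m \<union> T (Suc m)"
    using glued_Q[of "Suc m"] by (simp add: glued_def T_def)
  moreover have "{1..Suc m} = insert (Suc m) {1..m}" by auto
  ultimately show ?case using step by auto
qed

lemma T_subset_Q: "1 \<le> i \<Longrightarrow> i \<le> m \<Longrightarrow> m \<le> n \<Longrightarrow> T i \<subseteq> Q m"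
  using Q_eq[of m] by auto

lemma Field_UN: "Field (\<Union>i\<in>A. R i) = (\<Union>i\<in>A. Field (R i))"
  unfolding Field_def by blast

lemma minimal_subset: "A \<subseteq> B \<Longrightarrow> v \<in> minimal_elements B \<Longrightarrow> v \<in> Field A \<Longrightarrow> v \<in> minimal_elements A"
  unfolding minimal_elements_def Rel_def by blast

lemma maximal_subset: "A \<subseteq> B \<Longrightarrow> v \<in> maximal_elements B \<Longrightarrow> v \<in> Field A \<Longrightarrow> v \<in> maximal_elements A"
  unfolding maximal_elements_def Rel_def by blast

lemma overlap_less:
  assumes "i \<in> {1..n}" "j \<in> {1..n}" "i < j" "v \<in> Field (T i)" "v \<in> Field (T j)"
  shows "v \<in> minimal_elements (T i) \<and> v \<in> minimal_elements (T j) \<or>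
    v \<in> maximal_elements (T i) \<and> v \<in> maximal_elements (T j)"
proof -
  have sub: "T i \<subseteq> Q (j - 1)" using assms by (intro T_subset_Q) auto
  then have "v \<in> Field (Q (j - 1))" using assms(4) mono_Field by blast
  then show ?thesis
    using glued_overlap[OF glued_Q T_def assms(5)] assms minimal_subset[OF sub] maximal_subset[OF sub]
    by fastforce
qed

lemma overlap_T:
  assumes "i \<in> {1..n}" "j \<in> {1..n}" "i \<noteq> j" "v \<in> Field (T i)" "v \<in> Field (T j)"
  shows "v \<in> minimal_elements (T i) \<and> v \<in> minimal_elements (T j) \<or>
    v \<in> maximal_elements (T i) \<and> v \<in> maximal_elements (T j)"
proof (cases "i < j")
  case True
  then show ?thesis using overlap_less assms by blast
next
  case False
  then have "j < i" using assms(3) by simp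
  then show ?thesis using overlap_less[of j i v] assms by blast
qed

text \<open>
  \<open>D\<close> meets every piece in its own sources, since minimal elements are sources and maximal ones are not.
\<close>

lemma D_iff:
  assumes i: "i \<in> {1..n}" and p: "p \<in> Field (S i)"
  shows "e i p \<in> D \<longleftrightarrow> p \<in> S_sources i"
proof
  interpret Si: poset_copy "S i" "T i" "e i" by (rule copy[OF i])
  assume "e i p \<in> D"
  then obtain j x where j: "j \<in> {1..n}" and x: "x \<in> S_sources j" "e i p = e j x"
    unfolding D_def by blast
  interpret Sj: poset_copy "S j" "T j" "e j" by (rule copy[OF j])
  have xF: "x \<in> Field (S j)" using cut_properties(8)[OF j] x by blast
  show "p \<in> S_sources i"
  proof (cases "i = j")
    case True
    then show ?thesis using x xF p Si.copy_eq by blast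
  next
    case False
    have "e i p \<in> Field (T i)" unfolding Si.Field_copy using p by (rule imageI)
    moreover have "e i p \<in> Field (T j)" unfolding Sj.Field_copy x(2) using xF by (rule imageI)
    ultimately have "e i p \<in> Field (T i)" "e i p \<in> Field (T j)" .
    from overlap_T[OF i j False this] show ?thesis
    proof (elim disjE conjE)
      assume "e i p \<in> minimal_elements (T i)"
      then obtain y where y: "y \<in> minimal_elements (S i)" "e i p = e i y"
        unfolding Si.minimal_copy by blast
      then have "y = p" using p Si.copy_eq by (auto simp: minimal_elements_def)
      then show ?thesis using y cut_properties(3)[OF i] by blast
    next
      assume "e i p \<in> maximal_elements (T j)"
      then obtain y where y: "y \<in> maximal_elements (S j)" "e j x = e j y"
        unfolding Sj.maximal_copy x(2) by blast
      then have "y = x" using xF Sj.copy_eq by (auto simp: maximal_elements_def)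
      then show ?thesis using y x cut_properties(4)[OF j] by blast
    qed
  qed
next
  assume "p \<in> S_sources i"
  then show "e i p \<in> D" using i unfolding D_def by blast
qed

lemma down_T_D:
  assumes i: "i \<in> {1..n}"
  shows "down_closed (T i) D"
  unfolding down_closed_def
proof clarify
  interpret poset_copy "S i" "T i" "e i" by (rule copy[OF i])
  fix x y assume xy: "(x, y) \<in> T i" "y \<in> D"
  then obtain p q where pq: "(p, q) \<in> S i" "x = e i p" "y = e i q" unfolding T by auto
  note F = FieldI_pair[OF pq(1)]
  have "q \<in> S_sources i" using D_iff[OF i F(2)] xy pq by blast
  then have "p \<in> S_sources i" using cut_properties(2)[OF i] pq(1) unfolding down_closed_def by blast
  then show "x \<in> D" using D_iff[OF i F(1)] pq by blast
qed

lemma min_T_D: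
  assumes i: "i \<in> {1..n}"
  shows "minimal_elements (T i) \<subseteq> D"
proof -
  interpret poset_copy "S i" "T i" "e i" by (rule copy[OF i])
  show ?thesis
    using cut_properties(3)[OF i] D_iff[OF i] unfolding minimal_copy
    by (auto simp: minimal_elements_def)
qed

lemma max_T_D:
  assumes i: "i \<in> {1..n}"
  shows "maximal_elements (T i) \<inter> D = {}"
proof -
  interpret poset_copy "S i" "T i" "e i" by (rule copy[OF i])
  show ?thesis
    using cut_properties(4)[OF i] D_iff[OF i] unfolding maximal_copy
    by (auto simp: maximal_elements_def)
qed

definition T_edges :: "nat \<Rightarrow> nat rel" where "T_edges i = map_prod (e i) (e i) ` E i"

lemma T_edges_crossing:
  assumes i: "i \<in> {1..n}"
  shows "T_edges i \<subseteq> crossing (T i) D"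
proof -
  interpret poset_copy "S i" "T i" "e i" by (rule copy[OF i])
  have "crossing (T i) D = map_prod (e i) (e i) ` crossing (S i) (S_sources i)"
    by (rule crossing_copy) (rule D_iff[OF i])
  then show ?thesis using cut_properties(1)[OF i] unfolding T_edges_def by blast
qed

lemma T_edges_min_max:
  assumes i: "i \<in> {1..n}"
  shows "minimal_elements (T i) \<times> maximal_elements (T i) \<subseteq> T_edges i"
proof -
  interpret poset_copy "S i" "T i" "e i" by (rule copy[OF i])
  show ?thesis
    using cut_properties(5)[OF i] unfolding minimal_copy maximal_copy T_edges_def by fastforce
qed

sublocale amalgam P "{1..n}" T D
proof
  show "labelled_poset P" by (rule P_poset)
  show "P = (\<Union>i\<in>{1..n}. T i)" using Q_eq[of n] Q_n n_pos by simp
  fix i assume i: "i \<in> {1..n}"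
  interpret poset_copy "S i" "T i" "e i" by (rule copy[OF i])
  show "(p, p) \<in> T i" if "p \<in> Field (T i)" for p
    using that copy_iff labelled_posetD(5)[OF S_poset[OF i]] unfolding Field_copy by auto
  show "down_closed (T i) D" by (rule down_T_D[OF i])
  show "minimal_elements (T i) \<subseteq> D" by (rule min_T_D[OF i])
  show "maximal_elements (T i) \<inter> D = {}" by (rule max_T_D[OF i])
  show "minimal_elements (T i) \<times> maximal_elements (T i) \<subseteq> T i"
    using T_edges_min_max[OF i] T_edges_crossing[OF i] crossing_subset by blast
  have "minimal_elements (S i) \<subseteq> Field (S i)" "maximal_elements (S i) \<subseteq> Field (S i)"
    by (auto simp: minimal_elements_def maximal_elements_def)
  then have "inj_on (e i) (minimal_elements (S i))" "inj_on (e i) (maximal_elements (S i))"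
    "inj_on (e i) (Ext (S i))"
    using inj by (auto intro: inj_on_subset simp: Ext_def)
  then show "card (Ext (T i)) = Suc (card (minimal_elements (T i) \<times> maximal_elements (T i)))"
    using cut_properties(6)[OF i]
    by (simp add: Ext_copy minimal_copy maximal_copy card_image card_cartesian_product)
  fix j v assume "j \<in> {1..n}" "i \<noteq> j" "v \<in> Field (T i)" "v \<in> Field (T j)"
  then show "v \<in> minimal_elements (T i) \<and> v \<in> minimal_elements (T j) \<or>
      v \<in> maximal_elements (T i) \<and> v \<in> maximal_elements (T j)"
    by (rule overlap_T[OF i])
qed simp

lemma S_Field_nonempty: "i \<in> {1..n} \<Longrightarrow> Field (S i) \<noteq> {}"
  using cut_properties(7)[of i] by (auto simp: Ext_def minimal_elements_def maximal_elements_def)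

lemma piece_excess:
  assumes i: "i \<in> {1..n}"
  shows "card (internal (T i) D)
    = card (crossing (T i) D) + 1 + (if contact_toral_pair (S i) (\<phi> i) then 1 else 0)"
proof -
  interpret poset_copy "S i" "T i" "e i" by (rule copy[OF i])
  have card: "card (crossing (T i) D) = card (crossing (S i) (S_sources i))"
    "card (internal (T i) D) = card (internal (S i) (S_sources i))"
    by (rule card_copy, rule D_iff[OF i], assumption)+
  note one = one_in_Field(1)[OF S_poset[OF i] S_Field_nonempty[OF i]]
  show ?thesis
  proof (cases "contact_toral_pair (S i) (\<phi> i)")
    case True
    with contact_E[OF i] obtain k where "contact_kernel (S i) (E i) 1" "card (S i) - 1 = 2 * k + 1"
      by blast
    from card_internal_contact[OF S_poset[OF i] cut_properties(2,1)[OF i] one this] True show ?thesis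
      by (simp add: card)
  next
    case False
    from card_internal_frobenius[OF S_poset[OF i] cut_properties(2,1)[OF i] one toral_E[OF i False]] False
    show ?thesis by (simp add: card)
  qed
qed

text \<open>
  The constant \<open>1\<close> is the identity matrix, which is counted once for the whole poset.
\<close>

lemma sequence_excess:
  assumes "1 \<le> m" "m \<le> n"
  shows "int (card (internal (Q m) D)) - int (card (crossing (Q m) D))
    = 1 + int (card {i \<in> {1..m}. contact_toral_pair (S i) (\<phi> i)})
      - int (\<Sum>i\<in>{2..m}. rule_excess (\<rho> i))"
  using assms
proof (induction m rule: dec_induct)
  case base
  have "{i \<in> {1..1}. contact_toral_pair (S i) (\<phi> i)} = (if contact_toral_pair (S 1) (\<phi> 1) then {1} else {})"
    by auto
  moreover have "Q 1 = T 1" using Q_eq[of 1] n_pos by simp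
  ultimately show ?case using piece_excess[of 1] n_pos by simp
next
  case (step m)
  let ?i = "Suc m"
  have i: "?i \<in> {1..n}" "?i \<in> {2..n}" using step by auto
  have Qm: "Q m = (\<Union>i\<in>{1..m}. T i)" using step by (intro Q_eq) auto
  have sub: "i \<in> {1..m} \<Longrightarrow> i \<in> {1..n}" for i using step by auto
  have glued: "glued (\<rho> ?i) (Q m) (S ?i) (e ?i) (Q ?i)" using glued_Q[OF i(2)] by simp
  have Q_refl: "(p, p) \<in> Q m" if p: "p \<in> Field (Q m)" for p
  proof -
    obtain i where "i \<in> {1..m}" "p \<in> Field (T i)" using p unfolding Qm Field_UN by blast
    then show ?thesis using refl_T[OF sub] unfolding Qm by blast
  qed
  have Q_down: "down_closed (Q m) D"
    unfolding Qm down_closed_def using down_T_D[OF sub] unfolding down_closed_def by blast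
  have fin: "finite (Q m)" unfolding Qm using finite_T[OF sub] by blast
  have "{j \<in> {1..?i}. contact_toral_pair (S j) (\<phi> j)}
      = {j \<in> {1..m}. contact_toral_pair (S j) (\<phi> j)} \<union> (if contact_toral_pair (S ?i) (\<phi> ?i) then {?i} else {})"
    by (auto simp: le_Suc_eq)
  then have "card {j \<in> {1..?i}. contact_toral_pair (S j) (\<phi> j)}
      = card {j \<in> {1..m}. contact_toral_pair (S j) (\<phi> j)} + (if contact_toral_pair (S ?i) (\<phi> ?i) then 1 else 0)"
    by simp
  moreover have "(\<Sum>j\<in>{2..?i}. rule_excess (\<rho> j)) = (\<Sum>j\<in>{2..m}. rule_excess (\<rho> j)) + rule_excess (\<rho> ?i)"
    using step by simp
  moreover have "int (card (internal (Q m) D)) - int (card (crossing (Q m) D))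
    = 1 + int (card {i \<in> {1..m}. contact_toral_pair (S i) (\<phi> i)})
      - int (\<Sum>i\<in>{2..m}. rule_excess (\<rho> i))" using step by simp
  ultimately show ?case
    using card_glued[OF glued T_def fin finite_T[OF i(1)] Q_refl labelled_posetD(5)[OF S_poset[OF i(1)]]
        min_T_D[OF i(1)] max_T_D[OF i(1)] Q_down down_T_D[OF i(1)]] piece_excess[OF i(1)]
    by simp
qed

lemma P_excess:
  "int (card (internal P D)) - int (card (crossing P D))
    = 1 + int (card contact_indices) - int (\<Sum>i\<in>{2..n}. rule_excess (\<rho> i))"
  using sequence_excess[OF n_pos] Q_n by (simp add: contact_indices_def)

text \<open>
  With \<open>c\<close> contact pieces and total rule excess \<open>b\<close>, the isotropic bound gives \<open>c + b \<le> 1\<close>. The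
  dimension is odd and the crossing part is not too large, which leaves \<open>c = 1\<close> and \<open>b = 0\<close>.
\<close>

lemma contact_necessary:
  assumes "contact_poset P"
  shows "card contact_indices = 1 \<and> (\<Sum>i\<in>{2..n}. rule_excess (\<rho> i)) = 0"
proof -
  obtain \<psi> where \<psi>: "contact_form (lie_poset_A P) (poset_bracket P) \<psi>"
    using assms unfolding contact_poset_def contact_def by blast
  have one: "1 \<in> {1..n}" using n_pos by simp
  interpret poset_copy "S 1" "T 1" "e 1" by (rule copy[OF one])
  obtain v where v: "v \<in> Ext (T 1)" using cut_properties(7)[OF one] unfolding Ext_copy by blast
  then have vV: "v \<in> V" using Ext_Field Field_T[OF one] by blast
  from contact_form_coefficients[OF P_poset \<psi> vV] obtain f where
    f: "\<forall>X\<in>lie_poset P. X (v, v) = 0 \<longrightarrow> (\<Sum>pq\<in>P. f pq * X pq) = 0 \<longrightarrow>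
      (\<forall>pq\<in>P. coad V f X pq = 0) \<longrightarrow> X = 0" by blast
  have isotropic: "card (crossing P D) + 2 * card contact_indices \<le> card (internal P D)"
  proof (rule isotropic_bound[OF _ _ one v])
    show "contact_indices \<subseteq> {1..n}" by (auto simp: contact_indices_def)
    show "card (crossing (T i) D) + 1 < card (internal (T i) D)" if "i \<in> contact_indices" for i
      using piece_excess[of i] that by (simp add: contact_indices_def)
    show "X = 0" if "X \<in> lie_poset P" "X (v, v) = 0" "(\<Sum>pq\<in>P. f pq * X pq) = 0"
      "\<And>pq. pq \<in> P \<Longrightarrow> coad V f X pq = 0" for X
      using f that by blast
  qed
  have less: "card (crossing P D) < card (internal P D)"
  proof (rule ccontr)
    assume "\<not> ?thesis"
    then have "card (internal P D) \<le> card (crossing P D)" by simp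
    from crossing_kernel[OF P_poset down_P vV this, of f] obtain Y where
      Y: "Y \<noteq> 0" "supported (crossing P D) Y" "\<forall>pq\<in>P. coad V f Y pq = 0"
      "(\<Sum>pq\<in>P. f pq * Y pq) = 0" by blast
    have "Y \<in> lie_poset P"
      unfolding lie_poset_eq_supported using Y(2) crossing_subset by (rule supported_mono)
    moreover have "Y (v, v) = 0" using supportedD[OF Y(2), of "(v, v)"] by (simp add: crossing_iff)
    ultimately show False using f Y by blast
  qed
  have odd_dim: "\<exists>k. card P - 1 = 2 * k + 1"
  proof -
    have "V \<noteq> {}" using vV by blast
    then show ?thesis using \<psi> dim_lie_poset_A[OF P_poset] by (auto simp: contact_form_def)
  qed
  define x y c b where "x = card (crossing P D)" and "y = card (internal P D)"
    and "c = card contact_indices" and "b = (\<Sum>i\<in>{2..n}. rule_excess (\<rho> i))"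
  note defs = this
  have bound: "x + 2 * c \<le> y" "x < y" using isotropic less by (simp_all only: defs)
  have sum: "card P = y + x"
    using card_internal_crossing[OF finite_P, of D] by (simp only: defs)
  have diff: "int y - int x = 1 + int c - int b" using P_excess by (simp only: defs)
  have "c + b \<le> 1" using bound diff by linarith
  then consider "c = 1" "b = 0" | "c = 0" "b = 1" | "c = 0" "b = 0" by linarith
  then have "c = 1 \<and> b = 0"
  proof cases
    case 2
    then show ?thesis using bound diff by linarith
  next
    case 3
    then have "y = Suc x" using diff by linarith
    then have "odd (card P)" using sum by simp
    moreover have "even (card P)" using odd_dim bound sum by (elim exE) presburger
    ultimately show ?thesis by simp
  qed simp
  then show ?thesis by (simp only: defs)
qed

text \<open>
  With exactly one contact piece, the kernel of the sum of the local forms among the internal matrices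
  is as small as possible: on a toral piece such a matrix is scalar, all extremal diagonal
  entries agree because the pieces are linked by extremal elements, and on the contact piece the
  normalizations of entry and trace leave nothing.
\<close>

lemma internal_kernel_trivial:
  assumes j: "contact_indices = {j}"
    and X: "supported (internal P D) X"
    and eq: "\<And>pq. pq \<in> crossing P D \<Longrightarrow> coad V (edge_indicator (\<Union>i\<in>{1..n}. T_edges i)) X pq = 0"
    and vv: "X (e j 1, e j 1) = 0" and tr: "matrix_trace V X = 0"
  shows "X = 0"
proof -
  have jn: "j \<in> {1..n}" and j_iff: "i \<in> {1..n} \<Longrightarrow> contact_toral_pair (S i) (\<phi> i) \<longleftrightarrow> i = j" for i
    using j by (auto simp: contact_indices_def)
  have diag_eq: "X (u, u) = X (w, w)" if "i \<in> {1..n}" "u \<in> Ext (T i)" "w \<in> Ext (T i)" for i u w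
    by (rule extremal_diagonal_equal[where E = T_edges, OF _ _ X _ that])
      (rule T_edges_crossing T_edges_min_max eq, assumption)+
  have one: "1 \<in> {1..n}" using n_pos by simp
  obtain u0 where u0: "u0 \<in> Ext (T 1)"
    using cut_properties(7)[OF one] poset_copy.Ext_copy[OF copy[OF one]] by blast
  have all_equal: "X (u, u) = X (u0, u0)" if "i \<in> {1..n}" "u \<in> Ext (T i)" for i u
    using that
  proof (induction i arbitrary: u rule: less_induct)
    case (less i)
    show ?case
    proof (cases "i = 1")
      case True
      then show ?thesis using diag_eq[OF one _ u0] less.prems by blast
    next
      case False
      then have i2: "i \<in> {2..n}" using less.prems by auto
      then have "Q (i - 1) = (\<Union>k\<in>{1..i - 1}. T k)" by (intro Q_eq) auto
      moreover obtain w where w: "w \<in> Field (T i)" "w \<in> Field (Q (i - 1))"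
        using glued_meet[OF glued_Q[OF i2] T_def] by blast
      ultimately have "w \<in> (\<Union>k\<in>{1..i - 1}. Field (T k))" by (simp only: Field_UN)
      then obtain k where k: "k \<in> {1..i - 1}" "w \<in> Field (T k)" by blast
      then have kn: "k \<in> {1..n}" "k < i" using i2 by auto
      have "w \<in> Ext (T i)" "w \<in> Ext (T k)"
        using overlap_less[OF kn(1) less.prems(1) kn(2) k(2) w(1)] by (auto simp: Ext_def)
      then show ?thesis using diag_eq[OF less.prems(1,2)] less.IH[OF kn(2,1)] by metis
    qed
  qed
  have ext_zero: "X (u, u) = 0" if "i \<in> {1..n}" "u \<in> Ext (T i)" for i u
  proof -
    have "e j 1 \<in> Ext (T j)"
      using one_in_Field(2)[OF S_poset[OF jn] S_Field_nonempty[OF jn]]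
        poset_copy.Ext_copy[OF copy[OF jn]] by (auto simp: Ext_def)
    from all_equal[OF jn this] all_equal[OF that] vv show ?thesis by simp
  qed
  define Y where "Y i = (\<lambda>(p, q). if (p, q) \<in> S i then X (e i p, e i q) else 0)" for i
  have Y_eq: "Y i (p, q) = X (e i p, e i q)" if i: "i \<in> {1..n}" and pq: "p \<in> Field (S i)" "q \<in> Field (S i)"
    for i p q
  proof (cases "X (e i p, e i q) = 0")
    case False
    interpret poset_copy "S i" "T i" "e i" by (rule copy[OF i])
    have int: "(e i p, e i q) \<in> internal P D" using supportedD[OF X] False by blast
    then have rel: "(e i p, e i q) \<in> P" "e i p \<in> D \<longleftrightarrow> e i q \<in> D"
      using internal_iff[OF down_P] by blast+
    have "e i p \<in> Field (T i)" "e i q \<in> Field (T i)" using pq unfolding Field_copy by auto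
    then have "(e i p, e i q) \<in> T i"
      using below_local[OF i rel(1)] above_local[OF i rel(1)] rel(2) by blast
    then show ?thesis using copy_iff[OF pq] by (simp add: Y_def)
  qed (simp add: Y_def)
  have Y_supp: "supported (internal (S i) (S_sources i)) (Y i)" if i: "i \<in> {1..n}" for i
    unfolding supported_def
  proof (intro allI impI)
    fix pq assume npq: "pq \<notin> internal (S i) (S_sources i)"
    obtain p q where pq: "pq = (p, q)" by (cases pq)
    show "Y i pq = 0"
    proof (cases "(p, q) \<in> S i")
      case True
      note F = FieldI_pair[OF True]
      have "\<not> (p \<in> S_sources i \<longleftrightarrow> q \<in> S_sources i)"
        using npq True pq internal_iff[OF cut_properties(2)[OF i]] by blast
      then have "(e i p, e i q) \<notin> internal P D"
        using D_iff[OF i F(1)] D_iff[OF i F(2)] internal_iff[OF down_P] by blast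
      then show ?thesis using supportedD[OF X] by (simp add: pq Y_def)
    qed (simp add: pq Y_def)
  qed
  have Y_coad: "coad (Field (S i)) (edge_indicator (E i)) (Y i) pq = 0"
    if i: "i \<in> {1..n}" and pq: "pq \<in> S i" for i pq
  proof (rule coad_internal_all[OF cut_properties(2)[OF i]
        supported_edge_indicator[OF cut_properties(1)[OF i]] Y_supp[OF i] _ pq])
    interpret poset_copy "S i" "T i" "e i" by (rule copy[OF i])
    fix pq assume cr: "pq \<in> crossing (S i) (S_sources i)"
    obtain p q where pq: "pq = (p, q)" "(p, q) \<in> S i" using cr crossing_subset by (cases pq) blast
    note F = FieldI_pair[OF pq(2)]
    have "crossing (T i) D = map_prod (e i) (e i) ` crossing (S i) (S_sources i)"
      by (rule crossing_copy) (rule D_iff[OF i])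
    then have crT: "(e i p, e i q) \<in> crossing (T i) D" using cr pq(1) by force
    then have crP: "(e i p, e i q) \<in> crossing P D"
      using T_subset[OF i] by (auto simp: crossing_iff)
    have "coad (Field (S i)) (edge_indicator (E i)) (Y i) (p, q)
        = coad (Field (S i)) (edge_indicator (E i)) (\<lambda>(p, q). X (e i p, e i q)) (p, q)"
      unfolding coad_def by (simp add: Y_eq[OF i] F)
    also have "\<dots> = coad (Field (T i)) (edge_indicator (T_edges i)) X (e i p, e i q)"
      unfolding T_edges_def using cut_properties(1)[OF i] crossing_subset
      by (intro coad_copy[symmetric] F) blast
    also have "\<dots> = coad V (edge_indicator (\<Union>i\<in>{1..n}. T_edges i)) X (e i p, e i q)"
      by (rule coad_local_edges[OF T_edges_crossing T_edges_min_max X i crT, symmetric])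
    also have "\<dots> = 0" by (rule eq[OF crP])
    finally show "coad (Field (S i)) (edge_indicator (E i)) (Y i) pq = 0" by (simp add: pq)
  qed
  have Y_mem: "Y i \<in> lie_poset (S i)" if "i \<in> {1..n}" for i
    unfolding lie_poset_eq_supported using Y_supp[OF that] internal_subset by (rule supported_mono)
  have Y_toral: "Y i = 0" if i: "i \<in> {1..n}" "i \<noteq> j" for i
  proof -
    interpret poset_copy "S i" "T i" "e i" by (rule copy[OF i(1)])
    obtain p where p: "p \<in> Ext (S i)" using cut_properties(7)[OF i(1)] by blast
    then have pF: "p \<in> Field (S i)" by (auto simp: Ext_def minimal_elements_def maximal_elements_def)
    have "e i p \<in> Ext (T i)" using p unfolding Ext_copy by blast
    then have "Y i (p, p) = 0" using ext_zero[OF i(1)] Y_eq[OF i(1) pF pF] by simp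
    moreover have "frobenius_kernel (S i) (E i)" using toral_E i j_iff by blast
    from frobenius_kernel_scalar[OF S_poset[OF i(1)] this pF Y_mem[OF i(1)] Y_coad[OF i(1)]]
    have "Y i = scalar_matrix (Field (S i)) (Y i (p, p))" .
    ultimately have "Y i = scalar_matrix (Field (S i)) 0" by metis
    then show ?thesis by (auto simp: scalar_matrix_def fun_eq_iff)
  qed
  have Y_contact: "Y j = 0"
  proof -
    interpret poset_copy "S j" "T j" "e j" by (rule copy[OF jn])
    note oneF = one_in_Field(1)[OF S_poset[OF jn] S_Field_nonempty[OF jn]]
    have "matrix_trace (Field (S j)) (Y j) = (\<Sum>u\<in>Field (T j). X (u, u))"
      unfolding matrix_trace_def Field_copy by (subst sum.reindex[OF inj]) (simp add: Y_eq[OF jn])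
    also have "\<dots> = (\<Sum>u\<in>V. X (u, u))"
    proof (rule sum.mono_neutral_left[OF finite_V Field_T[OF jn]], intro ballI)
      fix u assume u: "u \<in> V - Field (T j)"
      then have "(u, u) \<in> P" using labelled_posetD(5)[OF P_poset] by blast
      from in_T[OF this] obtain i where i: "i \<in> {1..n}" "(u, u) \<in> T i" by blast
      then have iF: "u \<in> Field (T i)" by (auto simp: Field_def)
      then have "i \<noteq> j" using u iF by blast
      obtain p where p: "u = e i p" "p \<in> Field (S i)"
        using iF poset_copy.Field_copy[OF copy[OF i(1)]] by blast
      then show "X (u, u) = 0" using Y_eq[OF i(1) p(2) p(2)] Y_toral[OF i(1) \<open>i \<noteq> j\<close>] by simp
    qed
    also have "\<dots> = 0" using tr by (simp add: matrix_trace_def)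
    finally have mem: "Y j \<in> lie_poset_A (S j)" using Y_mem[OF jn] by (simp add: lie_poset_A_iff)
    have form: "coord_form (E j) (Y j) = 0"
      unfolding coord_form_def using cut_properties(1)[OF jn]
      by (intro sum.neutral) (auto simp: internal_def intro!: supportedD[OF Y_supp[OF jn]])
    have entry: "Y j (1, 1) = 0" using Y_eq[OF jn oneF oneF] vv by simp
    have "contact_kernel (S j) (E j) 1" using contact_E[OF jn] j_iff[OF jn] by blast
    then show ?thesis
      unfolding contact_kernel_def using mem form entry Y_coad[OF jn] by (elim ballE) auto
  qed
  show "X = 0"
  proof
    fix pq
    show "X pq = 0 pq"
    proof (cases "pq \<in> P")
      case True
      then obtain i where i: "i \<in> {1..n}" "pq \<in> T i" using in_T by blast
      then obtain p q where pq: "(p, q) \<in> S i" "pq = (e i p, e i q)" unfolding T_def by fast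
      then have "X pq = Y i (p, q)" by (simp add: Y_def)
      also have "\<dots> = 0" using Y_toral[OF i(1)] Y_contact by (cases "i = j") auto
      finally show ?thesis by simp
    next
      case False
      then have "pq \<notin> internal P D" using internal_subset[of P D] by blast
      then show ?thesis using supportedD[OF X] by simp
    qed
  qed
qed

lemma contact_sufficient:
  assumes c: "card contact_indices = 1" and b: "(\<Sum>i\<in>{2..n}. rule_excess (\<rho> i)) = 0"
  shows "contact_poset P"
proof -
  obtain j where j: "contact_indices = {j}" using c by (auto simp: card_1_singleton_iff)
  then have jn: "j \<in> {1..n}" by (auto simp: contact_indices_def)
  have "e j 1 \<in> Field (T j)"
    using one_in_Field(1)[OF S_poset[OF jn] S_Field_nonempty[OF jn]]
      poset_copy.Field_copy[OF copy[OF jn]] by blast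
  then have v: "e j 1 \<in> V" using Field_T[OF jn] by blast
  have "T_edges i \<subseteq> crossing P D" if "i \<in> {1..n}" for i
    using T_edges_crossing[OF that] T_subset[OF that] by (fastforce simp: crossing_def)
  then have E: "(\<Union>i\<in>{1..n}. T_edges i) \<subseteq> crossing P D" by blast
  have "card (internal P D) = card (crossing P D) + 2" using P_excess c b by simp
  then show ?thesis
    by (rule contact_poset_if_trivial_kernel[OF P_poset down_P E v])
      (rule internal_kernel_trivial[OF j])
qed

end

theorem theorem35:
  fixes P :: "nat rel" and n :: nat
    and S Q :: "nat \<Rightarrow> nat rel" and \<phi> :: "nat \<Rightarrow> pmat \<Rightarrow> complex"
    and e :: "nat \<Rightarrow> nat \<Rightarrow> nat" and \<rho> :: "nat \<Rightarrow> glue_rule"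
  assumes "toral_poset P"
    and "construction_sequence P n S \<phi> Q e \<rho>"
  shows "contact_poset P \<longleftrightarrow>
    (\<exists>!i. i \<in> {1..n} \<and> contact_toral_pair (S i) (\<phi> i)) \<and>
    (\<forall>i\<in>{2..n}. \<rho> i \<in> {Rule_A1, Rule_A2, Rule_C, Rule_D1, Rule_D2, Rule_F})"
proof -
  let ?good = "\<lambda>i E. spanning_cut (S i) E \<and>
      (contact_toral_pair (S i) (\<phi> i) \<longrightarrow>
        contact_kernel (S i) E 1 \<and> (\<exists>k. card (S i) - 1 = 2 * k + 1)) \<and>
      (\<not> contact_toral_pair (S i) (\<phi> i) \<longrightarrow> frobenius_kernel (S i) E)"
  have "\<forall>i\<in>{1..n}. \<exists>E. ?good i E"
  proof
    fix i assume i: "i \<in> {1..n}"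
    show "\<exists>E. ?good i E"
    proof (cases "contact_toral_pair (S i) (\<phi> i)")
      case True
      from contact_toral_pair_cut[OF this] obtain E k where
        "spanning_cut (S i) E" "contact_kernel (S i) E 1" "card (S i) - 1 = 2 * k + 1" by blast
      then show ?thesis using True by (intro exI[of _ E]) auto
    next
      case False
      then have "toral_pair (S i) (\<phi> i)"
        using assms(2) i unfolding construction_sequence_def by blast
      from toral_pair_cut[OF this] obtain E where "spanning_cut (S i) E" "frobenius_kernel (S i) E"
        by blast
      then show ?thesis using False by (intro exI[of _ E]) auto
    qed
  qed
  from bchoice[OF this] obtain E where E: "\<forall>i\<in>{1..n}. ?good i (E i)" by (elim exE)
  interpret construction P n S Q \<phi> e \<rho> E
  proof
    show "construction_sequence P n S \<phi> Q e \<rho>" by (rule assms(2))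
    fix i assume "i \<in> {1..n}"
    note good = bspec[OF E this]
    show "spanning_cut (S i) (E i)" using good by (rule conjunct1)
    show "contact_kernel (S i) (E i) 1 \<and> (\<exists>k. card (S i) - 1 = 2 * k + 1)"
      if "contact_toral_pair (S i) (\<phi> i)" using good that by (simp only: simp_thms)
    show "frobenius_kernel (S i) (E i)" if "\<not> contact_toral_pair (S i) (\<phi> i)"
      using good that by (simp only: simp_thms)
  qed
  have "(\<exists>!i. i \<in> {1..n} \<and> contact_toral_pair (S i) (\<phi> i)) \<longleftrightarrow> card contact_indices = 1"
  proof -
    have mem: "(i \<in> {1..n} \<and> contact_toral_pair (S i) (\<phi> i)) = (i \<in> contact_indices)" for i
      by (simp add: contact_indices_def)
    show ?thesis
      unfolding mem unfolding One_nat_def card_1_singleton_iff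
    proof
      assume "\<exists>!i. i \<in> contact_indices"
      then obtain j where "j \<in> contact_indices" "\<And>i. i \<in> contact_indices \<Longrightarrow> i = j" by (elim ex1E) blast
      then have "contact_indices = {j}" by blast
      then show "\<exists>j. contact_indices = {j}" by (rule exI)
    qed (elim exE, simp)
  qed
  moreover have "(\<forall>i\<in>{2..n}. \<rho> i \<in> {Rule_A1, Rule_A2, Rule_C, Rule_D1, Rule_D2, Rule_F})
      \<longleftrightarrow> (\<Sum>i\<in>{2..n}. rule_excess (\<rho> i)) = 0"
    unfolding rule_excess_eq_0[symmetric] by simp
  ultimately show ?thesis using contact_necessary contact_sufficient by argo
qed

end
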